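(* Let $(R,\mathfrak{m})$ be a local Cohen-Macaulay ring of dimension $d>0$ with infinite residue field, and let $I$ be an $\mathfrak{m}$-primary ideal of $R$. Then the multiplicity $f_0$ of the special fiber ring $\mathcal{F}$ of $I$ satisfies $$f_0 \leq e_1 - e_0 + \lambda(R/\check{I}) + \mu(\check{I}) - d +1.$$
   Context: Local rings are Noetherian. $\lambda(\cdot)$ denotes length and $\mu(\cdot)$ minimal number of generators. The special fiber ring of $I$ is $\mathcal{F}=\mathcal{F}(I)=\bigoplus_{m\ge 0} I^m/\mathfrak{m}I^m$. Since $I$ is $\mathfrak m$-primary, $\dim\mathcal{F}=d$; for $m\gg 0$, $\mu(I^m)$ is a polynomial in $m$ of degree $d-1$, and the multiplicity $f_0=f_0(I)$ of $\mathcal{F}$ is its normalized leading coefficient, i.e. $\mu(I^m)=f_0\binom{m+d-1}{d-1}+(\text{terms of lower degree in } m)$ for $m\gg0$. The integers $e_0=e_0(I)$, $e_1=e_1(I)$ are the first two Hilbert coefficients of $I$: for $m\gg 0$, $\lambda(R/I^m)=e_0\binom{m+d-1}{d}-e_1\binom{m+d-2}{d-1}+\cdots+(-1)^d e_d$. The ideal $\check{I}$ is the largest ideal containing $I$ such that, in the exact sequence of $\mathcal{R}(I)$-modules $0\to\mathcal{R}(I)\to\mathcal{R}(\check{I})\to C\to 0$ given by the inclusion of Rees algebras ($\mathcal{R}(K)=R[Kt]=\bigoplus_{m\ge0}K^mt^m$), one has $\dim C\le d-1$. Equivalently, $\check I$ is the degree one component of the $S_2$-ification of $\mathcal{R}(I)$,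 and is the largest ideal containing $I$ with the same Hilbert coefficients $e_0$ and $e_1$ as $I$. *)

theory Defs
  imports
    "HOL-Algebra.UnivPoly"
    "HOL-Algebra.Ideal_Product"
    "HOL-Algebra.QuotRing"
    "HOL-Algebra.Ring_Divisibility"
    "HOL-Library.Extended_Real"
    Complex_Main
begin

definition self_module :: "('a, 'b) ring_scheme \<Rightarrow> ('a, 'a) module" where
  "self_module A = \<lparr>carrier = carrier A, monoid.mult = monoid.mult A, one = one A,
     zero = zero A, add = add A, smult = monoid.mult A\<rparr>"

text \<open>The record type of modules extends that of rings; the ring fields \<open>mult\<close> and \<open>one\<close>
  play no role for a module and are left unspecified.\<close>

definition quot_module :: "('r, 'a, 'c) module_scheme \<Rightarrow> 'a set \<Rightarrow> ('r, 'a set) module" where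
  "quot_module M N = \<lparr>carrier = a_rcosets\<^bsub>M\<^esub> N, monoid.mult = undefined, one = undefined,
     zero = N, add = set_add M,
     smult = (\<lambda>a X. \<Union>x\<in>X. N +>\<^bsub>M\<^esub> (a \<odot>\<^bsub>M\<^esub> x))\<rparr>"

definition module_length ::
    "('r, 'b) ring_scheme \<Rightarrow> ('r, 'a, 'c) module_scheme \<Rightarrow> enat" where
  "module_length A M = Sup {enat n | n. \<exists>N. (\<forall>i\<le>n. submodule (N i) A M) \<and>
     (\<forall>i<n. N i \<subset> N (Suc i))}"

definition annihilator ::
    "('r, 'b) ring_scheme \<Rightarrow> ('r, 'a, 'c) module_scheme \<Rightarrow> 'r set" where
  "annihilator A M = {a \<in> carrier A. \<forall>x\<in>carrier M. a \<odot>\<^bsub>M\<^esub> x = \<zero>\<^bsub>M\<^esub>}"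

text \<open>The values lie in the extended reals, so that the zero ring and the zero module
  (suprema of the empty set) have dimension \<open>-\<infinity>\<close>.\<close>

definition krull_dim :: "('a, 'b) ring_scheme \<Rightarrow> ereal" where
  "krull_dim A = Sup {ereal (real n) | n. \<exists>P. (\<forall>i\<le>n. primeideal (P i) A) \<and>
     (\<forall>i<n. P i \<subset> P (Suc i))}"

definition module_dim ::
    "('r, 'b) ring_scheme \<Rightarrow> ('r, 'a, 'c) module_scheme \<Rightarrow> ereal" where
  "module_dim A M = krull_dim (A Quot annihilator A M)"

definition regular_sequence :: "('a, 'b) ring_scheme \<Rightarrow> 'a list \<Rightarrow> bool" where
  "regular_sequence R xs \<longleftrightarrow> set xs \<subseteq> carrier R \<and> genideal R (set xs) \<noteq> carrier R \<and>
     (\<forall>i<length xs. \<forall>a\<in>carrier R.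
        xs ! i \<otimes>\<^bsub>R\<^esub> a \<in> genideal R (set (take i xs)) \<longrightarrow> a \<in> genideal R (set (take i xs)))"

definition depth :: "('a, 'b) ring_scheme \<Rightarrow> 'a set \<Rightarrow> ereal" where
  "depth R J = Sup {ereal (real (length xs)) | xs. set xs \<subseteq> J \<and> regular_sequence R xs}"

locale noetherian_local_ring = cring R + noetherian_ring R
  for R (structure) and \<mm> +
  assumes maximal: "maximalideal \<mm> R"
    and unique_maximal: "maximalideal M R \<Longrightarrow> M = \<mm>"

locale cohen_macaulay_local_ring = noetherian_local_ring +
  assumes depth_eq_dim: "depth R \<mm> = krull_dim R"

abbreviation ideal_power :: "('a, 'b) ring_scheme \<Rightarrow> 'a set \<Rightarrow> nat \<Rightarrow> 'a set" where
  "ideal_power R K m \<equiv> K [^]\<^bsub>ideals_set R\<^esub> m"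

definition radical :: "('a, 'b) ring_scheme \<Rightarrow> 'a set \<Rightarrow> 'a set" where
  "radical R Q = {a \<in> carrier R. \<exists>n::nat. a [^]\<^bsub>R\<^esub> n \<in> Q}"

definition primary_ideal :: "'a set \<Rightarrow> ('a, 'b) ring_scheme \<Rightarrow> bool" where
  "primary_ideal Q R \<longleftrightarrow> ideal Q R \<and> Q \<noteq> carrier R \<and>
     (\<forall>a\<in>carrier R. \<forall>b\<in>carrier R. a \<otimes>\<^bsub>R\<^esub> b \<in> Q \<longrightarrow> a \<in> Q \<or> b \<in> radical R Q)"

definition primary_to :: "('a, 'b) ring_scheme \<Rightarrow> 'a set \<Rightarrow> 'a set \<Rightarrow> bool" where
  "primary_to R P Q \<longleftrightarrow> primary_ideal Q R \<and> radical R Q = P"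

definition min_gens :: "('a, 'b) ring_scheme \<Rightarrow> 'a set \<Rightarrow> nat" where
  "min_gens R K = (LEAST n. \<exists>S \<subseteq> carrier R. finite S \<and> card S = n \<and> K = genideal R S)"

text \<open>The length of \<open>R/K\<close> as a natural number; it is only meaningful when that length is
  finite, as it is for every ideal containing a power of the maximal ideal of a Noetherian
  local ring.\<close>

definition colength :: "('a, 'b) ring_scheme \<Rightarrow> 'a set \<Rightarrow> nat" where
  "colength R K = the_enat (module_length R (quot_module (self_module R) K))"

text \<open>In the following two definitions \<open>d\<close> is the dimension of \<open>R\<close>. The side condition
  \<open>e i = 0\<close> for \<open>i > d\<close> only serves to make the function \<open>e\<close> unique.\<close>

definition hilbert_coeff :: "('a, 'b) ring_scheme \<Rightarrow> nat \<Rightarrow> 'a set \<Rightarrow> nat \<Rightarrow> int" where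
  "hilbert_coeff R d I = (THE e. (\<forall>i>d. e i = 0) \<and>
     (\<forall>\<^sub>F m in sequentially. int (colength R (ideal_power R I m)) =
        (\<Sum>i\<le>d. (-1) ^ i * e i * int ((m + d - 1 - i) choose (d - i)))))"

text \<open>The degree \<open>m\<close> component \<open>I\<^sup>m/\<mm>I\<^sup>m\<close> of the special fiber ring of \<open>I\<close> is a vector space
  of dimension \<open>\<mu>(I\<^sup>m)\<close> over the residue field. Its multiplicity is the normalized leading
  coefficient, in degree \<open>d - 1\<close>, of the polynomial which gives \<open>\<mu>(I\<^sup>m)\<close> for large \<open>m\<close>; the sum
  over \<open>j\<close> collects the terms of lower degree.\<close>

definition fiber_multiplicity :: "('a, 'b) ring_scheme \<Rightarrow> nat \<Rightarrow> 'a set \<Rightarrow> int" where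
  "fiber_multiplicity R d I = (THE f. \<exists>c :: nat \<Rightarrow> real.
     \<forall>\<^sub>F m in sequentially. real (min_gens R (ideal_power R I m)) =
        real_of_int f * real ((m + d - 1) choose (d - 1)) + (\<Sum>j<d - 1. c j * real m ^ j))"

definition rees_algebra :: "('a, 'b) ring_scheme \<Rightarrow> 'a set \<Rightarrow> ('a, nat \<Rightarrow> 'a) up_ring" where
  "rees_algebra R K =
     (UP R)\<lparr>carrier := {p \<in> carrier (UP R). \<forall>m. coeff (UP R) p m \<in> ideal_power R K m}\<rparr>"

text \<open>The cokernel of the inclusion of Rees algebras, for \<open>I \<subseteq> K\<close>, as a module over the Rees
  algebra of \<open>I\<close>.\<close>

definition rees_cokernel ::
    "('a, 'b) ring_scheme \<Rightarrow> 'a set \<Rightarrow> 'a set \<Rightarrow> (nat \<Rightarrow> 'a, (nat \<Rightarrow> 'a) set) module" where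
  "rees_cokernel R I K =
     quot_module (self_module (rees_algebra R K)) (carrier (rees_algebra R I))"

text \<open>The largest ideal \<open>K \<supseteq> I\<close> for which this cokernel has dimension at most \<open>d - 1\<close>; the
  admissible ideals are closed under sums, so that it exists if \<open>R\<close> is Noetherian.\<close>

definition check_ideal :: "('a, 'b) ring_scheme \<Rightarrow> nat \<Rightarrow> 'a set \<Rightarrow> 'a set" where
  "check_ideal R d I = (GREATEST K. ideal K R \<and> I \<subseteq> K \<and>
     module_dim (rees_algebra R I) (rees_cokernel R I K) \<le> ereal (real d - 1))"

end

theory Submission
  imports Defs "HOL-Algebra.Subrings"
begin

text \<open>Let \<open>K\<close> be the check ideal of \<open>I\<close>. Its Rees cokernel \<open>C\<close> is annihilated by a nonzerodivisor, since \<open>R\<close> is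
  unmixed; hence \<open>K\<close> is integral over \<open>I\<close>, \<open>C\<close> is finitely generated, and \<open>\<lambda>(K\<^sup>m/I\<^sup>m)\<close> is of
  degree at most \<open>d - 2\<close>. As \<open>\<mu>(I\<^sup>m) \<le> \<mu>(K\<^sup>m) + \<mu>(\<mm>) \<lambda>(K\<^sup>m/I\<^sup>m)\<close>, and as \<open>I\<close> and \<open>K\<close> share \<open>e\<^sub>0\<close> and
  \<open>e\<^sub>1\<close>, it suffices to estimate \<open>\<mu>(K\<^sup>m)\<close>. A superficial sequence \<open>J = (a\<^sub>1, \<dots>, a\<^sub>d)\<close> in \<open>K\<close> is regular,
  \<open>\<lambda>(R/J) = e\<^sub>0\<close>, and its elements are independent modulo \<open>\<mm>K\<close>. Then
  \<open>\<mu>(K\<^sup>m\<^sup>+\<^sup>1) \<le> \<lambda>(K\<^sup>m\<^sup>+\<^sup>1/J\<^sup>mK) + \<lambda>((J\<^sup>mK + \<mm>K\<^sup>m\<^sup>+\<^sup>1)/\<mm>K\<^sup>m\<^sup>+\<^sup>1)\<close>, where both lengths are bounded by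
  counting monomials in the \<open>a\<^sub>i\<close>; the first summand is the Hilbert function of the Sally module.

  All modules that occur are subquotients of \<open>R[t]\<close>. They are represented by sequences of ideals of
  \<open>R\<close>, and lengths by chains of ideals.\<close>

subsection \<open>Ideal arithmetic\<close>

text \<open>The hypothesis on the cokernel speaks of chains of primes in the Rees algebra, the
  estimate needs the growth of \<lambda>(K^m/I^m). The bridge is the conductor of R(K) into R(I): if
  I^m modulo the conductor were not O(m^(d-2)), homogeneous primes could be stacked over it to a
  chain of length d. The constants are coefficients of (m+d-1 choose d-1). Generators lying in
  J^(m+1) cost at most one per monomial of degree m+1, hence the 1. The rest of J^m K costs
  \<lambda>(K/(J + \<mm>K)) per monomial of degree m, at most \<mu>(K) - d by independence. The
  layer J^m/J^m K gives \<lambda>(R/K). Finally, e_0 (m+d-1 choose d) - \<lambda>(R/K^(m+1)) has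
  leading coefficient e_1 - e_0, as the Hilbert polynomial at m+1 starts with e_0 (m+d choose d).
  Equality of e_1 for I and K is not a separate step: the Hilbert polynomial of I is inserted with
  defect \<lambda>(K^m/I^m), which vanishes in the limit. All generic choices rest on one fact: over
  an infinite residue field finitely many proper subideals, prime or not, do not cover an
  ideal.\<close>

context cring
begin

abbreviation idl :: "'a set \<Rightarrow> bool" where "idl J \<equiv> ideal J R"

abbreviation ideal_sum :: "'a set \<Rightarrow> 'a set \<Rightarrow> 'a set" (infixl \<open>\<boxplus>\<close> 65)
  where "A \<boxplus> B \<equiv> A <+>\<^bsub>R\<^esub> B"

lemma idl_subset: "idl J \<Longrightarrow> J \<subseteq> carrier R"
  by (simp add: additive_subgroup.a_subset ideal.axioms(1))

lemma idl_carr: "idl J \<Longrightarrow> a \<in> J \<Longrightarrow> a \<in> carrier R"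
  using idl_subset by blast

lemma idl_zero: "idl J \<Longrightarrow> \<zero> \<in> J"
  by (simp add: additive_subgroup.zero_closed ideal.axioms(1))

lemma idl_add: "idl J \<Longrightarrow> a \<in> J \<Longrightarrow> b \<in> J \<Longrightarrow> a \<oplus> b \<in> J"
  by (simp add: additive_subgroup.a_closed ideal.axioms(1))

lemma idl_neg: "idl J \<Longrightarrow> a \<in> J \<Longrightarrow> \<ominus> a \<in> J"
  by (simp add: additive_subgroup.a_inv_closed ideal.axioms(1))

lemma idl_minus: "idl J \<Longrightarrow> a \<in> J \<Longrightarrow> b \<in> J \<Longrightarrow> a \<ominus> b \<in> J"
  by (simp add: a_minus_def idl_add idl_neg)

lemma idl_lmult: "idl J \<Longrightarrow> a \<in> J \<Longrightarrow> x \<in> carrier R \<Longrightarrow> x \<otimes> a \<in> J"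
  by (simp add: ideal.I_l_closed)

lemma idl_rmult: "idl J \<Longrightarrow> a \<in> J \<Longrightarrow> x \<in> carrier R \<Longrightarrow> a \<otimes> x \<in> J"
  by (simp add: ideal.I_r_closed)

lemmas idl_rules = idl_zero idl_add idl_neg idl_minus idl_lmult idl_rmult

lemma idlI:
  assumes "J \<subseteq> carrier R" "\<zero> \<in> J" "\<And>a b. a \<in> J \<Longrightarrow> b \<in> J \<Longrightarrow> a \<oplus> b \<in> J"
    and "\<And>a x. a \<in> J \<Longrightarrow> x \<in> carrier R \<Longrightarrow> x \<otimes> a \<in> J"
  shows "idl J"
proof (rule idealI)
  show "ring R" by (rule ring_axioms)
  have neg: "\<ominus> a \<in> J" if "a \<in> J" for a
  proof -
    have a: "a \<in> carrier R" using that assms(1) by blast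
    have "(\<ominus> \<one>) \<otimes> a \<in> J" using assms(4)[OF that] by simp
    moreover have "(\<ominus> \<one>) \<otimes> a = \<ominus> a" using a l_minus[of "\<one>" a] by simp
    ultimately show ?thesis by simp
  qed
  show "subgroup J (add_monoid R)"
    by (rule subgroup.intro) (use assms neg in \<open>auto simp: a_inv_def[symmetric]\<close>)
  show "x \<otimes> a \<in> J" if "a \<in> J" "x \<in> carrier R" for a x using assms that by blast
  show "a \<otimes> x \<in> J" if "a \<in> J" "x \<in> carrier R" for a x
    using assms(4)[OF that] assms(1) that m_comm[of a x] by auto
qed

lemma idl_one_eq: "idl J \<Longrightarrow> \<one> \<in> J \<Longrightarrow> J = carrier R"
  by (simp add: ideal.one_imp_carrier)

lemma idl_cancel_add: "idl J \<Longrightarrow> a \<oplus> b \<in> J \<Longrightarrow> b \<in> J \<Longrightarrow> a \<in> carrier R \<Longrightarrow> a \<in> J"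
  by (metis a_minus_def add.inv_solve_right idl_carr idl_minus add.m_closed minus_eq)

lemma idl_Int: "idl A \<Longrightarrow> idl B \<Longrightarrow> idl (A \<inter> B)"
  by (rule i_intersect)

lemma mem_sum: "z \<in> A \<boxplus> B \<longleftrightarrow> (\<exists>a\<in>A. \<exists>b\<in>B. z = a \<oplus> b)"
  by (auto simp: set_add_def')

lemma sumI: "a \<in> A \<Longrightarrow> b \<in> B \<Longrightarrow> a \<oplus> b \<in> A \<boxplus> B"
  by (auto simp: mem_sum)

lemma sum_ub1: "idl A \<Longrightarrow> idl B \<Longrightarrow> A \<subseteq> A \<boxplus> B"
  using idl_zero idl_carr by (metis mem_sum r_zero subsetI)

lemma sum_ub2: "idl A \<Longrightarrow> idl B \<Longrightarrow> B \<subseteq> A \<boxplus> B"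
  using idl_zero idl_carr by (metis mem_sum l_zero subsetI)

lemma sum_le: "A \<subseteq> C \<Longrightarrow> B \<subseteq> C \<Longrightarrow> idl C \<Longrightarrow> A \<boxplus> B \<subseteq> C"
  by (auto simp: set_add_def' subset_iff intro!: idl_add)

lemma sum_mono: "A \<subseteq> A' \<Longrightarrow> B \<subseteq> B' \<Longrightarrow> A \<boxplus> B \<subseteq> A' \<boxplus> B'"
  unfolding set_add_def' by blast

lemma sum_absorb1: "idl A \<Longrightarrow> idl B \<Longrightarrow> B \<subseteq> A \<Longrightarrow> A \<boxplus> B = A"
  by (simp add: subset_antisym sum_le sum_ub1)

lemma sum_absorb2: "idl A \<Longrightarrow> idl B \<Longrightarrow> A \<subseteq> B \<Longrightarrow> A \<boxplus> B = B"
  by (simp add: subset_antisym sum_le sum_ub2)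

lemma sum_comm: "idl A \<Longrightarrow> idl B \<Longrightarrow> A \<boxplus> B = B \<boxplus> A"
  using idl_subset set_add_comm by blast

lemma sum_assoc: "idl A \<Longrightarrow> idl B \<Longrightarrow> idl C \<Longrightarrow> (A \<boxplus> B) \<boxplus> C = A \<boxplus> (B \<boxplus> C)"
proof (rule subset_antisym)
  assume i: "idl A" "idl B" "idl C"
  hence j: "idl (A \<boxplus> B)" "idl (B \<boxplus> C)" "idl ((A \<boxplus> B) \<boxplus> C)" "idl (A \<boxplus> (B \<boxplus> C))"
    by (simp_all add: add_ideals)
  note u = sum_ub1[OF i(1,2)] sum_ub2[OF i(1,2)] sum_ub1[OF i(2,3)] sum_ub2[OF i(2,3)]
    sum_ub1[OF j(1) i(3)] sum_ub2[OF j(1) i(3)] sum_ub1[OF i(1) j(2)] sum_ub2[OF i(1) j(2)]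
  show "(A \<boxplus> B) \<boxplus> C \<subseteq> A \<boxplus> (B \<boxplus> C)" using u by (intro sum_le j) auto
  show "A \<boxplus> (B \<boxplus> C) \<subseteq> (A \<boxplus> B) \<boxplus> C" using u by (intro sum_le j) auto
qed

lemma prodI: "a \<in> A \<Longrightarrow> b \<in> B \<Longrightarrow> a \<otimes> b \<in> A \<cdot> B"
  by (rule ideal_prod.prod)

lemma prod_le:
  assumes "idl C" "\<And>a b. a \<in> A \<Longrightarrow> b \<in> B \<Longrightarrow> a \<otimes> b \<in> C"
  shows "A \<cdot> B \<subseteq> C"
proof
  fix s assume "s \<in> A \<cdot> B"
  thus "s \<in> C" by induct (use assms idl_add in auto)
qed

lemma prod_mono: 
  assumes "A \<subseteq> A'" "B \<subseteq> B'" shows "A \<cdot> B \<subseteq> A' \<cdot> B'"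
proof
  fix s assume "s \<in> A \<cdot> B"
  thus "s \<in> A' \<cdot> B'" by induct (use assms in \<open>auto intro: ideal_prod.intros\<close>)
qed

lemma prod_subset1: "idl A \<Longrightarrow> idl B \<Longrightarrow> A \<cdot> B \<subseteq> A"
  using ideal_prod_inter by blast

lemma prod_subset2: "idl A \<Longrightarrow> idl B \<Longrightarrow> A \<cdot> B \<subseteq> B"
  using ideal_prod_inter by blast

lemma prod_sum_l: "idl A \<Longrightarrow> idl B \<Longrightarrow> idl C \<Longrightarrow> (A \<boxplus> B) \<cdot> C = A \<cdot> C \<boxplus> B \<cdot> C"
  by (metis add_ideals ideal_prod_commute ideal_prod_distr)

lemma prod_sum_r: "idl A \<Longrightarrow> idl B \<Longrightarrow> idl C \<Longrightarrow> A \<cdot> (B \<boxplus> C) = A \<cdot> B \<boxplus> A \<cdot> C"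
  by (rule ideal_prod_distr)

lemma prod_carr_l: "idl A \<Longrightarrow> carrier R \<cdot> A = A"
  using ideal_prod_commute ideal_prod_one oneideal by auto

section \<open>Multiples of an ideal by one element\<close>

definition mulset :: "'a \<Rightarrow> 'a set \<Rightarrow> 'a set" where
  "mulset x W = (\<lambda>w. x \<otimes> w) ` W"

lemma mulset_idl: "x \<in> carrier R \<Longrightarrow> idl W \<Longrightarrow> idl (mulset x W)"
proof (rule idlI)
  assume x: "x \<in> carrier R" and W: "idl W"
  note c = idl_carr[OF W]
  show "mulset x W \<subseteq> carrier R" using x c by (auto simp: mulset_def)
  show "\<zero> \<in> mulset x W" using x idl_zero[OF W] by (force simp: mulset_def)
  show "a \<oplus> b \<in> mulset x W" if "a \<in> mulset x W" "b \<in> mulset x W" for a b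
    using that idl_add[OF W] c x by (auto simp: mulset_def r_distr[symmetric])
  show "y \<otimes> a \<in> mulset x W" if a: "a \<in> mulset x W" and y: "y \<in> carrier R" for a y
  proof -
    obtain w where "w \<in> W" "a = x \<otimes> w" using a by (auto simp: mulset_def)
    thus ?thesis using idl_lmult[OF W, of w y] c x y m_lcomm[of y x w] by (auto simp: mulset_def)
  qed
qed

lemma mulset_mono: "W \<subseteq> W' \<Longrightarrow> mulset x W \<subseteq> mulset x W'"
  by (auto simp: mulset_def)

lemma mulsetI: "w \<in> W \<Longrightarrow> x \<otimes> w \<in> mulset x W"
  by (auto simp: mulset_def)

lemma mulset_prod: "idl A \<Longrightarrow> idl B \<Longrightarrow> x \<in> carrier R \<Longrightarrow> mulset x (A \<cdot> B) = mulset x A \<cdot> B"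
proof (rule subset_antisym)
  assume A: "idl A" "idl B" "x \<in> carrier R"
  show "mulset x (A \<cdot> B) \<subseteq> mulset x A \<cdot> B"
  proof
    fix z assume "z \<in> mulset x (A \<cdot> B)"
    then obtain w where w: "w \<in> A \<cdot> B" "z = x \<otimes> w" by (auto simp: mulset_def)
    have "x \<otimes> w \<in> mulset x A \<cdot> B" using w(1)
    proof induct
      case (prod i j)
      have "x \<otimes> (i \<otimes> j) = (x \<otimes> i) \<otimes> j" using prod A idl_carr m_assoc by simp
      thus ?case using prod by (simp add: mulsetI prodI)
    next
      case (sum s1 s2)
      have "s1 \<in> carrier R" "s2 \<in> carrier R" using sum ideal_prod_in_carrier A by blast+
      thus ?case using sum A by (simp add: r_distr ideal_prod.sum)
    qed
    thus "z \<in> mulset x A \<cdot> B" using w by simp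
  qed
  show "mulset x A \<cdot> B \<subseteq> mulset x (A \<cdot> B)"
  proof (rule prod_le)
    show "idl (mulset x (A \<cdot> B))" using A by (simp add: ideal_prod_is_ideal mulset_idl)
    fix a b assume ab: "a \<in> mulset x A" "b \<in> B"
    then obtain a' where a': "a' \<in> A" "a = x \<otimes> a'" by (auto simp: mulset_def)
    have "a \<otimes> b = x \<otimes> (a' \<otimes> b)" using a' ab A idl_carr m_assoc by simp
    thus "a \<otimes> b \<in> mulset x (A \<cdot> B)" using a' ab by (simp add: mulsetI prodI)
  qed
qed

lemma mulset_carrier: "x \<in> carrier R \<Longrightarrow> mulset x (carrier R) = PIdl x"
  by (auto simp: mulset_def cgenideal_def m_comm)

lemma pid_prod: "x \<in> carrier R \<Longrightarrow> idl W \<Longrightarrow> (PIdl x) \<cdot> W = mulset x W"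
  using mulset_prod[OF oneideal, of W x] by (simp add: mulset_carrier prod_carr_l)

lemma pid_idl: "x \<in> carrier R \<Longrightarrow> idl (PIdl x)"
  by (rule cgenideal_ideal)

lemma pid_self: "x \<in> carrier R \<Longrightarrow> x \<in> PIdl x"
  by (rule cgenideal_self)

lemma pid_le: "idl J \<Longrightarrow> x \<in> J \<Longrightarrow> PIdl x \<subseteq> J"
  by (rule cgenideal_minimal)

lemma pid_mem: "z \<in> PIdl x \<longleftrightarrow> (\<exists>r\<in>carrier R. z = r \<otimes> x)"
  by (auto simp: cgenideal_def)

lemma genideal_insert:
  assumes "S \<subseteq> carrier R" "x \<in> carrier R"
  shows "Idl (insert x S) = PIdl x \<boxplus> Idl S"
proof (rule subset_antisym)
  have i: "idl (PIdl x)" "idl (Idl S)" using assms by (simp_all add: pid_idl genideal_ideal)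
  show "Idl (insert x S) \<subseteq> PIdl x \<boxplus> Idl S"
  proof (rule genideal_minimal)
    show "idl (PIdl x \<boxplus> Idl S)" using i by (rule add_ideals)
    show "insert x S \<subseteq> PIdl x \<boxplus> Idl S"
      using sum_ub1[OF i] sum_ub2[OF i] pid_self[OF assms(2)] genideal_self[OF assms(1)] by blast
  qed
  have "idl (Idl (insert x S))" using assms by (simp add: genideal_ideal)
  moreover have "insert x S \<subseteq> Idl (insert x S)" by (rule genideal_self) (use assms in auto)
  ultimately show "PIdl x \<boxplus> Idl S \<subseteq> Idl (insert x S)"
    by (intro sum_le pid_le genideal_minimal) auto
qed

lemma genideal_empty: "Idl {} = {\<zero>}"
proof (rule subset_antisym)
  show "Idl {} \<subseteq> {\<zero>}" by (rule genideal_minimal) (simp_all add: zeroideal)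
  show "{\<zero>} \<subseteq> Idl {}" using idl_zero[OF genideal_ideal[of "{}"]] by simp
qed

subsection \<open>Powers\<close>

definition pw :: "'a set \<Rightarrow> nat \<Rightarrow> 'a set" where "pw K m = ideal_power R K m"

lemma pw_0 [simp]: "pw K 0 = carrier R"
  by (simp add: pw_def ideals_set_def nat_pow_def)

lemma pw_Suc: "pw K (Suc m) = pw K m \<cdot> K"
  by (simp add: pw_def ideals_set_def nat_pow_def)

lemma pw_idl: "idl K \<Longrightarrow> idl (pw K m)"
  by (induct m) (auto simp: pw_Suc oneideal ideal_prod_is_ideal)

lemma pw_Suc2: "idl K \<Longrightarrow> pw K (Suc m) = K \<cdot> pw K m"
  using ideal_prod_commute pw_Suc pw_idl by auto

lemma pw_1: "idl K \<Longrightarrow> pw K (Suc 0) = K"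
  by (simp add: pw_Suc prod_carr_l)

lemma pw_add: "idl K \<Longrightarrow> pw K (m + n) = pw K m \<cdot> pw K n"
proof (induct n)
  case 0 thus ?case by (simp add: pw_idl ideal_prod_one)
next
  case (Suc n) thus ?case by (simp add: pw_Suc ideal_prod_assoc pw_idl)
qed

lemma pw_antimono: "idl K \<Longrightarrow> m \<le> n \<Longrightarrow> pw K n \<subseteq> pw K m"
  using pw_add[of K m "n - m"] prod_subset1[of "pw K m" "pw K (n - m)"] pw_idl by simp

lemma pw_mono: "K \<subseteq> K' \<Longrightarrow> pw K m \<subseteq> pw K' m"
  by (induct m) (simp_all add: pw_Suc prod_mono)

lemma pw_le: "idl K \<Longrightarrow> m > 0 \<Longrightarrow> pw K m \<subseteq> K"
  using pw_antimono[of K "Suc 0" m] pw_1 by simp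

lemma pw_memI: "idl K \<Longrightarrow> a \<in> K \<Longrightarrow> a [^] (n::nat) \<in> pw K n"
  by (induct n) (auto simp: pw_Suc prodI)

lemma pw_carrier: "pw (carrier R) m = carrier R"
  by (induct m) (auto simp: pw_Suc oneideal ideal_prod_one)

text \<open>The preimage of \<open>N\<close> in \<open>W\<close> under multiplication by
  \<open>x\<close>, so that W/colon_in N x W is isomorphic to (N + xW)/N. For
  \<open>W = carrier R\<close> it is the colon ideal (N : x), the annihilator of x modulo N.\<close>

definition colon_in :: "'a set \<Rightarrow> 'a \<Rightarrow> 'a set \<Rightarrow> 'a set" where
  "colon_in N x W = {w \<in> W. x \<otimes> w \<in> N}"

lemma colon_in_idl:
  assumes "idl N" "x \<in> carrier R" "idl W" shows "idl (colon_in N x W)"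
  by (rule idlI)
     (use assms in \<open>auto simp: colon_in_def r_distr m_lcomm[of x] idl_carr intro: idl_rules\<close>)

lemma colon_in_subset: "colon_in N x W \<subseteq> W"
  by (auto simp: colon_in_def)

end

subsection \<open>Length of an interval of ideals\<close>

text \<open>Measures the module M/N without forming a quotient. Steps are peeled off at the top, so
  that inductions lower \<open>M\<close> while \<open>N\<close> stays fixed.\<close>

fun ideal_chain :: "('a, 'b) ring_scheme \<Rightarrow> 'a set \<Rightarrow> 'a set \<Rightarrow> nat \<Rightarrow> bool" where
  "ideal_chain R N M 0 = True"
| "ideal_chain R N M (Suc n) = (\<exists>B. ideal B R \<and> N \<subseteq> B \<and> B \<subset> M \<and> ideal_chain R N B n)"

definition ideal_length :: "('a, 'b) ring_scheme \<Rightarrow> 'a set \<Rightarrow> 'a set \<Rightarrow> enat" where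
  "ideal_length R N M = Sup {enat n | n. ideal_chain R N M n}"

context cring
begin

abbreviation "ichain \<equiv> ideal_chain R"
abbreviation "len \<equiv> ideal_length R"

lemma ichain_mono: "ichain N M n \<Longrightarrow> M \<subseteq> M' \<Longrightarrow> ichain N M' n"
  by (cases n) (simp, simp, blast)

lemma ichain_Suc_D: "ichain N M (Suc n) \<Longrightarrow> ichain N M n"
proof (induct n arbitrary: M)
  case 0 thus ?case by simp
next
  case (Suc n)
  then obtain B where B: "idl B" "N \<subseteq> B" "B \<subset> M" "ichain N B (Suc n)" by auto
  thus ?case using Suc(1)[OF B(4)] by auto
qed

lemma ichain_le: "ichain N M n \<Longrightarrow> k \<le> n \<Longrightarrow> ichain N M k"
proof (induct n)
  case (Suc n) thus ?case using ichain_Suc_D le_Suc_eq by blast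
qed simp

text \<open>Turns comparisons of suprema into statements about chains of one finite length. From
  left to right it uses that shorter chains exist whenever longer ones do.\<close>

lemma enat_le_len: "enat n \<le> len N M \<longleftrightarrow> ichain N M n"
proof
  assume "ichain N M n" thus "enat n \<le> len N M" unfolding ideal_length_def by (auto intro: Sup_upper)
next
  assume *: "enat n \<le> len N M"
  show "ichain N M n"
  proof (rule ccontr)
    assume n: "\<not> ichain N M n"
    hence "n \<noteq> 0" by (metis ideal_chain.simps(1))
    have "k \<le> n - 1" if "ichain N M k" for k using ichain_le[OF that, of n] n by linarith
    hence "len N M \<le> enat (n - 1)" unfolding ideal_length_def by (auto intro!: Sup_least)
    hence "enat n \<le> enat (n - 1)" using * by order
    thus False using \<open>n \<noteq> 0\<close> by simp
  qed
qed

lemma enat_eqI: "(\<And>n. enat n \<le> a \<longleftrightarrow> enat n \<le> b) \<Longrightarrow> a = b"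
proof -
  assume *: "\<And>n. enat n \<le> a \<longleftrightarrow> enat n \<le> b"
  show "a = b"
  proof (cases a)
    case (enat x)
    show ?thesis
    proof (cases b)
      case (enat y) thus ?thesis using *[of x] *[of y] \<open>a = enat x\<close> by auto
    next
      case infinity thus ?thesis using *[of "Suc x"] \<open>a = enat x\<close> by auto
    qed
  next
    case infinity
    show ?thesis
    proof (cases b)
      case (enat y) thus ?thesis using *[of "Suc y"] infinity by auto
    qed (simp add: infinity)
  qed
qed

lemma enat_leI: "(\<And>n. enat n \<le> a \<Longrightarrow> enat n \<le> b) \<Longrightarrow> a \<le> b"
proof -
  assume *: "\<And>n. enat n \<le> a \<Longrightarrow> enat n \<le> b"
  show "a \<le> b"
  proof (cases a)
    case (enat x) thus ?thesis using *[of x] by auto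
  next
    case infinity
    show ?thesis
    proof (cases b)
      case (enat y) thus ?thesis using *[of "Suc y"] infinity by auto
    qed simp
  qed
qed

lemma enat_le_add: "enat n \<le> a + b \<longleftrightarrow> (\<exists>i j. n = i + j \<and> enat i \<le> a \<and> enat j \<le> b)"
proof
  assume *: "enat n \<le> a + b"
  show "\<exists>i j. n = i + j \<and> enat i \<le> a \<and> enat j \<le> b"
  proof (cases "enat n \<le> a")
    case True thus ?thesis by (intro exI[of _ n] exI[of _ 0]) (simp add: zero_enat_def[symmetric])
  next
    case False
    then obtain x where x: "a = enat x" "x < n" by (cases a) auto
    have "enat (n - x) \<le> b" using * x by (cases b) auto
    thus ?thesis using x by (intro exI[of _ x] exI[of _ "n - x"]) simp
  qed
next
  assume "\<exists>i j. n = i + j \<and> enat i \<le> a \<and> enat j \<le> b"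
  then obtain i j where "n = i + j" "enat i \<le> a" "enat j \<le> b" by blast
  thus "enat n \<le> a + b" using add_mono[of "enat i" a "enat j" b] by simp
qed

lemma ichain_map:
  assumes "\<And>B. idl B \<Longrightarrow> N \<subseteq> B \<Longrightarrow> B \<subseteq> M \<Longrightarrow> idl (\<phi> B) \<and> N' \<subseteq> \<phi> B"
    and "\<And>B C. idl B \<Longrightarrow> idl C \<Longrightarrow> N \<subseteq> B \<Longrightarrow> B \<subset> C \<Longrightarrow> C \<subseteq> M \<Longrightarrow> \<phi> B \<subset> \<phi> C"
    and "ichain N M n" "idl M" "\<phi> M \<subseteq> M'"
  shows "ichain N' M' n"
proof -
  have "ichain N' (\<phi> C) n" if "ichain N C n" "idl C" "C \<subseteq> M" for C
    using that
  proof (induct n arbitrary: C)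
    case (Suc n)
    then obtain B where B: "idl B" "N \<subseteq> B" "B \<subset> C" "ichain N B n" by auto
    hence BM: "B \<subseteq> M" using Suc(4) by auto
    have "ichain N' (\<phi> B) n" by (rule Suc(1)[OF B(4) B(1) BM])
    moreover have "\<phi> B \<subset> \<phi> C" by (rule assms(2)[OF B(1) Suc(3) B(2,3) Suc(4)])
    moreover have "idl (\<phi> B)" "N' \<subseteq> \<phi> B" using assms(1)[OF B(1,2) BM] by auto
    ultimately show ?case by auto
  qed simp
  from this[OF assms(3,4)] show ?thesis using ichain_mono[OF _ assms(5)] by simp
qed

lemma len_le_map:
  assumes "\<And>B. idl B \<Longrightarrow> N \<subseteq> B \<Longrightarrow> B \<subseteq> M \<Longrightarrow> idl (\<phi> B) \<and> N' \<subseteq> \<phi> B"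
    and "\<And>B C. idl B \<Longrightarrow> idl C \<Longrightarrow> N \<subseteq> B \<Longrightarrow> B \<subset> C \<Longrightarrow> C \<subseteq> M \<Longrightarrow> \<phi> B \<subset> \<phi> C"
    and "idl M" "\<phi> M \<subseteq> M'"
  shows "len N M \<le> len N' M'"
  by (rule enat_leI, unfold enat_le_len) (rule ichain_map[of N M \<phi> N'], use assms in auto)

lemma len_mono: 
  assumes "N' \<subseteq> N" "M \<subseteq> M'" "idl M" shows "len N M \<le> len N' M'"
  by (rule len_le_map[where \<phi> = "\<lambda>x. x"]) (use assms in auto)

text \<open>Isomorphism theorem for multiplication by \<open>x\<close>: chains travel one way by
  taking preimages and the other way by taking images, both strictly monotone on the intervals in
  question.\<close>

lemma len_mult:
  assumes N: "idl N" and W: "idl W" and x: "x \<in> carrier R"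
  shows "len N (N \<boxplus> mulset x W) = len (colon_in N x W) W"
proof (rule antisym)
  have xW: "idl (mulset x W)" using W x by (simp add: mulset_idl)
  show "len N (N \<boxplus> mulset x W) \<le> len (colon_in N x W) W"
  proof (rule len_le_map[where \<phi> = "\<lambda>B. colon_in B x W"])
    show "idl (N \<boxplus> mulset x W)" using N xW by (rule add_ideals)
    show "colon_in (N \<boxplus> mulset x W) x W \<subseteq> W" by (rule colon_in_subset)
    fix B assume B: "idl B" "N \<subseteq> B"
    thus "idl (colon_in B x W) \<and> colon_in N x W \<subseteq> colon_in B x W"
      using W x by (auto simp: colon_in_idl) (auto simp: colon_in_def)
    fix C assume C: "idl C" "B \<subset> C" "C \<subseteq> N \<boxplus> mulset x W"
    then obtain z where z: "z \<in> C" "z \<notin> B" by blast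
    hence "z \<in> N \<boxplus> mulset x W" using C by blast
    then obtain n w where w: "n \<in> N" "w \<in> W" "z = n \<oplus> x \<otimes> w"
      by (auto simp: mulset_def mem_sum)
    have "x \<otimes> w \<notin> B" using w z B idl_add by blast
    moreover have "x \<otimes> w \<in> C"
    proof -
      have nC: "n \<in> C" using w B C by blast
      have xw: "x \<otimes> w \<in> carrier R" "n \<in> carrier R" using w x W N idl_carr by auto
      have "x \<otimes> w \<oplus> n \<in> C" using z w xw a_comm by simp
      thus ?thesis using idl_cancel_add[OF C(1) _ nC] xw by blast
    qed
    ultimately show "colon_in B x W \<subset> colon_in C x W" using C w by (auto simp: colon_in_def)
  qed
  show "len (colon_in N x W) W \<le> len N (N \<boxplus> mulset x W)"
  proof (rule len_le_map[where \<phi> = "\<lambda>B. N \<boxplus> mulset x B"])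
    show "idl W" by fact
    show "N \<boxplus> mulset x W \<subseteq> N \<boxplus> mulset x W" by simp
    fix B assume B: "idl B" "colon_in N x W \<subseteq> B" "B \<subseteq> W"
    have xB: "idl (mulset x B)" using B x by (simp add: mulset_idl)
    show "idl (N \<boxplus> mulset x B) \<and> N \<subseteq> N \<boxplus> mulset x B"
      using N xB by (simp add: add_ideals sum_ub1)
  next
    fix B C assume BC: "idl B" "idl C" "colon_in N x W \<subseteq> B" "B \<subset> C" "C \<subseteq> W"
    then obtain c where c: "c \<in> C" "c \<notin> B" by blast
    have xc: "idl (mulset x C)" using BC x by (simp add: mulset_idl)
    have 1: "N \<boxplus> mulset x B \<subseteq> N \<boxplus> mulset x C" using BC by (intro sum_mono mulset_mono) auto
    have 2: "x \<otimes> c \<in> N \<boxplus> mulset x C" using sum_ub2[OF N xc] mulsetI[OF c(1)] by blast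
    have "x \<otimes> c \<notin> N \<boxplus> mulset x B"
    proof
      assume "x \<otimes> c \<in> N \<boxplus> mulset x B"
      then obtain n b where nb: "n \<in> N" "b \<in> B" "x \<otimes> c = n \<oplus> x \<otimes> b" by (auto simp: mulset_def mem_sum)
      have carr: "n \<in> carrier R" "b \<in> carrier R" "c \<in> carrier R" using nb c BC N idl_carr by blast+
      have "x \<otimes> (c \<ominus> b) = x \<otimes> c \<ominus> x \<otimes> b" using carr x by algebra
      also have "\<dots> = n" unfolding nb(3) using carr x by algebra
      finally have "c \<ominus> b \<in> colon_in N x W" using nb c BC W by (auto simp: colon_in_def intro: idl_minus)
      hence "c \<ominus> b \<in> B" using BC by blast
      hence "(c \<ominus> b) \<oplus> b \<in> B" using nb BC idl_add by blast
      moreover have "(c \<ominus> b) \<oplus> b = c" using carr by algebra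
      ultimately show False using c by simp
    qed
    thus "N \<boxplus> mulset x B \<subset> N \<boxplus> mulset x C" using 1 2 by blast
  qed
qed

lemma mulset_one: "idl W \<Longrightarrow> mulset \<one> W = W"
  by (auto simp: mulset_def idl_carr image_def)

text \<open>Second isomorphism theorem, the case x = 1 of \<open>len_mult\<close>.\<close>

lemma len_sum: "idl N \<Longrightarrow> idl W \<Longrightarrow> len N (N \<boxplus> W) = len (N \<inter> W) W"
proof -
  assume N: "idl N" and W: "idl W"
  have "colon_in N \<one> W = N \<inter> W" using idl_carr[OF W] by (auto simp: colon_in_def)
  thus ?thesis using len_mult[OF N W one_closed] by (simp add: mulset_one W)
qed

lemma ichain_trans:
  "ichain N M i \<Longrightarrow> ichain M L j \<Longrightarrow> idl M \<Longrightarrow> N \<subseteq> M \<Longrightarrow> M \<subseteq> L \<Longrightarrow> ichain N L (i + j)"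
proof (induct j arbitrary: L)
  case 0 thus ?case using ichain_mono by auto
next
  case (Suc j)
  then obtain B where B: "idl B" "M \<subseteq> B" "B \<subset> L" "ichain M B j" by auto
  hence "ichain N B (i + j)" using Suc by blast
  moreover have "N \<subseteq> B" using B Suc by blast
  ultimately show ?case using B by auto
qed

text \<open>A chain in L/N is intersected with M and pushed into L/M. Its top step from B to L
  survives on one side at least: in L/M if M lies in B, otherwise in M/N, because then the
  intersection of M and B is smaller than M.\<close>

lemma ichain_split:
  "ichain N L n \<Longrightarrow> idl N \<Longrightarrow> idl M \<Longrightarrow> idl L \<Longrightarrow> N \<subseteq> M \<Longrightarrow> M \<subseteq> L \<Longrightarrow>
    \<exists>i j. n = i + j \<and> ichain N M i \<and> ichain M L j"
proof (induct n arbitrary: L M)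
  case 0 thus ?case by (intro exI[of _ 0]) simp
next
  case (Suc n)
  then obtain B where B: "idl B" "N \<subseteq> B" "B \<subset> L" "ichain N B n" by auto
  have MB: "idl (M \<inter> B)" using Suc B by (simp add: idl_Int)
  obtain i j where ij: "n = i + j" "ichain N (M \<inter> B) i" "ichain (M \<inter> B) B j"
    using Suc(1)[OF B(4) Suc(3) MB B(1)] B Suc by auto
  have "ichain M (M \<boxplus> B) j"
    using ij(3) len_sum[of M B] Suc B by (simp add: enat_le_len[symmetric])
  hence j: "ichain M L j" using ichain_mono sum_le Suc B by (metis psubset_imp_subset)
  show ?case
  proof (cases "M \<subseteq> B")
    case True
    hence "M \<inter> B = M" by blast
    hence "ichain M L (Suc j)" using ij B True by auto
    thus ?thesis using ij \<open>M \<inter> B = M\<close> by (intro exI[of _ i] exI[of _ "Suc j"]) auto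
  next
    case False
    hence "ichain N M (Suc i)" using ij MB Suc B by auto
    thus ?thesis using ij j by (intro exI[of _ "Suc i"] exI[of _ j]) auto
  qed
qed

lemma len_add:
  assumes "idl N" "idl M" "idl L" "N \<subseteq> M" "M \<subseteq> L"
  shows "len N L = len N M + len M L"
proof (rule enat_eqI)
  fix n
  show "enat n \<le> len N L \<longleftrightarrow> enat n \<le> len N M + len M L"
    unfolding enat_le_add enat_le_len
    using ichain_split[of N L n M] ichain_trans[of N M _ L] assms by blast
qed

lemma enat_eq_0_iff: "a = 0 \<longleftrightarrow> \<not> enat 1 \<le> a"
  by (cases a) (auto simp: zero_enat_def)

lemma len_eq_0: "idl N \<Longrightarrow> N \<subseteq> M \<Longrightarrow> len N M = 0 \<longleftrightarrow> N = M"
  unfolding enat_eq_0_iff enat_le_len by auto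

lemma len_self [simp]: "len N N = 0"
  unfolding enat_eq_0_iff enat_le_len by auto

lemma len_mult_le:
  assumes "idl X" "idl Y" "idl Z" "Y \<subseteq> X" "x \<in> carrier R" "mulset x Y \<subseteq> Z"
  shows "len Z (Z \<boxplus> mulset x X) \<le> len Y X"
  using assms by (simp add: len_mult) (rule len_mono, auto simp: colon_in_def mulset_def)

text \<open>If \<open>S\<close> generates \<open>A\<close>, multiplication by the elements of \<open>S\<close> maps \<open>(X/Y)\<^sup>|\<^sup>S\<^sup>|\<close> onto
  \<open>(Z + AX)/Z\<close>.\<close>

lemma len_gens:
  assumes "finite S" "S \<subseteq> carrier R" "idl X" "idl Y" "idl Z" "Y \<subseteq> X" "(Idl S) \<cdot> Y \<subseteq> Z"
  shows "len Z (Z \<boxplus> (Idl S) \<cdot> X) \<le> of_nat (card S) * len Y X"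
  using assms
proof (induct S arbitrary: Z)
  case empty
  have "{\<zero>} \<cdot> X = {\<zero>}" using empty ideal_prod_commute ideal_prod_zero zeroideal by metis
  moreover have "Z \<boxplus> {\<zero>} = Z" using empty by (intro sum_absorb1) (auto simp: zeroideal idl_zero)
  ultimately show ?case by (simp add: genideal_empty)
next
  case (insert s S)
  let ?A = "Idl S"
  have s: "s \<in> carrier R" "S \<subseteq> carrier R" using insert by auto
  have A: "idl ?A" using s by (simp add: genideal_ideal)
  have P: "idl (PIdl s)" using s by (simp add: pid_idl)
  have eq: "(Idl (insert s S)) \<cdot> W = mulset s W \<boxplus> ?A \<cdot> W" if "idl W" for W
    using that s A P by (simp add: genideal_insert prod_sum_l pid_prod)
  have AX: "idl (?A \<cdot> X)" "idl (?A \<cdot> Y)" using A insert by (simp_all add: ideal_prod_is_ideal)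
  have sX: "idl (mulset s X)" "idl (mulset s Y)" using s insert by (simp_all add: mulset_idl)
  have sub: "mulset s Y \<subseteq> Z" "?A \<cdot> Y \<subseteq> Z"
    using insert(9)[unfolded eq[OF insert(6)]] sum_ub1[OF sX(2) AX(2)] sum_ub2[OF sX(2) AX(2)] by blast+
  let ?Z = "Z \<boxplus> ?A \<cdot> X"
  have Z': "idl ?Z" using insert AX by (simp add: add_ideals)
  have "Z \<boxplus> (Idl (insert s S)) \<cdot> X = ?Z \<boxplus> mulset s X"
    using eq[OF insert(5)] insert AX sX by (simp add: sum_comm[of "mulset s X"] sum_assoc)
  moreover have "len Z (?Z \<boxplus> mulset s X) = len Z ?Z + len ?Z (?Z \<boxplus> mulset s X)"
    using insert AX sX Z' by (intro len_add) (auto simp: add_ideals sum_ub1[THEN subsetD])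
  moreover have a: "len Z ?Z \<le> of_nat (card S) * len Y X" using insert sub s by blast
  moreover have b: "len ?Z (?Z \<boxplus> mulset s X) \<le> len Y X"
    using insert sX Z' s sub sum_ub1[of Z "?A \<cdot> X"] AX by (intro len_mult_le) auto
  ultimately show ?case using insert add_mono[OF a b] by (simp add: distrib_right add.commute)
qed

end

subsection \<open>Noetherian local rings\<close>

context noetherian_local_ring
begin

text \<open>In a Noetherian ring the union of a nonempty chain of ideals is a member of the chain,
  so Zorn's lemma applies to every family of ideals.\<close>

lemma exists_maximal:
  assumes "F \<noteq> {}" "\<And>A. A \<in> F \<Longrightarrow> idl A"
  shows "\<exists>M\<in>F. \<forall>B\<in>F. M \<subseteq> B \<longrightarrow> B = M"
proof (rule subset_Zorn_nonempty[OF assms(1)])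
  fix C assume C: "C \<noteq> {}" "subset.chain F C"
  have CF: "C \<subseteq> F" using C(2) by (simp add: pred_on.chain_def)
  hence "subset.chain {J. idl J} C" using assms(2) C(2) by (auto simp: pred_on.chain_def)
  thus "\<Union>C \<in> F" using ideal_chain_is_trivial[OF C(1)] CF by auto
qed

lemma obtain_maximal:
  assumes "P A0" "\<And>A. P A \<Longrightarrow> idl A"
  obtains M where "P M" "\<And>B. P B \<Longrightarrow> M \<subseteq> B \<Longrightarrow> B = M"
proof -
  have "\<exists>M\<in>Collect P. \<forall>B\<in>Collect P. M \<subseteq> B \<longrightarrow> B = M"
    by (rule exists_maximal) (use assms in auto)
  thus ?thesis using that by auto
qed

lemma ideal_seq_stable:
  fixes C :: "nat \<Rightarrow> 'a set"
  assumes "\<And>k. idl (C k)" "\<And>k. C k \<subseteq> C (Suc k)"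
  shows "\<exists>k0. \<forall>k\<ge>k0. C k = C k0"
proof -
  have "\<exists>M\<in>range C. \<forall>B\<in>range C. M \<subseteq> B \<longrightarrow> B = M"
    by (rule exists_maximal) (use assms(1) in auto)
  then obtain k0 where "\<forall>B\<in>range C. C k0 \<subseteq> B \<longrightarrow> B = C k0" by (elim bexE rangeE) simp
  hence k0: "C k0 \<subseteq> C k \<Longrightarrow> C k = C k0" for k by simp
  have "C k0 \<subseteq> C k" if "k0 \<le> k" for k using lift_Suc_mono_le[of C, OF assms(2) that] by simp
  thus ?thesis using k0 by (intro exI[of _ k0]) simp
qed

lemma fin_gen: "idl J \<Longrightarrow> \<exists>S\<subseteq>carrier R. finite S \<and> J = Idl S"
  using finetely_gen by blast

lemma \<mm>_idl: "idl \<mm>"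
  using maximal maximalideal.axioms(1) by blast

lemma \<mm>_not_carrier: "\<mm> \<noteq> carrier R"
  using maximal maximalideal.I_notcarr by blast

lemma one_notin_\<mm>: "\<one> \<notin> \<mm>"
  using \<mm>_idl \<mm>_not_carrier idl_one_eq by blast

lemma proper_le_\<mm>:
  assumes "idl J" "J \<noteq> carrier R" shows "J \<subseteq> \<mm>"
proof -
  obtain M where M: "idl M \<and> M \<noteq> carrier R \<and> J \<subseteq> M"
    and max: "\<And>B. idl B \<and> B \<noteq> carrier R \<and> J \<subseteq> B \<Longrightarrow> M \<subseteq> B \<Longrightarrow> B = M"
    by (rule obtain_maximal[of "\<lambda>A. idl A \<and> A \<noteq> carrier R \<and> J \<subseteq> A" J]) (use assms in auto)
  have "maximalideal M R"
  proof (rule maximalidealI)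
    fix B assume B: "idl B" "M \<subseteq> B" "B \<subseteq> carrier R"
    show "B = M \<or> B = carrier R" using max[of B] B M by auto
  qed (use M in auto)
  hence "M = \<mm>" by (rule unique_maximal)
  thus ?thesis using M by simp
qed

lemma unit_outside:
  assumes "a \<in> carrier R" "a \<notin> \<mm>" shows "\<exists>b\<in>carrier R. b \<otimes> a = \<one>"
proof -
  have "PIdl a = carrier R" using proper_le_\<mm>[OF pid_idl[OF assms(1)]] pid_self[OF assms(1)] assms(2) by blast
  hence "\<one> \<in> PIdl a" by simp
  thus ?thesis by (auto simp: pid_mem)
qed

lemma unit_cancel:
  assumes "idl J" "a \<in> carrier R" "a \<notin> \<mm>" "z \<in> carrier R" "a \<otimes> z \<in> J" shows "z \<in> J"
proof -
  obtain b where b: "b \<in> carrier R" "b \<otimes> a = \<one>" using unit_outside assms by blast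
  have "b \<otimes> (a \<otimes> z) = z" using b assms by (simp add: m_assoc[symmetric])
  thus ?thesis using idl_lmult[OF assms(1,5) b(1)] by simp
qed

lemma one_minus_notin_\<mm>: "r \<in> \<mm> \<Longrightarrow> \<one> \<ominus> r \<notin> \<mm>"
proof
  assume r: "r \<in> \<mm>" "\<one> \<ominus> r \<in> \<mm>"
  have c: "r \<in> carrier R" using r \<mm>_idl idl_carr by blast
  have "(\<one> \<ominus> r) \<oplus> r \<in> \<mm>" using r \<mm>_idl idl_add by blast
  moreover have "(\<one> \<ominus> r) \<oplus> r = \<one>" using c by algebra
  ultimately show False using one_notin_\<mm> by simp
qed

text \<open>(1 - r) x = n, and 1 - r is a unit.\<close>

lemma absorb_cancel:
  assumes "idl J" "r \<in> \<mm>" "x \<in> carrier R" "n \<in> J" "x = n \<oplus> r \<otimes> x" shows "x \<in> J"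
proof -
  have c: "r \<in> carrier R" "n \<in> carrier R" using assms \<mm>_idl idl_carr by blast+
  have "(\<one> \<ominus> r) \<otimes> x = x \<ominus> r \<otimes> x" using c assms(3) by algebra
  also have "\<dots> = (n \<oplus> r \<otimes> x) \<ominus> r \<otimes> x" using assms(5) by simp
  also have "\<dots> = n" using c assms(3) by algebra
  finally have "(\<one> \<ominus> r) \<otimes> x \<in> J" using assms by simp
  thus ?thesis using unit_cancel[OF assms(1) _ one_minus_notin_\<mm>[OF assms(2)] assms(3)] c by simp
qed

text \<open>Needs no generators. Take A maximal among the ideals from N up to, but different from, N
  + M. Then \<mm>(N + M) lies in A, so M lies in N + \<mm>M and hence in A, which is absurd.\<close>

lemma nakayama:
  assumes N: "idl N" and M: "idl M" and sub: "M \<subseteq> N \<boxplus> \<mm> \<cdot> M"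
  shows "M \<subseteq> N"
proof (rule ccontr)
  assume nM: "\<not> M \<subseteq> N"
  let ?T = "N \<boxplus> M"
  have T: "idl ?T" using N M by (rule add_ideals)
  have NT: "N \<subset> ?T" using sum_ub1[OF N M] sum_ub2[OF N M] nM by blast
  obtain A where A': "idl A \<and> N \<subseteq> A \<and> A \<subset> ?T"
    and max: "\<And>B. idl B \<and> N \<subseteq> B \<and> B \<subset> ?T \<Longrightarrow> A \<subseteq> B \<Longrightarrow> B = A"
    by (rule obtain_maximal[of "\<lambda>A. idl A \<and> N \<subseteq> A \<and> A \<subset> ?T" N]) (use N NT in auto)
  hence A: "idl A" "N \<subseteq> A" "A \<subset> ?T" by auto
  \<comment> \<open>If r x were outside A, maximality would give A + (r x) = N + M, hence x = n + s
    r x with n in A, and x could be cancelled into A.\<close>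
  have key: "r \<otimes> x \<in> A" if r: "r \<in> \<mm>" and x: "x \<in> ?T" for r x
  proof (rule ccontr)
    assume rx: "r \<otimes> x \<notin> A"
    have xc: "x \<in> carrier R" using x T idl_carr by blast
    have rc: "r \<in> carrier R" using r \<mm>_idl idl_carr by blast
    let ?B = "A \<boxplus> PIdl (r \<otimes> x)"
    have p: "idl (PIdl (r \<otimes> x))" using xc rc by (simp add: pid_idl)
    have B: "idl ?B" using A p by (simp add: add_ideals)
    have "r \<otimes> x \<in> ?B" using sum_ub2[OF A(1) p] pid_self[of "r \<otimes> x"] xc rc by auto
    moreover have "?B \<subseteq> ?T" using A pid_le[OF T, of "r \<otimes> x"] idl_lmult[OF T x rc] T by (intro sum_le) auto
    moreover have "A \<subseteq> ?B" using A p by (simp add: sum_ub1)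
    ultimately have BT: "?B = ?T" using max[of ?B] A B rx by blast
    then obtain n s where ns: "n \<in> A" "s \<in> carrier R" "x = n \<oplus> s \<otimes> (r \<otimes> x)"
      using x unfolding BT[symmetric] by (auto simp: mem_sum pid_mem)
    hence "x = n \<oplus> (s \<otimes> r) \<otimes> x" using xc rc by (simp add: m_assoc)
    hence "x \<in> A" using absorb_cancel[OF A(1) idl_lmult[OF \<mm>_idl r ns(2)] xc ns(1)] by simp
    thus False using rx idl_lmult[OF A(1) _ rc] by blast
  qed
  have "\<mm> \<cdot> M \<subseteq> A" using key sum_ub2[OF N M] by (intro prod_le A) blast
  hence "M \<subseteq> A" using sub sum_le[OF A(2) _ A(1)] by blast
  hence "?T \<subseteq> A" using sum_le[OF A(2) _ A(1)] by blast
  thus False using A by blast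
qed

text \<open>Let a avoid the ideals treated so far but lie in the new N, and let b lie in I outside
  N. All b + u a avoid N. If each met an earlier ideal, two values of u with distinct residues would
  share one, which would then contain (u - u') a, and so a, since u - u' is a unit.\<close>

lemma ideal_avoidance:
  assumes inf: "infinite (carrier (R Quot \<mm>))"
    and I: "idl I" and "finite BB" and "\<And>B. B \<in> BB \<Longrightarrow> idl B \<and> B \<subset> I"
  shows "\<exists>a\<in>I. a \<notin> \<Union>BB"
  using assms(3,4)
proof induct
  case empty thus ?case using idl_zero[OF I] by auto
next
  case (insert N BB)
  then obtain a where a: "a \<in> I" "a \<notin> \<Union>BB" by blast
  show ?case
  proof (cases "a \<in> N")
    case False thus ?thesis using a by auto
  next
    case True
    have N: "idl N" "N \<subset> I" using insert by auto
    obtain b where b: "b \<in> I" "b \<notin> N" using N by blast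
    have c: "a \<in> carrier R" "b \<in> carrier R" using a b I idl_carr by blast+
    have notN: "b \<oplus> u \<otimes> a \<notin> N" if "u \<in> carrier R" for u
      using idl_cancel_add[OF N(1) _ idl_lmult[OF N(1) True that]] b c by blast
    show ?thesis
    proof (rule ccontr)
      assume contra: "\<not> ?thesis"
      have ex: "\<exists>B\<in>BB. b \<oplus> u \<otimes> a \<in> B" if u: "u \<in> carrier R" for u
      proof -
        have "b \<oplus> u \<otimes> a \<in> I" using I a b u by (simp add: idl_rules)
        thus ?thesis using contra notN[OF u] by blast
      qed
      \<comment> \<open>One representative per residue class: differences of distinct
        representatives are units.\<close>
      define rep where "rep X = (SOME u. u \<in> X)" for X :: "'a set"
      interpret mi: ideal \<mm> R by (rule \<mm>_idl)
      have car: "\<exists>u\<in>carrier R. X = \<mm> +> u" if "X \<in> carrier (R Quot \<mm>)" for X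
        using that by (auto simp: FactRing_def A_RCOSETS_def')
      have rep: "rep X \<in> X" "rep X \<in> carrier R" "X = \<mm> +> rep X" if X: "X \<in> carrier (R Quot \<mm>)" for X
      proof -
        obtain u where u: "u \<in> carrier R" "X = \<mm> +> u" using car X by blast
        have "u \<in> X" using u mi.a_rcos_self by blast
        thus 1: "rep X \<in> X" unfolding rep_def by (rule someI)
        thus 2: "rep X \<in> carrier R" using u a_r_coset_subset_G[OF idl_subset[OF \<mm>_idl]] by blast
        show "X = \<mm> +> rep X" using 1 u mi.a_repr_independence' by metis
      qed
      define f where "f X = (SOME B. B \<in> BB \<and> b \<oplus> rep X \<otimes> a \<in> B)" for X
      have f: "f X \<in> BB" "b \<oplus> rep X \<otimes> a \<in> f X" if "X \<in> carrier (R Quot \<mm>)" for X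
        using someI_ex[of "\<lambda>B. B \<in> BB \<and> b \<oplus> rep X \<otimes> a \<in> B"] ex[OF rep(2)[OF that]] unfolding f_def by blast+
      have "finite (f ` carrier (R Quot \<mm>))" using f insert(1) by (meson finite_subset image_subsetI)
      from pigeonhole_infinite[OF inf this] obtain X where X: "X \<in> carrier (R Quot \<mm>)"
        "infinite {Y \<in> carrier (R Quot \<mm>). f Y = f X}" by blast
      then obtain Y where Y: "Y \<in> carrier (R Quot \<mm>)" "f Y = f X" "Y \<noteq> X"
        by (metis (mono_tags, lifting) finite.emptyI finite.insertI infinite_super insertI1 mem_Collect_eq subsetI singletonI)
      have Bi: "idl (f X)" using insert f X by blast
      have "(b \<oplus> rep X \<otimes> a) \<ominus> (b \<oplus> rep Y \<otimes> a) \<in> f X"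
        using f(2)[OF X(1)] f(2)[OF Y(1)] Y(2) Bi idl_minus by simp
      moreover have "(b \<oplus> rep X \<otimes> a) \<ominus> (b \<oplus> rep Y \<otimes> a) = (rep X \<ominus> rep Y) \<otimes> a"
        using c rep(2)[OF X(1)] rep(2)[OF Y(1)] by algebra
      ultimately have in_fX: "(rep X \<ominus> rep Y) \<otimes> a \<in> f X" by simp
      have "rep X \<ominus> rep Y \<notin> \<mm>"
      proof
        assume *: "rep X \<ominus> rep Y \<in> \<mm>"
        have "\<mm> +> rep X = \<mm> +> rep Y"
          using quotient_eq_iff_same_a_r_cos[OF \<mm>_idl rep(2)[OF X(1)] rep(2)[OF Y(1)]] * by simp
        thus False using rep(3)[OF X(1)] rep(3)[OF Y(1)] Y(3) by simp
      qed
      hence "a \<in> f X" using unit_cancel[OF Bi _ _ c(1) in_fX] rep(2)[OF X(1)] rep(2)[OF Y(1)] by simp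
      thus False using a f(1)[OF X(1)] by blast
    qed
  qed
qed

subsection \<open>Graded submodules of Rees algebras\<close>

text \<open>A sequence \<open>L\<close> of this kind stands for the graded submodule \<open>\<Oplus> L\<^sub>m t\<^sup>m\<close> of \<open>R[t]\<close> over the Rees
  algebra of \<open>I\<close>.\<close>

definition gseq :: "'a set \<Rightarrow> (nat \<Rightarrow> 'a set) \<Rightarrow> bool" where
  "gseq I L \<longleftrightarrow> (\<forall>m. idl (L m)) \<and> (\<forall>m. I \<cdot> L m \<subseteq> L (Suc m))"

lemma gseq_idl: "gseq I L \<Longrightarrow> idl (L m)"
  by (simp add: gseq_def)

lemma gseq_step: "gseq I L \<Longrightarrow> b \<in> I \<Longrightarrow> z \<in> L m \<Longrightarrow> b \<otimes> z \<in> L (Suc m)"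
  by (meson gseq_def prodI subsetD)

lemma gseqI:
  assumes "\<And>m. idl (L m)" "\<And>m b z. b \<in> I \<Longrightarrow> z \<in> L m \<Longrightarrow> b \<otimes> z \<in> L (Suc m)"
  shows "gseq I L"
  unfolding gseq_def
proof (intro conjI allI)
  show "idl (L m)" for m by (rule assms(1))
  show "I \<cdot> L m \<subseteq> L (Suc m)" for m by (rule prod_le) (rule assms(1), rule assms(2))
qed

lemma gseq_pow:
  assumes "idl I" "gseq I L" shows "b \<in> pw I p \<Longrightarrow> z \<in> L m \<Longrightarrow> b \<otimes> z \<in> L (m + p)"
proof (induct p arbitrary: b)
  case 0 thus ?case using idl_lmult gseq_idl[OF assms(2)] by simp
next
  case (Suc p)
  have "b \<in> I \<cdot> pw I p" using Suc pw_Suc2 assms by simp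
  thus ?case
  proof induct
    case (prod i j)
    have "i \<otimes> (j \<otimes> z) \<in> L (Suc (m + p))" using gseq_step[OF assms(2) prod(1)] Suc prod by simp
    moreover have "i \<otimes> (j \<otimes> z) = (i \<otimes> j) \<otimes> z"
      using prod Suc(3) assms idl_carr[OF pw_idl[OF assms(1)]] idl_carr[OF gseq_idl[OF assms(2)]]
        idl_carr[OF assms(1)] m_assoc by simp
    ultimately show ?case by simp
  next
    case (sum s t)
    have "s \<in> carrier R" "t \<in> carrier R" "z \<in> carrier R"
      using sum Suc(3) idl_carr[OF ideal_prod_is_ideal[OF assms(1) pw_idl[OF assms(1)]]]
        idl_carr[OF gseq_idl[OF assms(2)]] by blast+
    thus ?case using sum idl_add[OF gseq_idl[OF assms(2)]] by (simp add: l_distr)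
  qed
qed

lemma gseq_pw: "idl I \<Longrightarrow> gseq I (pw I)"
  by (simp add: gseq_def pw_idl pw_Suc2)

text \<open>Every graded submodule of the Rees algebra of \<open>I\<close> is generated in bounded degree.\<close>

definition graded_noetherian :: "'a set \<Rightarrow> bool" where
  "graded_noetherian I \<longleftrightarrow> (\<forall>L. gseq I L \<longrightarrow> (\<forall>m. L m \<subseteq> pw I m) \<longrightarrow>
     (\<exists>g. \<forall>m\<ge>g. L (Suc m) \<subseteq> I \<cdot> L m))"

text \<open>The union of the chain is again a graded submodule, so it is generated in degrees up to
  some g; in each of these finitely many degrees the chain becomes stationary because R is
  Noetherian.\<close>

lemma gseq_acc:
  assumes I: "idl I" "graded_noetherian I"
    and C: "\<And>k. gseq I (C k)" "\<And>k m. C k m \<subseteq> pw I m" "\<And>k m. C k m \<subseteq> C (Suc k) m"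
  shows "\<exists>k0. \<forall>k\<ge>k0. \<forall>m. C k m = C k0 m"
proof -
  have mono: "C k m \<subseteq> C l m" if "k \<le> l" for k l m
    using lift_Suc_mono_le[of "\<lambda>k. C k m", OF C(3) that] by simp
  define U where "U m = (\<Union>k. C k m)" for m
  have "gseq I U"
  proof (rule gseqI)
    show "idl (U m)" for m
    proof (rule idlI)
      show "U m \<subseteq> carrier R" using gseq_idl[OF C(1)] idl_subset by (auto simp: U_def)
      show "\<zero> \<in> U m" using idl_zero[OF gseq_idl[OF C(1)]] by (auto simp: U_def)
      show "a \<oplus> b \<in> U m" if ab: "a \<in> U m" "b \<in> U m" for a b
      proof -
        obtain k l where "a \<in> C k m" "b \<in> C l m" using ab by (auto simp: U_def)
        hence "a \<in> C (max k l) m" "b \<in> C (max k l) m" using mono[of k "max k l"] mono[of l "max k l"] by auto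
        hence "a \<oplus> b \<in> C (max k l) m" using idl_add[OF gseq_idl[OF C(1)]] by blast
        thus ?thesis by (auto simp: U_def)
      qed
      show "x \<otimes> a \<in> U m" if xa: "a \<in> U m" "x \<in> carrier R" for a x
        
      proof -
        obtain k where "a \<in> C k m" using xa(1) unfolding U_def by blast
        hence "x \<otimes> a \<in> C k m" using idl_lmult[OF gseq_idl[OF C(1)]] xa by simp
        thus ?thesis by (auto simp: U_def)
      qed
    qed
    show "b \<otimes> z \<in> U (Suc m)" if xa: "b \<in> I" "z \<in> U m" for b z m
      
    proof -
      obtain k where "z \<in> C k m" using xa(2) unfolding U_def by blast
      hence "b \<otimes> z \<in> C k (Suc m)" using gseq_step[OF C(1)] xa by simp
      thus ?thesis by (auto simp: U_def)
    qed
  qed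
  moreover have "\<forall>m. U m \<subseteq> pw I m" using C by (auto simp: U_def)
  ultimately obtain g where g: "\<And>m. m \<ge> g \<Longrightarrow> U (Suc m) \<subseteq> I \<cdot> U m"
    using I unfolding graded_noetherian_def by blast
  have "\<exists>k0. \<forall>k\<ge>k0. C k m = C k0 m" for m
    by (rule ideal_seq_stable) (rule gseq_idl[OF C(1)], rule C(3))
  then obtain K where K: "\<And>m k. k \<ge> K m \<Longrightarrow> C k m = C (K m) m" by metis
  \<comment> \<open>Past this index the chain is constant in all degrees up to \<open>g\<close>;
    generation by \<open>I\<close> carries this to higher degrees.\<close>
  define k0 where "k0 = Max (K ` {..g})"
  have k0: "K m \<le> k0" if "m \<le> g" for m using that by (auto simp: k0_def)
  have UC: "U m \<subseteq> C k0 m" for m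
  proof (induct m)
    case 0
    have "C k 0 \<subseteq> C k0 0" for k using K[of 0 k] K[OF k0[of 0]] mono[of k "K 0" 0] by (cases "k \<le> K 0") auto
    thus ?case by (auto simp: U_def)
  next
    case (Suc m)
    show ?case
    proof (cases "Suc m \<le> g")
      case True
      have "C k (Suc m) \<subseteq> C k0 (Suc m)" for k
        using K[of "Suc m" k] K[OF k0[OF True]] mono[of k "K (Suc m)" "Suc m"] by (cases "k \<le> K (Suc m)") auto
      thus ?thesis by (auto simp: U_def)
    next
      case False
      hence "U (Suc m) \<subseteq> I \<cdot> U m" using g by simp
      also have "\<dots> \<subseteq> I \<cdot> C k0 m" using Suc by (intro prod_mono) auto
      also have "\<dots> \<subseteq> C k0 (Suc m)" using C(1) by (simp add: gseq_def)
      finally show ?thesis .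
    qed
  qed
  have "C k m = C k0 m" if "k \<ge> k0" for k m using UC[of m] mono[OF that] by (auto simp: U_def)
  thus ?thesis by blast
qed

lemma pow_Suc_mult: "x \<in> carrier R \<Longrightarrow> z \<in> carrier R \<Longrightarrow> x [^] Suc n \<otimes> z = x \<otimes> (x [^] n \<otimes> z)"
  by (simp add: m_assoc m_lcomm)

lemma pow_add_mult: "x \<in> carrier R \<Longrightarrow> z \<in> carrier R \<Longrightarrow>
    x [^] (m::nat) \<otimes> (x [^] (n::nat) \<otimes> z) = x [^] (m + n) \<otimes> z"
  by (simp add: m_assoc[symmetric] nat_pow_mult)

text \<open>For \<open>I = (x) + J\<close>, an element of \<open>L\<close> divisible by \<open>x\<^sup>k\<close> has the form \<open>x\<^sup>k (c + x w)\<close> with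
  \<open>c \<in> J\<^sup>m\<close>. These \<open>c\<close> form the graded modules \<open>W k\<close> over the Rees algebra of \<open>J\<close>, which increase
  with \<open>k\<close>. In large degree \<open>x\<^sup>k c\<close> can be replaced by an element of \<open>I L\<close>, which raises the power
  of \<open>x\<close> dividing the rest; the degree bounds that power.\<close>

lemma graded_noetherian_step:
  assumes J: "idl J" "graded_noetherian J" and x: "x \<in> carrier R" and I: "I = PIdl x \<boxplus> J"
  shows "graded_noetherian I"
  unfolding graded_noetherian_def
proof (intro allI impI)
  fix L assume L: "gseq I L" and LI: "\<forall>m. L m \<subseteq> pw I m"
  have px: "idl (PIdl x)" using x by (rule pid_idl)
  have idI: "idl I" unfolding I using px J(1) by (rule add_ideals)
  have JI: "J \<subseteq> I" unfolding I using px J(1) by (rule sum_ub2)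
  have xI: "x \<in> I" unfolding I using sum_ub1[OF px J(1)] pid_self[OF x] by blast
  note pc = idl_carr[OF pw_idl[OF idI]] idl_carr[OF pw_idl[OF J(1)]]
  note Lid = gseq_idl[OF L]
  note Lc = idl_carr[OF Lid]
  \<comment> \<open>The degree m part of the ideal of the Rees algebra of \<open>I\<close> generated
    by x t.\<close>
  define Y where "Y m = (case m of 0 \<Rightarrow> {\<zero>} | Suc p \<Rightarrow> mulset x (pw I p))" for m
  have Yid: "idl (Y m)" for m using x pw_idl[OF idI] by (auto simp: Y_def mulset_idl zeroideal split: nat.split)
  note Yc = idl_carr[OF Yid]
  have YJ: "b \<otimes> v \<in> Y (Suc m)" if b: "b \<in> J" and v: "v \<in> Y m" for b v m
  proof (cases m)
    case 0
    hence "b \<otimes> v = \<zero>" using v b idl_carr[OF J(1)] by (simp add: Y_def)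
    thus ?thesis using idl_zero[OF Yid] by simp
  next
    case (Suc p)
    then obtain w where w: "w \<in> pw I p" "v = x \<otimes> w" using v by (auto simp: Y_def mulset_def)
    have "w \<otimes> b \<in> pw I m" unfolding Suc pw_Suc using w b JI by (intro prodI) auto
    moreover have "b \<otimes> v = x \<otimes> (w \<otimes> b)" using w b x pc idl_carr[OF J(1)] m_lcomm m_comm by auto
    ultimately show ?thesis by (simp add: Y_def mulsetI)
  qed
  \<comment> \<open>Monomials in the generators of \<open>I\<close> either omit x or are divisible
    by it.\<close>
  have dec: "pw I m \<subseteq> pw J m \<boxplus> Y m" for m
  proof (induct m)
    case 0 show ?case using sum_ub1[OF oneideal Yid[of 0]] by simp
  next
    case (Suc m)
    have e1: "pw I (Suc m) = pw I m \<cdot> (PIdl x) \<boxplus> pw I m \<cdot> J"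
      unfolding pw_Suc using prod_sum_r[OF pw_idl[OF idI] px J(1)] I by simp
    have e2: "pw I m \<cdot> (PIdl x) = Y (Suc m)"
      using pid_prod[OF x pw_idl[OF idI]] ideal_prod_commute[OF pw_idl[OF idI] px] by (simp add: Y_def)
    have e3: "pw I m \<cdot> J \<subseteq> pw J (Suc m) \<boxplus> Y (Suc m)"
    proof (rule prod_le)
      show id: "idl (pw J (Suc m) \<boxplus> Y (Suc m))" using pw_idl[OF J(1)] Yid by (rule add_ideals)
      fix a b assume a: "a \<in> pw I m" and b: "b \<in> J"
      obtain c v where cv: "c \<in> pw J m" "v \<in> Y m" "a = c \<oplus> v" using subsetD[OF Suc a] by (auto simp: mem_sum)
      have "a \<otimes> b = c \<otimes> b \<oplus> b \<otimes> v" using cv b pc Yc idl_carr[OF J(1)] by (simp add: l_distr m_comm r_distr)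
      moreover have "c \<otimes> b \<in> pw J (Suc m)" unfolding pw_Suc using cv b by (intro prodI)
      ultimately show "a \<otimes> b \<in> pw J (Suc m) \<boxplus> Y (Suc m)" using YJ[OF b cv(2)] sumI by simp
    qed
    show ?case unfolding e1 e2
      by (intro sum_le e3 sum_ub2 add_ideals pw_idl J Yid)
  qed
  define W where "W k m = {c \<in> pw J m. \<exists>v\<in>Y m. x [^] k \<otimes> (c \<oplus> v) \<in> L (m + k)}" for k :: nat and m
  have xk: "x [^] k \<in> carrier R" for k :: nat using x by simp
  have WI: "c \<in> W k m" if "c \<in> pw J m" "v \<in> Y m" "x [^] k \<otimes> (c \<oplus> v) \<in> L (m + k)" for c k m v
    using that by (auto simp: W_def)
  have Wg: "gseq J (W k)" for k
  proof (rule gseqI)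
    show "idl (W k m)" for m
    proof (rule idlI)
      show "W k m \<subseteq> carrier R" using pc by (auto simp: W_def)
      show "\<zero> \<in> W k m" using idl_zero[OF Yid] idl_zero[OF Lid] idl_zero[OF pw_idl[OF J(1)]] xk
        by (auto simp: W_def intro!: bexI[of _ "\<zero>"])
    next
      fix a b assume "a \<in> W k m" "b \<in> W k m"
      then obtain v w where v: "a \<in> pw J m" "v \<in> Y m" "x [^] k \<otimes> (a \<oplus> v) \<in> L (m + k)"
        and w: "b \<in> pw J m" "w \<in> Y m" "x [^] k \<otimes> (b \<oplus> w) \<in> L (m + k)" by (auto simp: W_def)
      have "x [^] k \<otimes> ((a \<oplus> b) \<oplus> (v \<oplus> w)) = x [^] k \<otimes> (a \<oplus> v) \<oplus> x [^] k \<otimes> (b \<oplus> w)"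
        using pc(2)[OF v(1)] pc(2)[OF w(1)] Yc[OF v(2)] Yc[OF w(2)] xk[of k] by algebra
      hence "x [^] k \<otimes> ((a \<oplus> b) \<oplus> (v \<oplus> w)) \<in> L (m + k)" using v w idl_add[OF Lid] by simp
      thus "a \<oplus> b \<in> W k m" by (intro WI[of _ _ "v \<oplus> w"]) (use v w idl_add[OF Yid] idl_add[OF pw_idl[OF J(1)]] in auto)
    next
      fix a r assume "a \<in> W k m" and r: "r \<in> carrier R"
      then obtain v where v: "a \<in> pw J m" "v \<in> Y m" "x [^] k \<otimes> (a \<oplus> v) \<in> L (m + k)" by (auto simp: W_def)
      have "x [^] k \<otimes> (r \<otimes> a \<oplus> r \<otimes> v) = r \<otimes> (x [^] k \<otimes> (a \<oplus> v))"
        using pc(2)[OF v(1)] Yc[OF v(2)] xk[of k] r by algebra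
      hence "x [^] k \<otimes> (r \<otimes> a \<oplus> r \<otimes> v) \<in> L (m + k)" using v r idl_lmult[OF Lid] by simp
      thus "r \<otimes> a \<in> W k m" by (intro WI[of _ _ "r \<otimes> v"]) (use v r idl_lmult[OF Yid] idl_lmult[OF pw_idl[OF J(1)]] in auto)
    qed
    fix m b a assume b: "b \<in> J" and "a \<in> W k m"
    then obtain v where v: "a \<in> pw J m" "v \<in> Y m" "x [^] k \<otimes> (a \<oplus> v) \<in> L (m + k)" by (auto simp: W_def)
    have bc: "b \<in> carrier R" using b idl_carr[OF J(1)] by blast
    have "x [^] k \<otimes> (b \<otimes> a \<oplus> b \<otimes> v) = b \<otimes> (x [^] k \<otimes> (a \<oplus> v))"
      using pc(2)[OF v(1)] Yc[OF v(2)] xk[of k] bc by algebra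
    hence "x [^] k \<otimes> (b \<otimes> a \<oplus> b \<otimes> v) \<in> L (Suc m + k)" using gseq_step[OF L _ v(3), of b] b JI by auto
    moreover have "b \<otimes> a \<in> pw J (Suc m)" unfolding pw_Suc2[OF J(1)] using b v by (intro prodI)
    ultimately show "b \<otimes> a \<in> W k (Suc m)" by (intro WI[of _ _ "b \<otimes> v"]) (use YJ[OF b v(2)] in auto)
  qed
  have Winc: "W k m \<subseteq> W (Suc k) m" for k m
  proof
    fix a assume "a \<in> W k m"
    then obtain v where v: "a \<in> pw J m" "v \<in> Y m" "x [^] k \<otimes> (a \<oplus> v) \<in> L (m + k)" by (auto simp: W_def)
    have "x [^] Suc k \<otimes> (a \<oplus> v) = x \<otimes> (x [^] k \<otimes> (a \<oplus> v))"
      using pc(2)[OF v(1)] Yc[OF v(2)] x by (intro pow_Suc_mult) auto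
    hence "x [^] Suc k \<otimes> (a \<oplus> v) \<in> L (m + Suc k)" using gseq_step[OF L xI v(3)] by simp
    thus "a \<in> W (Suc k) m" using WI v by blast
  qed
  have WJ: "W k m \<subseteq> pw J m" for k m by (auto simp: W_def)
  have "\<exists>k0. \<forall>k\<ge>k0. \<forall>m. W k m = W k0 m"
    by (rule gseq_acc[OF J, of W]) (rule Wg, rule WJ, rule Winc)
  then obtain k0 where k0: "\<And>k m. k \<ge> k0 \<Longrightarrow> W k m = W k0 m" by blast
  have "\<exists>g. \<forall>m\<ge>g. W k (Suc m) \<subseteq> J \<cdot> W k m" for k
    using J(2) Wg[of k] WJ unfolding graded_noetherian_def by blast
  then obtain G where G: "\<And>k m. m \<ge> G k \<Longrightarrow> W k (Suc m) \<subseteq> J \<cdot> W k m" by metis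
  define g where "g = Max (G ` {..k0})"
  have g: "W k (Suc m) \<subseteq> J \<cdot> W k m" if "k \<le> k0" "m \<ge> g" for k m
  proof -
    have "G k \<le> g" using that(1) by (auto simp: g_def)
    thus ?thesis using G that by simp
  qed
  \<comment> \<open>Induction on the degree p of the cofactor u of x^k. Each step subtracts an
    element of I L and leaves a remainder divisible by one more x; it ends when x^k carries the
    whole degree.\<close>
  have main: "l \<in> I \<cdot> L n'" if "n' \<ge> g + k0" "k \<le> Suc n'" "p = Suc n' - k" "l \<in> L (Suc n')" 
    "l = x [^] k \<otimes> u" "u \<in> pw I p" for l u n' k p
    using that
  proof (induct p arbitrary: k l u)
    case (0 k l u)
    hence k: "k = Suc n'" by simp
    have uc: "u \<in> carrier R" using 0 by simp
    have "u \<in> W k 0" using 0 k uc by (intro WI[of _ _ "\<zero>"]) (auto simp: Y_def)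
    hence "u \<in> W k0 0" using k0[of k 0] k 0 by simp
    then obtain v where "v \<in> Y 0" "x [^] k0 \<otimes> (u \<oplus> v) \<in> L (0 + k0)" by (auto simp: W_def)
    hence xu: "x [^] k0 \<otimes> u \<in> L k0" using uc by (simp add: Y_def)
    have "x [^] (n' - k0) \<otimes> (x [^] k0 \<otimes> u) \<in> L (k0 + (n' - k0))"
      by (rule gseq_pow[OF idI L pw_memI[OF idI xI] xu])
    hence z: "x [^] (n' - k0) \<otimes> (x [^] k0 \<otimes> u) \<in> L n'" using 0 by simp
    have "x [^] (n' - k0) \<otimes> (x [^] k0 \<otimes> u) = x [^] n' \<otimes> u"
      using x uc 0 by (simp add: m_assoc[symmetric] nat_pow_mult)
    hence "x [^] n' \<otimes> u \<in> L n'" using z by simp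
    hence "x \<otimes> (x [^] n' \<otimes> u) \<in> I \<cdot> L n'" using xI by (intro prodI)
    moreover have "x \<otimes> (x [^] n' \<otimes> u) = l" using 0 k pow_Suc_mult[OF x uc, of n'] by simp
    ultimately show ?case by simp
  next
    case (Suc p k l u)
    have IL: "idl (I \<cdot> L n')" using idI Lid by (rule ideal_prod_is_ideal)
    obtain c v where cv: "c \<in> pw J (Suc p)" "v \<in> Y (Suc p)" "u = c \<oplus> v" using subsetD[OF dec Suc(7)] by (auto simp: mem_sum)
    have e: "Suc p + k = Suc n'" using Suc by simp
    have cW: "c \<in> W k (Suc p)" using cv Suc e by (intro WI[of _ _ v]) auto
    have "\<exists>l'\<in>I \<cdot> L n'. \<exists>v'\<in>Y (Suc p). l' = x [^] k \<otimes> (c \<oplus> v')"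
    proof (cases "k \<le> k0")
      case True
      \<comment> \<open>This is why degrees start at g + k0: for k at most k0 the remaining degree
        is still beyond the generation bound of \<open>W k\<close>.\<close>
      have "p \<ge> g" using e True Suc(2) by simp
      hence "c \<in> J \<cdot> W k p" using g[OF True] cW by blast
      thus ?thesis
      proof induct
        case (prod b a)
        then obtain w where w: "a \<in> pw J p" "w \<in> Y p" "x [^] k \<otimes> (a \<oplus> w) \<in> L (p + k)" by (auto simp: W_def)
        have bc: "b \<in> carrier R" using prod idl_carr[OF J(1)] by blast
        have "b \<otimes> (x [^] k \<otimes> (a \<oplus> w)) \<in> I \<cdot> L n'" using w prod JI e by (intro prodI) auto
        moreover have "b \<otimes> (x [^] k \<otimes> (a \<oplus> w)) = x [^] k \<otimes> (b \<otimes> a \<oplus> b \<otimes> w)"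
          using pc(2)[OF w(1)] Yc[OF w(2)] xk[of k] bc by algebra
        ultimately show ?case using YJ[OF prod(1) w(2)] by metis
      next
        case (sum s t)
        then obtain l1 v1 l2 v2 where h: "l1 \<in> I \<cdot> L n'" "v1 \<in> Y (Suc p)" "l1 = x [^] k \<otimes> (s \<oplus> v1)"
          "l2 \<in> I \<cdot> L n'" "v2 \<in> Y (Suc p)" "l2 = x [^] k \<otimes> (t \<oplus> v2)" by blast
        have "s \<in> carrier R" "t \<in> carrier R"
          using sum idl_carr[OF ideal_prod_is_ideal[OF J(1) gseq_idl[OF Wg]]] by blast+
        hence "l1 \<oplus> l2 = x [^] k \<otimes> ((s \<oplus> t) \<oplus> (v1 \<oplus> v2))"
          unfolding h(3,6) using Yc[OF h(2)] Yc[OF h(5)] xk[of k] by algebra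
        thus ?case using idl_add[OF IL h(1,4)] idl_add[OF Yid h(2,5)] by blast
      qed
    next
      \<comment> \<open>Now \<open>W k\<close> equals \<open>W k0\<close>, so x^k0 (c + w) lies in L
        already. Of the k - k0 further factors x, all but one stay inside L and the last one
        supplies the factor from I.\<close>
      case False
      hence "c \<in> W k0 (Suc p)" using k0[of k] cW by simp
      then obtain w where w: "w \<in> Y (Suc p)" "x [^] k0 \<otimes> (c \<oplus> w) \<in> L (Suc p + k0)" by (auto simp: W_def)
      define j where "j = k - k0 - 1"
      have j: "k = Suc (j + k0)" using False by (simp add: j_def)
      have cc: "c \<oplus> w \<in> carrier R" using pc(2)[OF cv(1)] Yc[OF w(1)] by simp
      have "x [^] j \<otimes> (x [^] k0 \<otimes> (c \<oplus> w)) \<in> L (Suc p + k0 + j)"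
        by (rule gseq_pow[OF idI L pw_memI[OF idI xI] w(2)])
      moreover have "Suc p + k0 + j = n'" using e j by simp
      ultimately have "x \<otimes> (x [^] j \<otimes> (x [^] k0 \<otimes> (c \<oplus> w))) \<in> I \<cdot> L n'" using xI by (intro prodI) auto
      moreover have "x \<otimes> (x [^] j \<otimes> (x [^] k0 \<otimes> (c \<oplus> w))) = x [^] k \<otimes> (c \<oplus> w)"
        using pow_add_mult[OF x cc, of j k0] pow_Suc_mult[OF x cc, of "j + k0"] unfolding j by simp
      ultimately show ?thesis using w(1) by metis
    qed
    then obtain l' v' where l': "l' \<in> I \<cdot> L n'" "v' \<in> Y (Suc p)" "l' = x [^] k \<otimes> (c \<oplus> v')" by blast
    have "v \<ominus> v' \<in> Y (Suc p)" using cv l' idl_minus[OF Yid] by blast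
    then obtain w where w: "w \<in> pw I p" "v \<ominus> v' = x \<otimes> w" by (auto simp: Y_def mulset_def)
    \<comment> \<open>The two elements share c, so their difference only involves \<open>Y\<close>,
      which is divisible by x.\<close>
    have "l \<ominus> l' = x [^] k \<otimes> (v \<ominus> v')"
      unfolding Suc(6) l'(3) cv(3) using pc(2)[OF cv(1)] Yc[OF cv(2)] Yc[OF l'(2)] xk[of k] by algebra
    also have "\<dots> = x [^] Suc k \<otimes> w" using w x pc by (simp add: m_assoc)
    finally have eq: "l \<ominus> l' = x [^] Suc k \<otimes> w" .
    have "l' \<in> L (Suc n')" using l'(1) L by (auto simp: gseq_def)
    hence "l \<ominus> l' \<in> L (Suc n')" using Suc(5) idl_minus[OF Lid] by blast
    hence "l \<ominus> l' \<in> I \<cdot> L n'" using Suc(1)[OF Suc(2) _ _ _ eq w(1)] e by simp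
    hence "(l \<ominus> l') \<oplus> l' \<in> I \<cdot> L n'" using l' idl_add[OF IL] by blast
    moreover have "(l \<ominus> l') \<oplus> l' = l" using Lc[OF Suc(5)] idl_carr[OF IL l'(1)] by algebra
    ultimately show ?case by simp
  qed
  show "\<exists>g. \<forall>m\<ge>g. L (Suc m) \<subseteq> I \<cdot> L m"
  proof (intro exI[of _ "g + k0"] allI impI subsetI)
    fix m l assume m: "g + k0 \<le> m" and l: "l \<in> L (Suc m)"
    have "l = x [^] (0::nat) \<otimes> l" using Lc[OF l] by simp
    thus "l \<in> I \<cdot> L m" using main[OF m, of 0 "Suc m" l l] l LI by auto
  qed
qed

text \<open>Hilbert's basis theorem for the Rees algebra, by adjoining the generators of
  \<open>I\<close> one at a time to the zero ideal.\<close>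

theorem graded_noetherian: "idl I \<Longrightarrow> graded_noetherian I"
proof -
  assume "idl I"
  then obtain S where S: "S \<subseteq> carrier R" "finite S" "I = Idl S" using fin_gen by blast
  have "graded_noetherian (Idl S)" using S(2,1)
  proof induct
    case empty
    show ?case unfolding graded_noetherian_def genideal_empty
    proof (intro allI impI exI[of _ 0])
      fix L m assume L: "gseq {\<zero>} L" "\<forall>m. L m \<subseteq> pw {\<zero>} m"
      have "pw {\<zero>} (Suc m) \<subseteq> {\<zero>}" using pw_le[OF zeroideal] by simp
      hence "L (Suc m) \<subseteq> {\<zero>}" using L by blast
      also have "\<dots> \<subseteq> {\<zero>} \<cdot> L m"
        using idl_zero[OF ideal_prod_is_ideal[OF zeroideal gseq_idl[OF L(1)]]] by simp
      finally show "L (Suc m) \<subseteq> {\<zero>} \<cdot> L m" .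
    qed
  next
    case (insert x S)
    thus ?case using graded_noetherian_step[of "Idl S" x] genideal_ideal genideal_insert by simp
  qed
  thus ?thesis using S by simp
qed

lemma hilbert_basis:
  assumes "idl I" "gseq I L" "\<And>m. L m \<subseteq> pw I m"
  obtains g where "\<And>m. m \<ge> g \<Longrightarrow> L (Suc m) = I \<cdot> L m"
proof -
  obtain g where "\<And>m. m \<ge> g \<Longrightarrow> L (Suc m) \<subseteq> I \<cdot> L m"
    using graded_noetherian[OF assms(1)] assms(2,3) unfolding graded_noetherian_def by blast
  moreover have "I \<cdot> L m \<subseteq> L (Suc m)" for m using assms(2) by (simp add: gseq_def)
  ultimately show ?thesis by (intro that[of g] subset_antisym)
qed

text \<open>The larger module comes first, so well-foundedness is the ascending chain condition and
  induction runs from larger modules to smaller ones.\<close>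

definition gseq_rel :: "'a set \<Rightarrow> ((nat \<Rightarrow> 'a set) \<times> (nat \<Rightarrow> 'a set)) set" where
  "gseq_rel I = {(N', N). gseq I N \<and> gseq I N' \<and> (\<forall>m. N m \<subseteq> N' m \<and> N' m \<subseteq> pw I m) \<and> N \<noteq> N'}"

lemma wf_gseq_rel: 
  assumes "idl I" shows "wf (gseq_rel I)"
  unfolding wf_iff_no_infinite_down_chain
proof
  assume "\<exists>f. \<forall>i. (f (Suc i), f i) \<in> gseq_rel I"
  then obtain f where f: "\<And>i. (f (Suc i), f i) \<in> gseq_rel I" by blast
  have g: "gseq I (f k)" for k using f[of k] by (simp add: gseq_rel_def)
  have i: "f k m \<subseteq> f (Suc k) m" for k m using f[of k] by (simp add: gseq_rel_def)
  have "f (Suc k) m \<subseteq> pw I m" for k m using f[of k] by (simp add: gseq_rel_def)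
  hence u: "f k m \<subseteq> pw I m" for k m by (rule subset_trans[OF i])
  have "\<exists>k0. \<forall>k\<ge>k0. \<forall>m. f k m = f k0 m"
    by (rule gseq_acc[of I f, OF assms graded_noetherian[OF assms]]) (rule g, rule u, rule i)
  then obtain k0 where k0: "\<forall>k\<ge>k0. \<forall>m. f k m = f k0 m" by blast
  have "f (Suc k0) = f k0"
  proof (rule ext)
    show "f (Suc k0) m = f k0 m" for m using k0 le_SucI[OF order_refl, of k0] by blast
  qed
  moreover have "f k0 \<noteq> f (Suc k0)" using f[of k0] unfolding gseq_rel_def by blast
  ultimately show False by metis
qed

subsection \<open>Generic elements\<close>

text \<open>Noetherian induction on \<open>N\<close>. Enlarging \<open>N\<close> by a cyclic module \<open>A c\<close> with maximal degree one
  annihilator adds at most one ideal to be avoided; if that annihilator is all of \<open>I\<close>, then \<open>A c\<close>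
  lives in a single degree, which the bound \<open>m0\<close> takes care of.\<close>

lemma generic_element:
  assumes I: "idl I" and "gseq I N" and "\<And>m. N m \<subseteq> pw I m"
  shows "\<exists>m0 BB. finite BB \<and> (\<forall>B\<in>BB. idl B \<and> B \<subset> I) \<and>
    (\<forall>a\<in>I. a \<notin> \<Union>BB \<longrightarrow> (\<forall>m\<ge>m0. \<forall>c\<in>pw I m. a \<otimes> c \<in> N (Suc m) \<longrightarrow> c \<in> N m))"
  using assms(2,3)
proof (induct N rule: wf_induct_rule[OF wf_gseq_rel[OF I]])
  case (1 N)
  note N = 1(2) and NI = 1(3)
  note pid = pw_idl[OF I]
  note pc = idl_carr[OF pid]
  note Nid = gseq_idl[OF N]
  show ?case
  proof (cases "\<forall>m. pw I m \<subseteq> N m")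
    case True
    thus ?thesis by (intro exI[of _ 0] exI[of _ "{}"]) auto
  next
    case False
    then obtain m1 c1 where mc1: "c1 \<in> pw I m1" "c1 \<notin> N m1" by blast
    \<comment> \<open>Degree one annihilators modulo N of homogeneous elements outside N. A maximal
      one plays the part of an associated prime.\<close>
    define P where "P A \<longleftrightarrow> (\<exists>m c. c \<in> pw I m \<and> c \<notin> N m \<and> A = colon_in (N (Suc m)) c I)" for A
    obtain B where PB: "P B" and Bmax: "\<And>A. P A \<Longrightarrow> B \<subseteq> A \<Longrightarrow> A = B"
    proof -
      have p: "P (colon_in (N (Suc m1)) c1 I)" using mc1 by (auto simp: P_def)
      have "idl A" if "P A" for A using that pc Nid I by (auto simp: P_def intro!: colon_in_idl)
      from obtain_maximal[of P, OF p this] show thesis using that by blast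
    qed
    obtain m c where mc: "c \<in> pw I m" "c \<notin> N m" "B = colon_in (N (Suc m)) c I" using PB by (auto simp: P_def)
    have cc: "c \<in> carrier R" using mc pc by blast
    have Bid: "idl B" unfolding mc(3) using Nid cc I by (rule colon_in_idl)
    \<comment> \<open>N + A c, where A is the Rees algebra and c sits in degree m.\<close>
    define N' where "N' j = (if j < m then N j else N j \<boxplus> mulset c (pw I (j - m)))" for j
    have cpid: "idl (mulset c (pw I j))" for j using cc pid by (rule mulset_idl)
    have N'id: "idl (N' j)" for j by (simp add: N'_def Nid add_ideals cpid)
    have NN': "N j \<subseteq> N' j" for j using sum_ub1[OF Nid cpid] by (simp add: N'_def)
    have N': "gseq I N'"
    proof (rule gseqI)
      show "idl (N' j)" for j by (rule N'id)
      fix j b z assume b: "b \<in> I" and z: "z \<in> N' j"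
      show "b \<otimes> z \<in> N' (Suc j)"
      proof (cases "j < m")
        case True
        hence "z \<in> N j" using z by (simp add: N'_def)
        thus ?thesis using gseq_step[OF N b] NN' by blast
      next
        case False
        then obtain n w where nw: "n \<in> N j" "w \<in> pw I (j - m)" "z = n \<oplus> c \<otimes> w"
          using z by (auto simp: N'_def mem_sum mulset_def)
        have bc: "b \<in> carrier R" using b I idl_carr by blast
        have "b \<otimes> z = b \<otimes> n \<oplus> c \<otimes> (b \<otimes> w)"
          unfolding nw(3) using bc cc idl_carr[OF Nid nw(1)] pc[OF nw(2)] by algebra
        moreover have "b \<otimes> w \<in> pw I (Suc j - m)"
          using nw(2) b False pw_Suc2[OF I, of "j - m"] by (simp add: Suc_diff_le prodI)
        ultimately show ?thesis using gseq_step[OF N b nw(1)] False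
          by (simp add: N'_def sumI mulsetI)
      qed
    qed
    have N'I: "N' j \<subseteq> pw I j" for j
    proof (cases "j < m")
      case False
      have "mulset c (pw I (j - m)) \<subseteq> pw I j"
        using prodI[OF mc(1)] False pw_add[OF I, of m "j - m"] by (auto simp: mulset_def)
      thus ?thesis using False NI pid by (simp add: N'_def sum_le)
    qed (simp add: N'_def NI)
    have "c \<otimes> \<one> \<in> N' m" unfolding N'_def using subsetD[OF sum_ub2[OF Nid cpid] mulsetI[of "\<one>" "pw I 0" c]] by simp
    hence "c \<in> N' m" using cc by simp
    hence "N \<noteq> N'" using mc(2) by metis
    hence "(N', N) \<in> gseq_rel I" using N N' NN' N'I by (simp add: gseq_rel_def)
    from 1(1)[OF this N' N'I] obtain m0 BB where fin: "finite BB" and BB: "\<forall>B\<in>BB. idl B \<and> B \<subset> I"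
      and gen0: "\<forall>a\<in>I. a \<notin> \<Union>BB \<longrightarrow> (\<forall>m\<ge>m0. \<forall>c\<in>pw I m. a \<otimes> c \<in> N' (Suc m) \<longrightarrow> c \<in> N' m)"
      by (elim exE conjE)
    have gen: "c \<in> N' m" if "a \<in> I" "a \<notin> \<Union>BB" "m \<ge> m0" "c \<in> pw I m" "a \<otimes> c \<in> N (Suc m)" for a m c
      using gen0 that NN'[of "Suc m"] by blast
    show ?thesis
    proof (cases "B = I")
      case True
      have cI: "c \<otimes> b \<in> N (Suc m)" if "b \<in> I" for b using that True mc(3) by (auto simp: colon_in_def)
      have "mulset c (pw I (Suc p)) \<subseteq> N (Suc m + p)" for p
      proof -
        have "mulset c (I \<cdot> pw I p) = mulset c I \<cdot> pw I p" by (rule mulset_prod[OF I pid cc])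
        also have "\<dots> \<subseteq> N (Suc m + p)"
        proof (rule prod_le[OF Nid])
          fix a b assume a: "a \<in> mulset c I" and b: "b \<in> pw I p"
          have a': "a \<in> N (Suc m)" using a cI by (auto simp: mulset_def)
          show "a \<otimes> b \<in> N (Suc m + p)" using gseq_pow[OF I N b a'] m_comm[OF pc[OF b] idl_carr[OF Nid a']] by simp
        qed
        finally show ?thesis by (simp add: pw_Suc2[OF I])
      qed
      hence "mulset c (pw I (j - m)) \<subseteq> N j" if "j \<ge> Suc m" for j
        using that by (metis Suc_diff_Suc Suc_le_lessD le_add_diff_inverse diff_Suc_Suc)
      hence eq: "N' j = N j" if "j \<ge> Suc m" for j using that sum_absorb1[OF Nid cpid] by (simp add: N'_def)
      have "c \<in> N j" if "a \<in> I" "a \<notin> \<Union>BB" "j \<ge> max m0 (Suc m)" "c \<in> pw I j" "a \<otimes> c \<in> N (Suc j)" for a j c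
        using that gen[of a j c] eq[of j] by simp
      thus ?thesis using fin BB by (intro exI[of _ "max m0 (Suc m)"] exI[of _ BB]) auto
    next
      case False
      have BI: "B \<subset> I" using False mc(3) colon_in_subset by blast
      have "c' \<in> N j" if a: "a \<in> I" "a \<notin> \<Union>(insert B BB)" "j \<ge> m0" "c' \<in> pw I j" "a \<otimes> c' \<in> N (Suc j)" for a j c'
      proof (cases "j < m")
        case True
        thus ?thesis using a gen[of a j c'] by (simp add: N'_def)
      next
        case j: False
        have ac: "a \<in> carrier R" using a I idl_carr by blast
        have "c' \<in> N' j" using a gen[of a j c'] by simp
        then obtain n b where nb: "n \<in> N j" "b \<in> pw I (j - m)" "c' = n \<oplus> c \<otimes> b"
          using j by (auto simp: N'_def mem_sum mulset_def)
        note k = idl_carr[OF Nid nb(1)] pc[OF nb(2)]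
        have cbI: "c \<otimes> b \<in> pw I j" using prodI[OF mc(1) nb(2)] pw_add[OF I, of m "j - m"] j by simp
        have "a \<otimes> (c \<otimes> b) = a \<otimes> c' \<ominus> a \<otimes> n" unfolding nb(3) using k ac cc by algebra
        hence acb: "a \<otimes> (c \<otimes> b) \<in> N (Suc j)" using a gseq_step[OF N a(1) nb(1)] idl_minus[OF Nid] by simp
        \<comment> \<open>If c b were outside N, its degree one annihilator would contain B, hence
          equal B by maximality, and a would belong to B.\<close>
        have "c \<otimes> b \<in> N j"
        proof (rule ccontr)
          assume nn: "c \<otimes> b \<notin> N j"
          let ?B = "colon_in (N (Suc j)) (c \<otimes> b) I"
          have "P ?B" using cbI nn by (auto simp: P_def)
          moreover have "B \<subseteq> ?B"
          proof
            fix \<beta> assume "\<beta> \<in> B"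
            hence \<beta>: "\<beta> \<in> I" "c \<otimes> \<beta> \<in> N (Suc m)" using mc(3) by (auto simp: colon_in_def)
            have "b \<otimes> (c \<otimes> \<beta>) \<in> N (Suc m + (j - m))" by (rule gseq_pow[OF I N nb(2) \<beta>(2)])
            moreover have "b \<otimes> (c \<otimes> \<beta>) = (c \<otimes> b) \<otimes> \<beta>" using k cc idl_carr[OF I \<beta>(1)] by algebra
            ultimately show "\<beta> \<in> ?B" using j \<beta> by (simp add: colon_in_def)
          qed
          ultimately have "?B = B" by (rule Bmax)
          moreover have "a \<in> ?B" using a acb ac k cc by (simp add: colon_in_def m_comm)
          ultimately show False using a by simp
        qed
        thus ?thesis using nb idl_add[OF Nid] by simp
      qed
      thus ?thesis using fin BB Bid BI by (intro exI[of _ m0] exI[of _ "insert B BB"]) auto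
    qed
  qed
qed

text \<open>Nonzerodivisor on R/J in the weak sense: J + (a) may be the whole ring. Membership in
  \<mm> is required separately where it matters.\<close>

definition reg :: "'a set \<Rightarrow> 'a \<Rightarrow> bool" where
  "reg J a \<longleftrightarrow> a \<in> carrier R \<and> (\<forall>z\<in>carrier R. a \<otimes> z \<in> J \<longrightarrow> z \<in> J)"

lemma regD: "reg J a \<Longrightarrow> z \<in> carrier R \<Longrightarrow> a \<otimes> z \<in> J \<Longrightarrow> z \<in> J"
  by (simp add: reg_def)

lemma reg_carr: "reg J a \<Longrightarrow> a \<in> carrier R"
  by (simp add: reg_def)

text \<open>\<open>generic_element\<close> is applied to the submodule with components B^m \<inter>
  J. It controls large degrees only; the hypothesis that B kills no nonzero element of R/J brings
  the conclusion back to degree zero.\<close>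

lemma generic_regular:
  assumes B: "idl B" and J: "idl J"
    and soc: "\<And>z. z \<in> carrier R \<Longrightarrow> (\<And>b. b \<in> B \<Longrightarrow> b \<otimes> z \<in> J) \<Longrightarrow> z \<in> J"
  shows "\<exists>BB. finite BB \<and> (\<forall>A\<in>BB. idl A \<and> A \<subset> B) \<and> (\<forall>a\<in>B. a \<notin> \<Union>BB \<longrightarrow> reg J a)"
proof -
  note pc = idl_carr[OF pw_idl[OF B]]
  have "gseq B (\<lambda>m. pw B m \<inter> J)"
  proof (rule gseqI)
    show "idl (pw B m \<inter> J)" for m using pw_idl[OF B] J by (rule idl_Int)
    show "b \<otimes> z \<in> pw B (Suc m) \<inter> J" if "b \<in> B" "z \<in> pw B m \<inter> J" for b z m
      using that gseq_step[OF gseq_pw[OF B]] idl_lmult[OF J] idl_carr[OF B] by auto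
  qed
  from generic_element[OF B this] obtain m0 BB where BB: "finite BB" "\<forall>A\<in>BB. idl A \<and> A \<subset> B"
    and gen0: "\<forall>a\<in>B. a \<notin> \<Union>BB \<longrightarrow>
      (\<forall>m\<ge>m0. \<forall>c\<in>pw B m. a \<otimes> c \<in> pw B (Suc m) \<inter> J \<longrightarrow> c \<in> pw B m \<inter> J)"
    using Int_lower1 by metis
  have gen: "\<And>a m c. a \<in> B \<Longrightarrow> a \<notin> \<Union>BB \<Longrightarrow> m \<ge> m0 \<Longrightarrow> c \<in> pw B m \<Longrightarrow> a \<otimes> c \<in> pw B (Suc m) \<inter> J
      \<Longrightarrow> c \<in> pw B m \<inter> J" using gen0 by blast
  \<comment> \<open>Iterating \<open>soc\<close>: no power of B kills a nonzero element of R/J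
    either.\<close>
  have *: "z \<in> J" if z: "\<And>b. b \<in> pw B m \<Longrightarrow> b \<otimes> z \<in> J" "z \<in> carrier R" for z m
    using z(1)
  proof (induct m)
    case 0 thus ?case using z(2) 0[of "\<one>"] by simp
  next
    case (Suc m)
    have "b' \<otimes> z \<in> J" if b': "b' \<in> pw B m" for b'
    proof (rule soc)
      show "b' \<otimes> z \<in> carrier R" using b' pc z(2) by simp
      fix b assume b: "b \<in> B"
      have "b' \<otimes> b \<in> pw B (Suc m)" unfolding pw_Suc using b' b by (rule prodI)
      hence "(b' \<otimes> b) \<otimes> z \<in> J" by (rule Suc(2))
      moreover have "(b' \<otimes> b) \<otimes> z = b \<otimes> (b' \<otimes> z)" using pc[OF b'] idl_carr[OF B b] \<open>z \<in> carrier R\<close> by algebra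
      ultimately show "b \<otimes> (b' \<otimes> z) \<in> J" by simp
    qed
    thus ?case by (rule Suc(1))
  qed
  have "reg J a" if a: "a \<in> B" "a \<notin> \<Union>BB" for a
    unfolding reg_def
  proof (intro conjI ballI impI)
    show ac: "a \<in> carrier R" using a B idl_carr by blast
    fix z assume z: "z \<in> carrier R" "a \<otimes> z \<in> J"
    show "z \<in> J"
    proof (rule *[of m0, OF _ z(1)])
      fix b assume b: "b \<in> pw B m0"
      have bz: "b \<otimes> z \<in> pw B m0" using idl_rmult[OF pw_idl[OF B] b z(1)] .
      have "a \<otimes> (b \<otimes> z) = b \<otimes> (a \<otimes> z)" using ac pc[OF b] z by algebra
      hence "a \<otimes> (b \<otimes> z) \<in> J" using idl_lmult[OF J z(2) pc[OF b]] by simp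
      moreover have "a \<otimes> (b \<otimes> z) \<in> pw B (Suc m0)" by (rule gseq_step[OF gseq_pw[OF B] a(1) bz])
      ultimately show "b \<otimes> z \<in> J" using gen[OF a order_refl bz] by blast
    qed
  qed
  thus ?thesis using BB by blast
qed

subsection \<open>Regular sequences\<close>

lemma mem_adjoin:
  assumes "idl J" "a \<in> carrier R"
  shows "z \<in> J \<boxplus> PIdl a \<longleftrightarrow> (\<exists>r\<in>carrier R. z \<in> carrier R \<and> z \<ominus> a \<otimes> r \<in> J)"
proof
  assume "z \<in> J \<boxplus> PIdl a"
  then obtain j r where jr: "j \<in> J" "r \<in> carrier R" "z = j \<oplus> r \<otimes> a" by (auto simp: mem_sum pid_mem)
  have jc: "j \<in> carrier R" using jr assms idl_carr by blast
  hence "z \<ominus> a \<otimes> r = j" unfolding jr(3) using jr assms by algebra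
  hence "z \<ominus> a \<otimes> r \<in> J" using jr by simp
  moreover have "z \<in> carrier R" using jr jc assms by simp
  ultimately show "\<exists>r\<in>carrier R. z \<in> carrier R \<and> z \<ominus> a \<otimes> r \<in> J" using jr(2) by blast
next
  assume "\<exists>r\<in>carrier R. z \<in> carrier R \<and> z \<ominus> a \<otimes> r \<in> J"
  then obtain r where r: "r \<in> carrier R" "z \<in> carrier R" "z \<ominus> a \<otimes> r \<in> J" by blast
  have "z = (z \<ominus> a \<otimes> r) \<oplus> r \<otimes> a" using r assms by algebra
  moreover have "r \<otimes> a \<in> PIdl a" using r by (auto simp: pid_mem)
  ultimately show "z \<in> J \<boxplus> PIdl a" using sumI[OF r(3)] by metis
qed

lemma adjoin_idl: "idl J \<Longrightarrow> a \<in> carrier R \<Longrightarrow> idl (J \<boxplus> PIdl a)"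
  by (simp add: add_ideals pid_idl)

lemma adjoin_swap: "idl J \<Longrightarrow> a \<in> carrier R \<Longrightarrow> b \<in> carrier R \<Longrightarrow>
    (J \<boxplus> PIdl a) \<boxplus> PIdl b = (J \<boxplus> PIdl b) \<boxplus> PIdl a"
  by (simp add: sum_assoc pid_idl sum_comm[of "PIdl a" "PIdl b"])

lemma adjoin_ub: "idl J \<Longrightarrow> a \<in> carrier R \<Longrightarrow> J \<subseteq> J \<boxplus> PIdl a"
  by (simp add: sum_ub1 pid_idl)

lemma adjoin_self: "idl J \<Longrightarrow> a \<in> carrier R \<Longrightarrow> a \<in> J \<boxplus> PIdl a"
  using sum_ub2[of J "PIdl a"] pid_idl pid_self by blast

lemma adjoin_le: "idl J \<Longrightarrow> idl A \<Longrightarrow> J \<subseteq> A \<Longrightarrow> a \<in> A \<Longrightarrow> J \<boxplus> PIdl a \<subseteq> A"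
  by (simp add: sum_le pid_le)

text \<open>Some regular sequence of n elements of \<mm> exists on R/J. The existential form lets
  exchange arguments replace the first element.\<close>

primrec depth_ge :: "nat \<Rightarrow> 'a set \<Rightarrow> bool" where
  "depth_ge 0 J = True"
| "depth_ge (Suc n) J = (\<exists>x\<in>\<mm>. reg J x \<and> depth_ge n (J \<boxplus> PIdl x))"

lemma depth_ge_Suc_D: "depth_ge (Suc n) J \<Longrightarrow> depth_ge n J"
proof (induct n arbitrary: J)
  case (Suc n)
  then obtain x where "x \<in> \<mm>" "reg J x" "depth_ge (Suc n) (J \<boxplus> PIdl x)" by auto
  thus ?case using Suc(1) by auto
qed simp

lemma depth_ge_le: "depth_ge n J \<Longrightarrow> k \<le> n \<Longrightarrow> depth_ge k J"
proof (induct n)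
  case (Suc n) thus ?case using depth_ge_Suc_D le_Suc_eq by blast
qed simp

text \<open>From x u = b v modulo J follows v = x w modulo J, and x cancels. This half of permuting
  a regular sequence needs no Nakayama; that b is regular modulo J as well is arranged where the
  lemma is used.\<close>

lemma reg_swap:
  assumes J: "idl J" and x: "reg J x" and b: "reg (J \<boxplus> PIdl x) b"
  shows "reg (J \<boxplus> PIdl b) x"
  unfolding reg_def
proof (intro conjI ballI impI)
  show xc: "x \<in> carrier R" using x by (rule reg_carr)
  have bc: "b \<in> carrier R" using b by (rule reg_carr)
  fix u assume u: "u \<in> carrier R" "x \<otimes> u \<in> J \<boxplus> PIdl b"
  then obtain v where v: "v \<in> carrier R" "x \<otimes> u \<ominus> b \<otimes> v \<in> J" using mem_adjoin[OF J bc] by blast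
  have "\<ominus> (x \<otimes> u \<ominus> b \<otimes> v) \<in> J" using v J idl_neg by blast
  moreover have "\<ominus> (x \<otimes> u \<ominus> b \<otimes> v) = b \<otimes> v \<ominus> x \<otimes> u" using u v xc bc by algebra
  ultimately have "b \<otimes> v \<in> J \<boxplus> PIdl x" using u v xc bc mem_adjoin[OF J xc] by auto
  hence "v \<in> J \<boxplus> PIdl x" using regD[OF b v(1)] by blast
  then obtain w where w: "w \<in> carrier R" "v \<ominus> x \<otimes> w \<in> J" using mem_adjoin[OF J xc] by blast
  have "(x \<otimes> u \<ominus> b \<otimes> v) \<oplus> b \<otimes> (v \<ominus> x \<otimes> w) \<in> J"
    by (rule idl_add[OF J v(2) idl_lmult[OF J w(2) bc]])
  moreover have "(x \<otimes> u \<ominus> b \<otimes> v) \<oplus> b \<otimes> (v \<ominus> x \<otimes> w) = x \<otimes> (u \<ominus> b \<otimes> w)"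
    using u v w xc bc by algebra
  ultimately have "x \<otimes> (u \<ominus> b \<otimes> w) \<in> J" by simp
  hence "u \<ominus> b \<otimes> w \<in> J" using regD[OF x] u w bc by simp
  thus "u \<in> J \<boxplus> PIdl b" using mem_adjoin[OF J bc] u w by blast
qed

text \<open>R/J has zero socle. With an infinite residue field this yields regular elements in
  \<mm>, by generic choice.\<close>

definition socle_free :: "'a set \<Rightarrow> bool" where
  "socle_free J \<longleftrightarrow> (\<forall>z\<in>carrier R. (\<forall>b\<in>\<mm>. b \<otimes> z \<in> J) \<longrightarrow> z \<in> J)"

lemma socle_freeI: "x \<in> \<mm> \<Longrightarrow> reg J x \<Longrightarrow> socle_free J"
  by (auto simp: socle_free_def reg_def)

text \<open>Rees: the socles of \<open>M/xM\<close> and \<open>M/aM\<close> are isomorphic when both \<open>x\<close> and \<open>a\<close> are regular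
  on \<open>M\<close>.\<close>

lemma socle_free_exchange:
  assumes J: "idl J" and x: "x \<in> \<mm>" "reg J x" and a: "a \<in> \<mm>" "reg J a" and sx: "socle_free (J \<boxplus> PIdl x)"
  shows "socle_free (J \<boxplus> PIdl a)"
  unfolding socle_free_def
proof (intro ballI impI)
  note xc = reg_carr[OF x(2)] and ac = reg_carr[OF a(2)]
  fix z assume z: "z \<in> carrier R" "\<forall>b\<in>\<mm>. b \<otimes> z \<in> J \<boxplus> PIdl a"
  hence "x \<otimes> z \<in> J \<boxplus> PIdl a" using x by blast
  then obtain w where w: "w \<in> carrier R" "x \<otimes> z \<ominus> a \<otimes> w \<in> J" using mem_adjoin[OF J ac] by blast
  have "w \<in> J \<boxplus> PIdl x"
  proof -
    have "r \<otimes> w \<in> J \<boxplus> PIdl x" if r: "r \<in> \<mm>" for r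
    proof -
      have rc: "r \<in> carrier R" using r \<mm>_idl idl_carr by blast
      obtain s where s: "s \<in> carrier R" "r \<otimes> z \<ominus> a \<otimes> s \<in> J" using z r mem_adjoin[OF J ac] by blast
      have "x \<otimes> (r \<otimes> z \<ominus> a \<otimes> s) \<ominus> r \<otimes> (x \<otimes> z \<ominus> a \<otimes> w) \<in> J"
        by (rule idl_minus[OF J idl_lmult[OF J s(2) xc] idl_lmult[OF J w(2) rc]])
      moreover have "x \<otimes> (r \<otimes> z \<ominus> a \<otimes> s) \<ominus> r \<otimes> (x \<otimes> z \<ominus> a \<otimes> w) = a \<otimes> (r \<otimes> w \<ominus> x \<otimes> s)"
        using s rc xc ac w z by algebra
      ultimately have "r \<otimes> w \<ominus> x \<otimes> s \<in> J" using regD[OF a(2), of "r \<otimes> w \<ominus> x \<otimes> s"] rc w xc s by simp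
      thus ?thesis using mem_adjoin[OF J xc] s rc w by auto
    qed
    thus ?thesis using sx w unfolding socle_free_def by blast
  qed
  then obtain t where t: "t \<in> carrier R" "w \<ominus> x \<otimes> t \<in> J" using mem_adjoin[OF J xc] by blast
  have "(x \<otimes> z \<ominus> a \<otimes> w) \<oplus> a \<otimes> (w \<ominus> x \<otimes> t) \<in> J"
    by (rule idl_add[OF J w(2) idl_lmult[OF J t(2) ac]])
  moreover have "(x \<otimes> z \<ominus> a \<otimes> w) \<oplus> a \<otimes> (w \<ominus> x \<otimes> t) = x \<otimes> (z \<ominus> a \<otimes> t)"
    using z w t xc ac by algebra
  ultimately have "z \<ominus> a \<otimes> t \<in> J" using regD[OF x(2), of "z \<ominus> a \<otimes> t"] z t ac by simp
  thus "z \<in> J \<boxplus> PIdl a" using mem_adjoin[OF J ac] z t by blast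
qed

lemma generic_regular_\<mm>:
  "idl J \<Longrightarrow> socle_free J \<Longrightarrow>
    \<exists>BB. finite BB \<and> (\<forall>A\<in>BB. idl A \<and> A \<subset> \<mm>) \<and> (\<forall>a\<in>\<mm>. a \<notin> \<Union>BB \<longrightarrow> reg J a)"
  by (rule generic_regular[OF \<mm>_idl]) (auto simp: socle_free_def)

text \<open>Any regular \<open>a\<close> can begin a regular sequence of the length known to exist.
  A generic b, regular modulo J, J + (x) and J + (a), mediates: the induction hypothesis passes from
  x to b and then from b to a.\<close>

lemma depth_exchange:
  assumes inf: "infinite (carrier (R Quot \<mm>))"
  shows "idl J \<Longrightarrow> depth_ge (Suc n) J \<Longrightarrow> a \<in> \<mm> \<Longrightarrow> reg J a \<Longrightarrow> depth_ge n (J \<boxplus> PIdl a)"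
proof (induct n arbitrary: J a)
  case (Suc n)
  note J = Suc(2) and a = Suc(4,5)
  obtain x where x: "x \<in> \<mm>" "reg J x" and dx: "depth_ge (Suc n) (J \<boxplus> PIdl x)" using Suc(3) by auto
  note xc = reg_carr[OF x(2)] and ac = reg_carr[OF a(2)]
  note Jx = adjoin_idl[OF J xc] and Ja = adjoin_idl[OF J ac]
  have sx: "socle_free (J \<boxplus> PIdl x)" using dx socle_freeI by auto
  have sa: "socle_free (J \<boxplus> PIdl a)" by (rule socle_free_exchange[OF J x a sx])
  have s: "socle_free J" using x socle_freeI by blast
  obtain B1 where B1: "finite B1" "\<forall>A\<in>B1. idl A \<and> A \<subset> \<mm>" "\<forall>b\<in>\<mm>. b \<notin> \<Union>B1 \<longrightarrow> reg J b"
    using generic_regular_\<mm>[OF J s] by blast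
  obtain B2 where B2: "finite B2" "\<forall>A\<in>B2. idl A \<and> A \<subset> \<mm>" "\<forall>b\<in>\<mm>. b \<notin> \<Union>B2 \<longrightarrow> reg (J \<boxplus> PIdl x) b"
    using generic_regular_\<mm>[OF Jx sx] by blast
  obtain B3 where B3: "finite B3" "\<forall>A\<in>B3. idl A \<and> A \<subset> \<mm>" "\<forall>b\<in>\<mm>. b \<notin> \<Union>B3 \<longrightarrow> reg (J \<boxplus> PIdl a) b"
    using generic_regular_\<mm>[OF Ja sa] by blast
  have "\<exists>b\<in>\<mm>. b \<notin> \<Union>(B1 \<union> B2 \<union> B3)"
  proof (rule ideal_avoidance[OF inf \<mm>_idl])
    show "finite (B1 \<union> B2 \<union> B3)" using B1(1) B2(1) B3(1) by simp
    show "idl A \<and> A \<subset> \<mm>" if "A \<in> B1 \<union> B2 \<union> B3" for A using that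
      by (elim UnE) (erule B1(2)[rule_format] B2(2)[rule_format] B3(2)[rule_format])+
  qed
  then obtain b where b0: "b \<in> \<mm>" "b \<notin> \<Union>B1" "b \<notin> \<Union>B2" "b \<notin> \<Union>B3" by auto
  have b: "b \<in> \<mm>" "reg J b" "reg (J \<boxplus> PIdl x) b" "reg (J \<boxplus> PIdl a) b"
    using b0 B1(3) B2(3) B3(3) by simp_all
  note bc = reg_carr[OF b(2)]
  note Jb = adjoin_idl[OF J bc]
  have "depth_ge n ((J \<boxplus> PIdl x) \<boxplus> PIdl b)" by (rule Suc(1)[OF Jx dx b(1,3)])
  hence "depth_ge n ((J \<boxplus> PIdl b) \<boxplus> PIdl x)" by (simp add: adjoin_swap[OF J xc bc])
  hence "depth_ge (Suc n) (J \<boxplus> PIdl b)" using x reg_swap[OF J x(2) b(3)] by auto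
  hence "depth_ge n ((J \<boxplus> PIdl b) \<boxplus> PIdl a)"
    by (rule Suc(1)[OF Jb _ a(1) reg_swap[OF J a(2) b(4)]])
  hence "depth_ge n ((J \<boxplus> PIdl a) \<boxplus> PIdl b)" by (simp add: adjoin_swap[OF J ac bc])
  thus ?case using b by auto
qed simp

lemma regular_sequence_depth_ge:
  assumes "set xs \<subseteq> \<mm>" "regular_sequence R xs"
  shows "depth_ge (length xs) {\<zero>}"
proof -
  have c: "set xs \<subseteq> carrier R" using assms(1) \<mm>_idl idl_subset by blast
  have "depth_ge (length xs - i) (genideal R (set (take i xs)))" if "i \<le> length xs" for i
    using that
  proof (induct i rule: inc_induct)
    case (step i)
    have i: "i < length xs" using step by simp
    have xi: "xs ! i \<in> \<mm>" "xs ! i \<in> carrier R" using assms(1) c nth_mem[OF i] by auto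
    have ti: "set (take i xs) \<subseteq> carrier R" using c set_take_subset[of i xs] by (rule subset_trans[rotated])
    have "set (take (Suc i) xs) = insert (xs ! i) (set (take i xs))" using i by (simp add: take_Suc_conv_app_nth)
    hence "genideal R (set (take (Suc i) xs)) = genideal R (set (take i xs)) \<boxplus> PIdl (xs ! i)"
      using genideal_insert[OF ti xi(2)] sum_comm[OF pid_idl[OF xi(2)] genideal_ideal[OF ti]] by simp
    moreover have "reg (genideal R (set (take i xs))) (xs ! i)"
      using assms(2) i xi by (simp add: reg_def regular_sequence_def)
    moreover have "length xs - i = Suc (length xs - Suc i)" using i by simp
    ultimately show ?case using step xi by auto
  qed simp
  from this[of 0] show ?thesis by (simp add: genideal_empty)
qed

end

subsection \<open>Numerical polynomials\<close>

text \<open>Literally the sum in \<open>hilbert_coeff\<close>. Truncated subtraction only matters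
  for m = 0 and i = d, where the binomial coefficient is \<open>0 choose 0\<close>.\<close>

definition hilb_poly :: "nat \<Rightarrow> (nat \<Rightarrow> int) \<Rightarrow> nat \<Rightarrow> int" where
  "hilb_poly d e m = (\<Sum>i\<le>d. (-1) ^ i * e i * int ((m + d - 1 - i) choose (d - i)))"

text \<open>Pascal's rule in each summand. Differencing keeps the coefficients e_0, ..., e_d and
  kills the constant term belonging to e_(d+1).\<close>

lemma hilb_poly_Suc_diff:
  "hilb_poly (Suc d) e (Suc m) - hilb_poly (Suc d) e m = hilb_poly d e (Suc m)"
proof -
  have *: "(-1) ^ i * e i * int ((Suc m + Suc d - 1 - i) choose (Suc d - i))
      - (-1) ^ i * e i * int ((m + Suc d - 1 - i) choose (Suc d - i))
      = (-1) ^ i * e i * int ((Suc m + d - 1 - i) choose (d - i))" if "i \<le> d" for i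
  proof -
    have "Suc m + Suc d - 1 - i = Suc (m + d - i)" "Suc d - i = Suc (d - i)" using that by auto
    hence "int ((Suc m + Suc d - 1 - i) choose (Suc d - i))
      = int ((m + d - i) choose (d - i)) + int ((m + d - i) choose (Suc (d - i)))" by simp
    moreover have "m + Suc d - 1 - i = m + d - i" "Suc m + d - 1 - i = m + d - i" using that by auto
    ultimately show ?thesis using \<open>Suc d - i = Suc (d - i)\<close> by (simp add: algebra_simps)
  qed
  have "hilb_poly (Suc d) e (Suc m) - hilb_poly (Suc d) e m
    = (\<Sum>i\<le>d. (-1) ^ i * e i * int ((Suc m + Suc d - 1 - i) choose (Suc d - i))
      - (-1) ^ i * e i * int ((m + Suc d - 1 - i) choose (Suc d - i)))"
    unfolding hilb_poly_def sum_subtractf by simp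
  also have "\<dots> = hilb_poly d e (Suc m)" unfolding hilb_poly_def by (intro sum.cong refl *) simp
  finally show ?thesis .
qed

lemma hilb_poly_cong: "(\<And>i. i \<le> d \<Longrightarrow> e i = e' i) \<Longrightarrow> hilb_poly d e m = hilb_poly d e' m"
  unfolding hilb_poly_def by (intro sum.cong refl) simp

lemma hilb_poly_sum:
  assumes "\<And>m. m \<ge> m0 \<Longrightarrow> f (Suc m) - f m = hilb_poly d e (Suc m)"
  shows "\<exists>e'. (\<forall>i\<le>d. e' i = e i) \<and> (\<forall>m\<ge>m0. f m = hilb_poly (Suc d) e' m)"
proof -
  \<comment> \<open>The constant of integration. It becomes the new last coefficient, up to the
    alternating sign.\<close>
  define c where "c = f m0 - hilb_poly (Suc d) (e(Suc d := 0)) m0"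
  define e' where "e' = e(Suc d := (-1) ^ Suc d * c)"
  have e': "e' i = e i" if "i \<le> d" for i using that by (simp add: e'_def)
  have top: "(-1) ^ Suc d * e' (Suc d) = c"
    by (simp add: e'_def mult.assoc[symmetric] power_add[symmetric])
  have eq: "hilb_poly (Suc d) e' m = hilb_poly (Suc d) (e(Suc d := 0)) m + c" for m
    unfolding hilb_poly_def using top by (simp add: e')
  have "f m = hilb_poly (Suc d) e' m" if "m \<ge> m0" for m
    using that
  proof (induct m rule: dec_induct)
    case base show ?case by (simp add: eq c_def)
  next
    case (step m)
    have "f (Suc m) = f m + hilb_poly d e (Suc m)" using assms[OF step(1)] by simp
    also have "hilb_poly d e (Suc m) = hilb_poly d e' (Suc m)" by (rule hilb_poly_cong) (simp add: e')
    also have "\<dots> = hilb_poly (Suc d) e' (Suc m) - hilb_poly (Suc d) e' m" by (simp add: hilb_poly_Suc_diff)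
    finally show ?case using step by simp
  qed
  thus ?thesis using e' by blast
qed

lemma hilb_poly_unique:
  assumes "\<And>m. m \<ge> m0 \<Longrightarrow> hilb_poly d e m = hilb_poly d e' m"
  shows "\<forall>i\<le>d. e i = e' i"
  using assms
proof (induct d arbitrary: m0)
  case 0
  thus ?case using 0[of m0] by (simp add: hilb_poly_def)
next
  case (Suc d)
  have "hilb_poly d e m = hilb_poly d e' m" if m: "Suc m0 \<le> m" for m
  proof -
    obtain k where k: "m = Suc k" "m0 \<le> k" using m Suc_le_D by auto
    have "hilb_poly (Suc d) e (Suc k) = hilb_poly (Suc d) e' (Suc k)" using k(2) by (intro Suc(2)) simp
    thus ?thesis using Suc(2)[OF k(2)] hilb_poly_Suc_diff[of d e k] hilb_poly_Suc_diff[of d e' k] unfolding k(1) by linarith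
  qed
  hence IH: "\<forall>i\<le>d. e i = e' i" by (rule Suc(1))
  hence "(\<Sum>i\<le>d. (-1) ^ i * e i * int ((m0 + Suc d - 1 - i) choose (Suc d - i)))
      = (\<Sum>i\<le>d. (-1) ^ i * e' i * int ((m0 + Suc d - 1 - i) choose (Suc d - i)))"
    by (intro sum.cong refl) simp
  hence "e (Suc d) = e' (Suc d)" using Suc(2)[of m0] by (simp add: hilb_poly_def)
  thus ?case using IH le_Suc_eq by auto
qed

subsection \<open>Chains of prime ideals\<close>

definition prime_chain :: "('a, 'b) ring_scheme \<Rightarrow> nat \<Rightarrow> (nat \<Rightarrow> 'a set) \<Rightarrow> bool" where
  "prime_chain R n P \<longleftrightarrow> (\<forall>i\<le>n. primeideal (P i) R) \<and> (\<forall>i<n. P i \<subset> P (Suc i))"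

lemma prime_chain_krull_dim: "prime_chain R n P \<Longrightarrow> ereal (real n) \<le> krull_dim R"
  unfolding krull_dim_def prime_chain_def by (rule Sup_upper) blast

lemma prime_chain_snoc:
  assumes "prime_chain R n C" "primeideal P R" "C n \<subset> P"
  shows "prime_chain R (Suc n) (C(Suc n := P))"
  using assms by (auto simp: prime_chain_def le_Suc_eq less_Suc_eq)

lemma prime_chain_cons:
  assumes "prime_chain R n C" "primeideal P R" "P \<subset> C 0"
  shows "prime_chain R (Suc n) (case_nat P C)"
proof -
  have "primeideal (case_nat P C i) R" if "i \<le> Suc n" for i
    using that assms by (cases i) (auto simp: prime_chain_def)
  moreover have "case_nat P C i \<subset> case_nat P C (Suc i)" if "i < Suc n" for i
    using that assms by (cases i) (auto simp: prime_chain_def)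
  ultimately show ?thesis unfolding prime_chain_def by blast
qed

context noetherian_local_ring
begin

lemma primeideal_idl: "primeideal P R \<Longrightarrow> idl P"
  by (rule primeideal.axioms(1))

lemma primeideal_mem: "primeideal P R \<Longrightarrow> a \<in> carrier R \<Longrightarrow> b \<in> carrier R \<Longrightarrow> a \<otimes> b \<in> P \<Longrightarrow> a \<in> P \<or> b \<in> P"
  by (rule primeideal.I_prime)

lemma primeideal_one: "primeideal P R \<Longrightarrow> \<one> \<notin> P"
  using idl_one_eq primeideal.I_notcarr primeideal_idl by metis

lemma primeidealI':
  assumes "idl P" "\<one> \<notin> P" "\<And>a b. a \<in> carrier R \<Longrightarrow> b \<in> carrier R \<Longrightarrow> a \<otimes> b \<in> P \<Longrightarrow> a \<notin> P \<Longrightarrow> b \<in> P"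
  shows "primeideal P R"
proof (rule primeidealI[OF assms(1)])
  show "cring R" by (rule cring_axioms)
  show "carrier R \<noteq> P" using assms(2) by auto
  show "a \<in> P \<or> b \<in> P" if "a \<in> carrier R" "b \<in> carrier R" "a \<otimes> b \<in> P" for a b using assms(3) that by metis
qed

lemma \<mm>_prime: "primeideal \<mm> R"
  using maximalideal_prime[OF maximal] .

lemma primeideal_le_\<mm>: "primeideal P R \<Longrightarrow> P \<subseteq> \<mm>"
  using proper_le_\<mm> primeideal_idl primeideal.I_notcarr by metis

text \<open>An ideal Q maximal among those disjoint from S is prime: for u, v outside Q both Q + (u)
  and Q + (v) meet S, and if u v were in Q, so would be the product of the two elements met.\<close>

lemma prime_avoiding:
  assumes J: "idl J" and S: "\<one> \<in> S" "S \<subseteq> carrier R" "\<And>s t. s \<in> S \<Longrightarrow> t \<in> S \<Longrightarrow> s \<otimes> t \<in> S"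
    and JS: "J \<inter> S = {}"
  obtains Q where "primeideal Q R" "J \<subseteq> Q" "Q \<inter> S = {}"
proof -
  obtain Q where Q0: "idl Q \<and> J \<subseteq> Q \<and> Q \<inter> S = {}"
    and max: "\<And>B. idl B \<and> J \<subseteq> B \<and> B \<inter> S = {} \<Longrightarrow> Q \<subseteq> B \<Longrightarrow> B = Q"
    by (rule obtain_maximal[of "\<lambda>Q. idl Q \<and> J \<subseteq> Q \<and> Q \<inter> S = {}" J]) (use J JS in auto)
  hence Q: "idl Q" "J \<subseteq> Q" "Q \<inter> S = {}" by auto
  have meet: "\<exists>r\<in>carrier R. \<exists>s\<in>S. s \<ominus> u \<otimes> r \<in> Q" if u: "u \<in> carrier R" "u \<notin> Q" for u
  proof (rule ccontr)
    assume n: "\<not> ?thesis"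
    have "(Q \<boxplus> PIdl u) \<inter> S = {}" using n mem_adjoin[OF Q(1) u(1)] by blast
    hence "Q \<boxplus> PIdl u = Q" using max[of "Q \<boxplus> PIdl u"] adjoin_idl[OF Q(1) u(1)] adjoin_ub[OF Q(1) u(1)] Q(2) by auto
    thus False using adjoin_self[OF Q(1) u(1)] u by simp
  qed
  have "primeideal Q R"
  proof (rule primeidealI'[OF Q(1)])
    show "\<one> \<notin> Q" using S Q by auto
    fix u v assume u: "u \<in> carrier R" and v: "v \<in> carrier R" and uv: "u \<otimes> v \<in> Q" and nu: "u \<notin> Q"
    show "v \<in> Q"
    proof (rule ccontr)
      assume nv: "v \<notin> Q"
      obtain r s where rs: "r \<in> carrier R" "s \<in> S" "s \<ominus> u \<otimes> r \<in> Q" using meet[OF u nu] by blast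
      obtain r' s' where rs': "r' \<in> carrier R" "s' \<in> S" "s' \<ominus> v \<otimes> r' \<in> Q" using meet[OF v nv] by blast
      have sc: "s \<in> carrier R" "s' \<in> carrier R" using rs rs' S by auto
      have "(s' \<otimes> (s \<ominus> u \<otimes> r) \<oplus> (u \<otimes> r) \<otimes> (s' \<ominus> v \<otimes> r')) \<oplus> (r \<otimes> r') \<otimes> (u \<otimes> v) \<in> Q"
        by (intro idl_add[OF Q(1)] idl_lmult[OF Q(1)] rs rs' uv) (use sc u v rs rs' in auto)
      moreover have "(s' \<otimes> (s \<ominus> u \<otimes> r) \<oplus> (u \<otimes> r) \<otimes> (s' \<ominus> v \<otimes> r')) \<oplus> (r \<otimes> r') \<otimes> (u \<otimes> v) = s \<otimes> s'"
        using sc u v rs(1) rs'(1) by algebra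
      ultimately have "s \<otimes> s' \<in> Q" by simp
      thus False using S(3)[OF rs(2) rs'(2)] Q(3) by blast
    qed
  qed
  thus thesis using that Q by blast
qed

text \<open>An element regular on R/J lies in no minimal prime over J. Instead of localizing at P, a
  prime is found that avoids all s a^n with s outside P.\<close>

lemma prime_below:
  assumes P: "primeideal P R" and J: "idl J" "J \<subseteq> P" and a: "reg J a" "a \<in> P"
  obtains Q where "primeideal Q R" "J \<subseteq> Q" "Q \<subset> P"
proof -
  define S where "S = {s \<otimes> a [^] n | s n. s \<in> carrier R \<and> s \<notin> P \<and> n \<in> (UNIV :: nat set)}"
  have ac: "a \<in> carrier R" using a reg_carr by blast
  have SI: "s \<otimes> a [^] n \<in> S" if "s \<in> carrier R" "s \<notin> P" for s and n :: nat using that unfolding S_def by blast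
  have SD: "\<exists>t. \<exists>n::nat. t \<in> carrier R \<and> t \<notin> P \<and> s = t \<otimes> a [^] n" if "s \<in> S" for s using that unfolding S_def by blast
  note P1 = primeideal_one[OF P]
  have regpow: "z \<in> J" if "z \<in> carrier R" "z \<otimes> a [^] n \<in> J" for z and n :: nat
    using that(2)
  proof (induct n)
    case (Suc n)
    have "a \<otimes> (z \<otimes> a [^] n) = z \<otimes> a [^] Suc n" using that(1) ac by (simp add: m_ac)
    hence "a \<otimes> (z \<otimes> a [^] n) \<in> J" using Suc(2) by simp
    hence "z \<otimes> a [^] n \<in> J" by (rule regD[OF a(1), rotated]) (use that(1) ac in simp)
    thus ?case by (rule Suc(1))
  qed (use that(1) in simp)
  have m1: "\<one> \<in> S" using SI[of "\<one>" 0] P1 by simp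
  have m2: "S \<subseteq> carrier R"
  proof
    fix s assume "s \<in> S"
    from SD[OF this] obtain t n where "t \<in> carrier R" "s = t \<otimes> a [^] (n::nat)" by blast
    thus "s \<in> carrier R" using ac by simp
  qed
  have m3: "s \<otimes> t \<in> S" if s: "s \<in> S" and t: "t \<in> S" for s t
  proof -
    obtain u n where u: "u \<in> carrier R" "u \<notin> P" "s = u \<otimes> a [^] (n::nat)" using SD[OF s] by blast
    obtain v k where v: "v \<in> carrier R" "v \<notin> P" "t = v \<otimes> a [^] (k::nat)" using SD[OF t] by blast
    have "(u \<otimes> v) \<otimes> a [^] (n + k) = s \<otimes> t" unfolding u v using u(1) v(1) ac
      by (simp add: nat_pow_mult[symmetric] m_ac)
    moreover have "u \<otimes> v \<notin> P" using primeideal_mem[OF P u(1) v(1)] u v by blast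
    ultimately show ?thesis using SI[of "u \<otimes> v" "n + k"] u v by simp
  qed
  have m4: "J \<inter> S = {}"
  proof (rule ccontr)
    assume "J \<inter> S \<noteq> {}"
    then obtain s where s: "s \<in> J" "s \<in> S" by blast
    obtain t n where t: "t \<in> carrier R" "t \<notin> P" "s = t \<otimes> a [^] (n::nat)" using SD[OF s(2)] by blast
    hence "t \<in> J" using regpow s by blast
    thus False using t J by blast
  qed
  obtain Q where Q: "primeideal Q R" "J \<subseteq> Q" "Q \<inter> S = {}"
    by (rule prime_avoiding[OF J(1) m1 m2 m3 m4])
  have "Q \<subseteq> P"
  proof
    fix t assume t: "t \<in> Q"
    hence tc: "t \<in> carrier R" using primeideal_idl[OF Q(1)] idl_carr by blast
    show "t \<in> P"
    proof (rule ccontr)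
      assume "t \<notin> P" hence "t \<in> S" using SI[OF tc, of 0] tc by simp
      thus False using Q t by blast
    qed
  qed
  moreover have "a \<notin> Q" using SI[OF one_closed P1, of 1] ac Q by auto
  ultimately show thesis using that Q a by blast
qed

text \<open>Ideals generated by a regular sequence of n elements of \<mm>. The sequence grows at its
  end, whereas \<open>depth_ge\<close> consumes one from its beginning.\<close>

inductive regular_ext :: "nat \<Rightarrow> 'a set \<Rightarrow> bool" where
  zero: "regular_ext 0 {\<zero>}"
| adjoin: "regular_ext n J \<Longrightarrow> a \<in> \<mm> \<Longrightarrow> reg J a \<Longrightarrow> regular_ext (Suc n) (J \<boxplus> PIdl a)"

lemma regular_ext_idl: "regular_ext n J \<Longrightarrow> idl J"
  by (induct rule: regular_ext.induct) (auto simp: zeroideal adjoin_idl reg_carr)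

text \<open>Primes over such an ideal have height at least n: each regular element allows one
  descent by \<open>prime_below\<close>.\<close>

lemma regular_ext_chain:
  "regular_ext n J \<Longrightarrow> primeideal P R \<Longrightarrow> J \<subseteq> P \<Longrightarrow> \<exists>C. prime_chain R n C \<and> C n = P"
proof (induct arbitrary: P rule: regular_ext.induct)
  case zero
  thus ?case by (intro exI[of _ "\<lambda>_. P"]) (simp add: prime_chain_def)
next
  case (adjoin n J a)
  have J: "idl J" by (rule regular_ext_idl[OF adjoin(1)])
  have ac: "a \<in> carrier R" using adjoin reg_carr by blast
  have JP: "J \<subseteq> P" "a \<in> P" using adjoin(6) adjoin_ub[OF J ac] adjoin_self[OF J ac] by auto
  obtain Q where Q: "primeideal Q R" "J \<subseteq> Q" "Q \<subset> P" by (rule prime_below[OF adjoin(5) J JP(1) adjoin(4) JP(2)])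
  obtain C where C: "prime_chain R n C" "C n = Q" using adjoin(2)[OF Q(1,2)] by blast
  have "prime_chain R (Suc n) (C(Suc n := P))" using C Q adjoin(5) by (intro prime_chain_snoc) auto
  moreover have "(C(Suc n := P)) (Suc n) = P" by simp
  ultimately show ?case by blast
qed

lemma pw_sum_le: "idl A \<Longrightarrow> idl B \<Longrightarrow> pw (A \<boxplus> B) (m + n) \<subseteq> pw A m \<boxplus> pw B n"
proof (induct "m + n" arbitrary: m n)
  case 0 
  thus ?case using sum_ub1[OF oneideal oneideal] by simp
next
  case (Suc k)
  note A = Suc(3) and B = Suc(4)
  note AB = add_ideals[OF A B]
  have tgt: "idl (pw A m \<boxplus> pw B n)" using A B by (simp add: add_ideals pw_idl)
  show ?case
  proof (cases "m = 0 \<or> n = 0")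
    case True
    have "carrier R \<subseteq> pw A m \<boxplus> pw B n"
      using True sum_ub1[OF pw_idl[OF A] pw_idl[OF B]] sum_ub2[OF pw_idl[OF A] pw_idl[OF B]] by (metis pw_0)
    thus ?thesis using idl_subset[OF pw_idl[OF AB]] by blast
  next
    case False
    then obtain m' n' where mn: "m = Suc m'" "n = Suc n'" by (cases m; cases n) auto
    have k: "k = m' + n" "k = m + n'" using Suc(2) mn by auto
    have "pw (A \<boxplus> B) (m + n) = pw (A \<boxplus> B) k \<cdot> A \<boxplus> pw (A \<boxplus> B) k \<cdot> B"
      using Suc(2) pw_Suc prod_sum_r[OF pw_idl[OF AB] A B] by metis
    also have "\<dots> \<subseteq> (pw A m' \<boxplus> pw B n) \<cdot> A \<boxplus> (pw A m \<boxplus> pw B n') \<cdot> B"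
      using Suc(1)[OF k(1) A B] Suc(1)[OF k(2) A B] k by (intro sum_mono prod_mono) auto
    also have "\<dots> = (pw A m' \<cdot> A \<boxplus> pw B n \<cdot> A) \<boxplus> (pw A m \<cdot> B \<boxplus> pw B n' \<cdot> B)"
      using A B by (simp add: prod_sum_l pw_idl)
    also have "\<dots> \<subseteq> pw A m \<boxplus> pw B n"
    proof -
      have "pw A m' \<cdot> A \<subseteq> pw A m" "pw B n' \<cdot> B \<subseteq> pw B n" unfolding mn pw_Suc by auto
      moreover have "pw B n \<cdot> A \<subseteq> pw B n" "pw A m \<cdot> B \<subseteq> pw A m" using A B by (simp_all add: prod_subset1 pw_idl)
      ultimately show ?thesis
        using sum_ub1[OF pw_idl[OF A, of m] pw_idl[OF B, of n]] sum_ub2[OF pw_idl[OF A, of m] pw_idl[OF B, of n]] tgt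
        by (intro sum_le tgt) blast+
    qed
    finally show ?thesis .
  qed
qed

lemma pw_gen_le:
  assumes "finite S" "S \<subseteq> carrier R" "idl J" "\<And>s. s \<in> S \<Longrightarrow> \<exists>n::nat. s [^] n \<in> J"
  shows "\<exists>N. pw (Idl S) N \<subseteq> J"
  using assms
proof (induct S)
  case empty
  have "pw {\<zero>} (Suc 0) \<subseteq> J" using empty idl_zero by (simp add: pw_1 zeroideal)
  thus ?case by (auto simp: genideal_empty)
next
  case (insert s S)
  obtain N where N: "pw (Idl S) N \<subseteq> J" using insert by auto
  obtain n where n: "s [^] (n::nat) \<in> J" using insert(6)[of s] by blast
  have s: "s \<in> carrier R" "S \<subseteq> carrier R" using insert by auto
  have "pw (PIdl s) k \<subseteq> PIdl (s [^] k)" for k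
  proof (induct k)
    case 0 show ?case using pid_idl[OF one_closed] pid_self[OF one_closed] idl_one_eq by simp
  next
    case (Suc k)
    show ?case unfolding pw_Suc
    proof (rule prod_le)
      show "idl (PIdl (s [^] Suc k))" using s by (intro pid_idl) simp
      fix a b assume a: "a \<in> pw (PIdl s) k" and b: "b \<in> PIdl s"
      obtain r where r: "r \<in> carrier R" "a = r \<otimes> s [^] k" using subsetD[OF Suc a] by (auto simp: pid_mem)
      obtain t where t: "t \<in> carrier R" "b = t \<otimes> s" using b by (auto simp: pid_mem)
      have "a \<otimes> b = (r \<otimes> t) \<otimes> s [^] Suc k" unfolding r t using r(1) t(1) s by (simp add: m_ac)
      thus "a \<otimes> b \<in> PIdl (s [^] Suc k)" using r t pid_mem by blast
    qed
  qed
  hence "pw (PIdl s) n \<subseteq> J" using pid_le[OF insert(5) n] by blast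
  moreover have "pw (Idl (insert s S)) (n + N) \<subseteq> pw (PIdl s) n \<boxplus> pw (Idl S) N"
    unfolding genideal_insert[OF s(2,1)] by (rule pw_sum_le) (use s in \<open>auto simp: pid_idl genideal_ideal\<close>)
  ultimately show ?case using N sum_le[OF _ _ insert(5)] by (meson subset_trans)
qed

text \<open>A generator of \<mm> without a power in J would be missing from some prime over
  J.\<close>

lemma nilpotent_mod:
  assumes J: "idl J" and only: "\<And>P. primeideal P R \<Longrightarrow> J \<subseteq> P \<Longrightarrow> P = \<mm>"
  shows "\<exists>N. pw \<mm> N \<subseteq> J"
proof -
  obtain S where S: "S \<subseteq> carrier R" "finite S" "\<mm> = Idl S" using fin_gen[OF \<mm>_idl] by blast
  have "\<exists>n::nat. s [^] n \<in> J" if s: "s \<in> S" for s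
  proof (rule ccontr)
    assume n: "\<not> ?thesis"
    have sc: "s \<in> carrier R" using s S by blast
    let ?T = "range (\<lambda>n::nat. s [^] n)"
    have t1: "\<one> \<in> ?T" by (rule range_eqI[of _ _ 0]) simp
    have t2: "?T \<subseteq> carrier R" using sc by auto
    have t3: "x \<otimes> y \<in> ?T" if "x \<in> ?T" "y \<in> ?T" for x y
      using that sc by (auto simp: nat_pow_mult)
    have t4: "J \<inter> ?T = {}" using n by auto
    obtain Q where Q: "primeideal Q R" "J \<subseteq> Q" "Q \<inter> ?T = {}" by (rule prime_avoiding[OF J t1 t2 t3 t4])
    have "s \<in> Q" using only[OF Q(1,2)] S s genideal_self by blast
    moreover have "s \<in> ?T" by (rule range_eqI[of _ _ 1]) (use sc in simp)
    ultimately show False using Q by blast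
  qed
  from pw_gen_le[OF S(2,1) J this] show ?thesis using S(3) by simp
qed

text \<open>A regular sequence of length dim R is a system of parameters: a prime over J other than
  \<mm> tops a chain of length d, which \<mm> would prolong.\<close>

lemma regular_ext_\<mm>_power:
  assumes "regular_ext d J" "krull_dim R = ereal (real d)"
  shows "\<exists>N. pw \<mm> N \<subseteq> J"
proof (rule nilpotent_mod[OF regular_ext_idl[OF assms(1)]])
  fix P assume P: "primeideal P R" "J \<subseteq> P"
  obtain C where C: "prime_chain R d C" "C d = P" using regular_ext_chain[OF assms(1) P] by blast
  show "P = \<mm>"
  proof (rule ccontr)
    assume "P \<noteq> \<mm>"
    hence "C d \<subset> \<mm>" using primeideal_le_\<mm>[OF P(1)] C by blast
    from prime_chain_krull_dim[OF prime_chain_snoc[OF C(1) \<mm>_prime this]] show False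
      using assms(2) by simp
  qed
qed

text \<open>Associated primes of R/J: a maximal annihilator of a nonzero residue class is
  prime.\<close>

lemma ann_prime_exists:
  assumes J: "idl J" and c: "c \<in> carrier R" "c \<notin> J"
  shows "\<exists>e\<in>carrier R. e \<notin> J \<and> colon_in J c (carrier R) \<subseteq> colon_in J e (carrier R) \<and>
    primeideal (colon_in J e (carrier R)) R"
proof -
  define P where "P A \<longleftrightarrow> colon_in J c (carrier R) \<subseteq> A \<and> (\<exists>e\<in>carrier R. e \<notin> J \<and> A = colon_in J e (carrier R))" for A
  have "P (colon_in J c (carrier R))" unfolding P_def using c by blast
  moreover have "idl A" if "P A" for A using that colon_in_idl[OF J _ oneideal] unfolding P_def by blast
  ultimately obtain Q where Q: "P Q" and max: "\<And>B. P B \<Longrightarrow> Q \<subseteq> B \<Longrightarrow> B = Q"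
    using obtain_maximal[of P] by metis
  obtain e where e: "e \<in> carrier R" "e \<notin> J" "Q = colon_in J e (carrier R)" "colon_in J c (carrier R) \<subseteq> Q"
    using Q unfolding P_def by blast
  have "primeideal Q R"
  proof (rule primeidealI')
    show "idl Q" unfolding e(3) by (rule colon_in_idl[OF J e(1) oneideal])
    show "\<one> \<notin> Q" using e by (simp add: colon_in_def)
    fix a b assume ab: "a \<in> carrier R" "b \<in> carrier R" "a \<otimes> b \<in> Q" "a \<notin> Q"
    have ea: "e \<otimes> a \<notin> J" "e \<otimes> a \<in> carrier R" using ab e by (simp_all add: colon_in_def)
    let ?B = "colon_in J (e \<otimes> a) (carrier R)"
    have "Q \<subseteq> ?B"
    proof
      fix r assume "r \<in> Q"
      hence r: "r \<in> carrier R" "e \<otimes> r \<in> J" using e by (simp_all add: colon_in_def)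
      have "a \<otimes> (e \<otimes> r) = (e \<otimes> a) \<otimes> r" using r(1) ab(1) e(1) by algebra
      thus "r \<in> ?B" using r idl_lmult[OF J r(2) ab(1)] by (simp add: colon_in_def)
    qed
    moreover from this have "P ?B" unfolding P_def using e(4) ea by blast
    ultimately have "?B = Q" by (rule max[rotated])
    moreover have "b \<in> ?B" using ab e by (simp add: colon_in_def m_assoc)
    ultimately show "b \<in> Q" by simp
  qed
  thus ?thesis using e by blast
qed

text \<open>The primes of the chain are annihilators of elements modulo the successive members of a regular
  sequence.\<close>

lemma depth_prime_chain:
  "idl J \<Longrightarrow> depth_ge n J \<Longrightarrow> c \<in> carrier R \<Longrightarrow> c \<notin> J \<Longrightarrow> primeideal (colon_in J c (carrier R)) R \<Longrightarrow>
    \<exists>C. prime_chain R n C \<and> C 0 = colon_in J c (carrier R)"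
proof (induct n arbitrary: J c)
  case 0
  show ?case by (intro exI[of _ "\<lambda>_. colon_in J c (carrier R)"]) (use 0 in \<open>simp add: prime_chain_def\<close>)
next
  case (Suc n)
  note J = Suc(2)
  let ?p = "colon_in J c (carrier R)"
  obtain x where x: "x \<in> \<mm>" "reg J x" "depth_ge n (J \<boxplus> PIdl x)" using Suc(3) by auto
  have xc: "x \<in> carrier R" using x reg_carr by blast
  note Jx = adjoin_idl[OF J xc]
  \<comment> \<open>Among the elements with annihilator \<open>?p\<close>, one generating a maximal
    ideal over J is chosen; this keeps it out of J + (x).\<close>
  define P where "P A \<longleftrightarrow> (\<exists>e\<in>carrier R. e \<notin> J \<and> colon_in J e (carrier R) = ?p \<and> A = J \<boxplus> PIdl e)" for A
  have "P (J \<boxplus> PIdl c)" unfolding P_def using Suc by blast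
  moreover have "idl A" if "P A" for A using that adjoin_idl[OF J] unfolding P_def by blast
  ultimately obtain B where B: "P B" and max: "\<And>A. P A \<Longrightarrow> B \<subseteq> A \<Longrightarrow> A = B"
    using obtain_maximal[of P] by metis
  obtain e where e: "e \<in> carrier R" "e \<notin> J" "colon_in J e (carrier R) = ?p" "B = J \<boxplus> PIdl e"
    using B unfolding P_def by blast
  \<comment> \<open>If e = x r modulo J, then r has the same annihilator as e since x is regular, so
    J + (r) = J + (e) by maximality. Thus r = e s = s x r modulo J, which forces r into J.\<close>
  have enx: "e \<notin> J \<boxplus> PIdl x"
  proof
    assume "e \<in> J \<boxplus> PIdl x"
    then obtain r where r: "r \<in> carrier R" "e \<ominus> x \<otimes> r \<in> J" using mem_adjoin[OF J xc] by blast
    have eq: "e \<otimes> t \<in> J \<longleftrightarrow> r \<otimes> t \<in> J" if t: "t \<in> carrier R" for t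
    proof -
      have m: "t \<otimes> (e \<ominus> x \<otimes> r) \<in> J" by (rule idl_lmult[OF J r(2) t])
      show ?thesis
      proof
        assume "e \<otimes> t \<in> J"
        hence "e \<otimes> t \<ominus> t \<otimes> (e \<ominus> x \<otimes> r) \<in> J" using m idl_minus[OF J] by blast
        moreover have "e \<otimes> t \<ominus> t \<otimes> (e \<ominus> x \<otimes> r) = x \<otimes> (r \<otimes> t)" using t r(1) xc e(1) by algebra
        ultimately show "r \<otimes> t \<in> J" using regD[OF x(2), of "r \<otimes> t"] r t by simp
      next
        assume "r \<otimes> t \<in> J"
        hence "t \<otimes> (e \<ominus> x \<otimes> r) \<oplus> x \<otimes> (r \<otimes> t) \<in> J" using m idl_add[OF J] idl_lmult[OF J _ xc] by blast
        moreover have "t \<otimes> (e \<ominus> x \<otimes> r) \<oplus> x \<otimes> (r \<otimes> t) = e \<otimes> t" using t r(1) xc e(1) by algebra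
        ultimately show "e \<otimes> t \<in> J" by simp
      qed
    qed
    have rJ: "r \<notin> J" using eq[OF one_closed] r(1) e(1,2) by (simp only: r_one simp_thms)
    have "colon_in J r (carrier R) = colon_in J e (carrier R)"
      unfolding colon_in_def by (rule Collect_cong, rule conj_cong, rule refl, rule eq[symmetric])
    hence "colon_in J r (carrier R) = ?p" using e(3) by (rule trans)
    hence "P (J \<boxplus> PIdl r)" unfolding P_def using r(1) rJ by blast
    moreover have "B \<subseteq> J \<boxplus> PIdl r" unfolding e(4)
    proof (rule adjoin_le[OF J adjoin_idl[OF J r(1)] adjoin_ub[OF J r(1)]])
      have "e \<ominus> r \<otimes> x \<in> J" using r m_comm[OF xc r(1)] by simp
      thus "e \<in> J \<boxplus> PIdl r" using mem_adjoin[OF J r(1)] xc e(1) by blast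
    qed
    ultimately have "J \<boxplus> PIdl r = J \<boxplus> PIdl e" using max[of "J \<boxplus> PIdl r"] e(4) by simp
    hence "r \<in> J \<boxplus> PIdl e" using adjoin_self[OF J r(1)] by simp
    then obtain s where s: "s \<in> carrier R" "r \<ominus> e \<otimes> s \<in> J" using mem_adjoin[OF J e(1)] by blast
    let ?n = "(r \<ominus> e \<otimes> s) \<oplus> s \<otimes> (e \<ominus> x \<otimes> r)"
    have n: "?n \<in> J" by (rule idl_add[OF J s(2) idl_lmult[OF J r(2) s(1)]])
    have "r = ?n \<oplus> (s \<otimes> x) \<otimes> r" using s(1) r(1) e(1) xc by algebra
    from absorb_cancel[OF J idl_lmult[OF \<mm>_idl x(1) s(1)] r(1) n this] show False using rJ by simp
  qed
  obtain f where f: "f \<in> carrier R" "f \<notin> J \<boxplus> PIdl x"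
    "colon_in (J \<boxplus> PIdl x) e (carrier R) \<subseteq> colon_in (J \<boxplus> PIdl x) f (carrier R)"
    "primeideal (colon_in (J \<boxplus> PIdl x) f (carrier R)) R"
    using ann_prime_exists[OF Jx e(1) enx] by blast
  obtain C where C: "prime_chain R n C" "C 0 = colon_in (J \<boxplus> PIdl x) f (carrier R)"
    using Suc(1)[OF Jx x(3) f(1,2,4)] by blast
  \<comment> \<open>The new prime contains the old one and x, since x e lies in J + (x). But x is
    not in the old prime, as x is regular and e is outside J.\<close>
  have 1: "?p \<subseteq> C 0" unfolding C(2) e(3)[symmetric] using f(3) adjoin_ub[OF J xc] by (auto simp: colon_in_def)
  have 2: "x \<in> C 0" unfolding C(2) using idl_rmult[OF Jx adjoin_self[OF J xc] e(1)] f(3) xc e(1)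
    by (auto simp: colon_in_def m_comm)
  have "e \<otimes> x \<notin> J" using regD[OF x(2) e(1)] e(2) m_comm[OF xc e(1)] by auto
  hence 3: "x \<notin> ?p" unfolding e(3)[symmetric] by (simp add: colon_in_def)
  have "prime_chain R (Suc n) (case_nat ?p C)" using 1 2 3 by (intro prime_chain_cons C(1) Suc(6)) blast
  thus ?case by (intro exI[of _ "case_nat ?p C"]) simp
qed

subsection \<open>Ideals of finite colength\<close>

lemma len_\<mm>: "len \<mm> (carrier R) \<le> 1"
proof (rule enat_leI)
  fix n assume "enat n \<le> len \<mm> (carrier R)"
  hence n: "ichain \<mm> (carrier R) n" by (simp add: enat_le_len)
  have "\<not> ichain \<mm> (carrier R) (Suc (Suc 0))"
  proof
    assume "ichain \<mm> (carrier R) (Suc (Suc 0))"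
    then obtain B B' where B: "idl B" "\<mm> \<subseteq> B" "B \<subset> carrier R" "idl B'" "\<mm> \<subseteq> B'" "B' \<subset> B" by auto
    have "B \<subseteq> \<mm>" using proper_le_\<mm>[OF B(1)] B(3) by blast
    thus False using B by blast
  qed
  hence "n \<le> 1" using ichain_le[OF n, of "Suc (Suc 0)"] by linarith
  thus "enat n \<le> 1" by (simp add: one_enat_def)
qed

text \<open>\<mm>-primary ideals together with R itself, so that products and all powers, including
  the zeroth, stay in the class.\<close>

definition cofin :: "'a set \<Rightarrow> bool" where
  "cofin J \<longleftrightarrow> idl J \<and> (\<exists>N. pw \<mm> N \<subseteq> J)"

lemma cofin_idl: "cofin J \<Longrightarrow> idl J"
  by (simp add: cofin_def)

lemma cofin_mono: "cofin A \<Longrightarrow> A \<subseteq> B \<Longrightarrow> idl B \<Longrightarrow> cofin B"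
  unfolding cofin_def using subset_trans by blast

lemma cofin_prod: 
  assumes "cofin A" "cofin B" shows "cofin (A \<cdot> B)"
proof -
  obtain M N where MN: "pw \<mm> M \<subseteq> A" "pw \<mm> N \<subseteq> B" using assms unfolding cofin_def by blast
  have "pw \<mm> (M + N) \<subseteq> A \<cdot> B" unfolding pw_add[OF \<mm>_idl] using MN by (rule prod_mono)
  thus ?thesis using assms ideal_prod_is_ideal unfolding cofin_def by blast
qed

lemma cofin_carrier: "cofin (carrier R)"
  unfolding cofin_def using oneideal pw_0 by blast

lemma cofin_\<mm>: "cofin \<mm>"
  unfolding cofin_def using \<mm>_idl pw_1 by blast

lemma cofin_pw: "cofin K \<Longrightarrow> cofin (pw K m)"
  by (induct m) (auto simp: cofin_carrier pw_Suc cofin_prod)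

text \<open>Each layer \<mm>^N/\<mm>^(N+1) is no longer than the number of generators of
  \<mm>^N.\<close>

lemma len_finite: 
  assumes "cofin J" "idl M" shows "len J M \<noteq> \<infinity>"
proof -
  have fin: "len (pw \<mm> N) (carrier R) \<noteq> \<infinity>" for N
  proof (induct N)
    case (Suc N)
    obtain S where S: "S \<subseteq> carrier R" "finite S" "pw \<mm> N = Idl S" using fin_gen[OF pw_idl[OF \<mm>_idl]] by blast
    have sub: "pw \<mm> (Suc N) \<subseteq> pw \<mm> N" by (rule pw_antimono[OF \<mm>_idl]) simp
    have "len (pw \<mm> (Suc N)) (pw \<mm> (Suc N) \<boxplus> (Idl S) \<cdot> carrier R) \<le> of_nat (card S) * len \<mm> (carrier R)"
      by (rule len_gens) (use S(1,2) \<mm>_idl oneideal pw_idl[OF \<mm>_idl] idl_subset[OF \<mm>_idl] ideal_prod_is_ideal in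
        \<open>simp_all add: pw_Suc S(3)[symmetric]\<close>)
    also have "\<dots> \<le> of_nat (card S) * 1" using len_\<mm> by (rule mult_left_mono) simp
    also have "pw \<mm> (Suc N) \<boxplus> (Idl S) \<cdot> carrier R = pw \<mm> N"
      using sub by (simp add: S(3)[symmetric] ideal_prod_one pw_idl \<mm>_idl sum_absorb2)
    finally have "len (pw \<mm> (Suc N)) (pw \<mm> N) \<noteq> \<infinity>"
      by (metis enat_ord_code(5) mult.right_neutral of_nat_eq_enat enat.distinct(2))
    moreover have "len (pw \<mm> (Suc N)) (carrier R) = len (pw \<mm> (Suc N)) (pw \<mm> N) + len (pw \<mm> N) (carrier R)"
      using sub by (intro len_add pw_idl \<mm>_idl oneideal idl_subset)
    ultimately show ?case using Suc by auto
  qed simp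
  obtain N where N: "pw \<mm> N \<subseteq> J" using assms cofin_def by blast
  have "len J M \<le> len (pw \<mm> N) (carrier R)" using N assms(2) by (intro len_mono idl_subset)
  thus ?thesis using fin[of N] by (metis enat_ord_simps(5))
qed

text \<open>Read only when \<open>cofin N\<close>, where the length is finite by
  \<open>len_finite\<close>.\<close>

definition nlen :: "'a set \<Rightarrow> 'a set \<Rightarrow> nat" where
  "nlen N M = the_enat (len N M)"

lemma enat_nlen: "cofin N \<Longrightarrow> idl M \<Longrightarrow> enat (nlen N M) = len N M"
  using len_finite[of N M] by (auto simp: nlen_def)

lemma nlen_add:
  assumes "cofin N" "idl M" "idl L" "N \<subseteq> M" "M \<subseteq> L"
  shows "nlen N L = nlen N M + nlen M L"
proof -
  have "cofin M" using cofin_mono assms by blast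
  hence "enat (nlen N L) = enat (nlen N M) + enat (nlen M L)"
    using len_add[OF cofin_idl[OF assms(1)] assms(2-5)] assms by (simp add: enat_nlen)
  thus ?thesis by simp
qed

lemma nlen_le: 
  assumes "cofin N" "idl M" "cofin N'" "idl M'" "len N M \<le> len N' M'" shows "nlen N M \<le> nlen N' M'"
  using assms enat_nlen[of N M] enat_nlen[of N' M'] by (metis enat_ord_simps(1))

subsection \<open>Superficial elements\<close>

lemma reg_pow:
  assumes "reg J x" "z \<in> carrier R" "x [^] (n::nat) \<otimes> z \<in> J" shows "z \<in> J"
  using assms(3)
proof (induct n)
  case (Suc n)
  have xc: "x \<in> carrier R" using assms(1) by (rule reg_carr)
  have "x \<otimes> (x [^] n \<otimes> z) \<in> J" using Suc(2) pow_Suc_mult[OF xc assms(2)] by simp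
  hence "x [^] n \<otimes> z \<in> J" by (rule regD[OF assms(1), rotated]) (use xc assms(2) in simp)
  thus ?case by (rule Suc(1))
qed (use assms(2) in simp)

text \<open>A generic \<open>a\<close> is a nonzerodivisor in high degrees of the associated graded
  module of R/J. This only cancels \<open>a\<close> from c already known to lie in a suitable power;
  Artin-Rees supplies such a power for arbitrary c, and graded cancellation then climbs from
  it.\<close>

lemma superficial_element:
  assumes inf: "infinite (carrier (R Quot \<mm>))"
    and K: "cofin K" "K \<subseteq> \<mm>" and J: "idl J" "J \<subseteq> K" and dep: "depth_ge (Suc n) J"
  obtains a m0 where "a \<in> K" "reg J a" "a \<notin> J \<boxplus> \<mm> \<cdot> K"
    "\<And>m c. m \<ge> m0 \<Longrightarrow> c \<in> carrier R \<Longrightarrow> a \<otimes> c \<in> J \<boxplus> pw K (Suc m) \<Longrightarrow> c \<in> J \<boxplus> pw K m"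
proof -
  note Ki = cofin_idl[OF K(1)]
  note pK = pw_idl[OF Ki]
  note Kc = idl_carr[OF Ki] and pc = idl_carr[OF pK] and Jc = idl_carr[OF J(1)]
  obtain x where x: "x \<in> \<mm>" "reg J x" using dep by auto
  have xc: "x \<in> carrier R" using x reg_carr by blast
  obtain N where "pw \<mm> N \<subseteq> K" using K unfolding cofin_def by blast
  hence xN: "x [^] N \<in> K" using pw_memI[OF \<mm>_idl x(1), of N] by blast
  have nK: "\<not> K \<subseteq> J"
  proof
    assume "K \<subseteq> J"
    hence "x [^] N \<otimes> \<one> \<in> J" using xN Kc by auto
    hence "\<one> \<in> J" by (rule reg_pow[OF x(2) one_closed])
    thus False using J K one_notin_\<mm> by blast
  qed
  \<comment> \<open>A proper subideal of K by Nakayama. Avoiding it makes the chosen elements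
    independent modulo \<mm>K.\<close>
  let ?B0 = "J \<boxplus> \<mm> \<cdot> K"
  have mK: "idl (\<mm> \<cdot> K)" using \<mm>_idl Ki by (rule ideal_prod_is_ideal)
  have B0: "idl ?B0" "?B0 \<subset> K"
  proof -
    show "idl ?B0" using J(1) mK by (rule add_ideals)
    have "?B0 \<subseteq> K" using J(2) prod_subset2[OF \<mm>_idl Ki] Ki by (rule sum_le)
    moreover have "\<not> K \<subseteq> ?B0" using nakayama[OF J(1) Ki] nK by blast
    ultimately show "?B0 \<subset> K" by blast
  qed
  have soc: "z \<in> J" if "z \<in> carrier R" "\<And>b. b \<in> K \<Longrightarrow> b \<otimes> z \<in> J" for z
    using reg_pow[OF x(2) that(1)] that(2)[OF xN] by blast
  obtain B1 where B1: "finite B1" "\<forall>A\<in>B1. idl A \<and> A \<subset> K" "\<forall>a\<in>K. a \<notin> \<Union>B1 \<longrightarrow> reg J a"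
    using generic_regular[OF Ki J(1) soc] by blast
  define F where "F m = J \<boxplus> pw K m" for m
  have Fi: "idl (F m)" for m unfolding F_def using J(1) pK by (rule add_ideals)
  have JF: "J \<subseteq> F m" for m unfolding F_def using J(1) pK by (rule sum_ub1)
  have KF: "pw K m \<subseteq> F m" for m unfolding F_def using J(1) pK by (rule sum_ub2)
  have Fmono: "F n \<subseteq> F m" if "m \<le> n" for m n unfolding F_def using pw_antimono[OF Ki that] by (intro sum_mono) auto
  have FS: "b \<otimes> z \<in> F (Suc m)" if b: "b \<in> K" and z: "z \<in> F m" for b z m
  proof -
    obtain j w where jw: "j \<in> J" "w \<in> pw K m" "z = j \<oplus> w" using z by (auto simp: F_def mem_sum)
    have "b \<otimes> z = b \<otimes> j \<oplus> b \<otimes> w" unfolding jw using r_distr Jc[OF jw(1)] pc[OF jw(2)] Kc[OF b] by simp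
    thus ?thesis unfolding F_def using sumI idl_lmult[OF J(1) jw(1) Kc[OF b]] gseq_step[OF gseq_pw[OF Ki] b jw(2)] by simp
  qed
  \<comment> \<open>The kernel of the map from K^m onto the degree m part of the associated graded
    module of R/J.\<close>
  have g1: "gseq K (\<lambda>m. pw K m \<inter> F (Suc m))"
  proof (rule gseqI)
    show "idl (pw K m \<inter> F (Suc m))" for m using pK Fi by (rule idl_Int)
    show "b \<otimes> z \<in> pw K (Suc m) \<inter> F (Suc (Suc m))" if "b \<in> K" "z \<in> pw K m \<inter> F (Suc m)" for b z m
      using that FS gseq_step[OF gseq_pw[OF Ki]] by blast
  qed
  obtain m1 B2 where B2: "finite B2" "\<forall>A\<in>B2. idl A \<and> A \<subset> K" 
    and gen: "\<forall>a\<in>K. a \<notin> \<Union>B2 \<longrightarrow> (\<forall>m\<ge>m1. \<forall>c\<in>pw K m. a \<otimes> c \<in> pw K (Suc m) \<inter> F (Suc (Suc m)) \<longrightarrow> c \<in> pw K m \<inter> F (Suc m))"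
    using generic_element[OF Ki g1 Int_lower1] by (elim exE conjE) 
  have "\<exists>a\<in>K. a \<notin> \<Union>(insert ?B0 (B1 \<union> B2))"
  proof (rule ideal_avoidance[OF inf Ki])
    show "finite (insert ?B0 (B1 \<union> B2))" using B1(1) B2(1) by simp
    show "idl A \<and> A \<subset> K" if "A \<in> insert ?B0 (B1 \<union> B2)" for A using that
      by (elim insertE UnE) (simp add: B0, erule B1(2)[rule_format], erule B2(2)[rule_format])
  qed
  then obtain a where a0: "a \<in> K" "a \<notin> ?B0" "a \<notin> \<Union>B1" "a \<notin> \<Union>B2" by auto
  have a: "reg J a" using B1(3) a0 by simp
  have ac: "a \<in> carrier R" using a reg_carr by blast
  \<comment> \<open>Cancellation of the initial form of a: membership of c improves by one
    power.\<close>
  have step1: "c \<in> F (Suc m)" if m: "m \<ge> m1" and c: "c \<in> F m" and acF: "a \<otimes> c \<in> F (Suc (Suc m))" for m c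
  proof -
    obtain j w where jw: "j \<in> J" "w \<in> pw K m" "c = j \<oplus> w" using c by (auto simp: F_def mem_sum)
    have "a \<otimes> w = a \<otimes> c \<ominus> a \<otimes> j" unfolding jw using ac Jc[OF jw(1)] pc[OF jw(2)] by algebra
    moreover have "a \<otimes> j \<in> F (Suc (Suc m))" using JF idl_lmult[OF J(1) jw(1) ac] by blast
    ultimately have "a \<otimes> w \<in> F (Suc (Suc m))" using idl_minus[OF Fi acF] by simp
    moreover have "a \<otimes> w \<in> pw K (Suc m)" by (rule gseq_step[OF gseq_pw[OF Ki] a0(1) jw(2)])
    ultimately have "w \<in> F (Suc m)" using gen a0 m jw(2) by blast
    thus ?thesis unfolding jw(3) using JF[of "Suc m"] jw(1) idl_add[OF Fi] by blast
  qed
  let ?X = "J \<boxplus> PIdl a"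
  note Xi = adjoin_idl[OF J(1) ac]
  have g2: "gseq K (\<lambda>m. pw K m \<inter> ?X)"
  proof (rule gseqI)
    show "idl (pw K m \<inter> ?X)" for m using pK Xi by (rule idl_Int)
    show "b \<otimes> z \<in> pw K (Suc m) \<inter> ?X" if "b \<in> K" "z \<in> pw K m \<inter> ?X" for b z m
      using that gseq_step[OF gseq_pw[OF Ki]] idl_lmult[OF Xi _ Kc] by blast
  qed
  obtain g where g: "\<And>m. m \<ge> g \<Longrightarrow> pw K (Suc m) \<inter> ?X = K \<cdot> (pw K m \<inter> ?X)"
    using hilbert_basis[OF Ki g2 Int_lower1] by blast
  \<comment> \<open>Artin-Rees: the traces of J + (a) on the powers of K are generated in bounded
    degree.\<close>
  have AR: "pw K (g + k) \<inter> ?X \<subseteq> pw K k \<cdot> ?X" for k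
  proof (induct k)
    case 0 show ?case using prod_carr_l[OF Xi] by simp
  next
    case (Suc k)
    have "pw K (g + Suc k) \<inter> ?X = K \<cdot> (pw K (g + k) \<inter> ?X)" using g[of "g + k"] by simp
    also have "\<dots> \<subseteq> K \<cdot> (pw K k \<cdot> ?X)" using Suc by (intro prod_mono) auto
    also have "\<dots> = pw K (Suc k) \<cdot> ?X" using ideal_prod_assoc[OF Ki pK Xi] pw_Suc2[OF Ki] by simp
    finally show ?case .
  qed
  \<comment> \<open>Modulo J, a c becomes a multiple a b with b in K^k, and the regular a cancels.
    Only the fixed shift g is lost.\<close>
  have step2: "c \<in> F k" if c: "c \<in> carrier R" and acF: "a \<otimes> c \<in> F (g + k)" for c k
  proof -
    obtain j i where ji: "j \<in> J" "i \<in> pw K (g + k)" "a \<otimes> c = j \<oplus> i" using acF by (auto simp: F_def mem_sum)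
    have "i \<ominus> a \<otimes> c = \<ominus> j" unfolding ji(3) using Jc[OF ji(1)] pc[OF ji(2)] by algebra
    hence "i \<ominus> a \<otimes> c \<in> J" using idl_neg[OF J(1) ji(1)] by simp
    hence "i \<in> ?X" using mem_adjoin[OF J(1) ac] pc[OF ji(2)] c by blast
    hence "i \<in> pw K k \<cdot> ?X" using AR ji(2) by blast
    also have "pw K k \<cdot> ?X = pw K k \<cdot> J \<boxplus> pw K k \<cdot> (PIdl a)" using prod_sum_r[OF pK J(1) pid_idl[OF ac]] .
    also have "pw K k \<cdot> (PIdl a) = mulset a (pw K k)"
      using ideal_prod_commute[OF pK pid_idl[OF ac]] pid_prod[OF ac pK] by simp
    finally obtain j' b where jb: "j' \<in> pw K k \<cdot> J" "b \<in> pw K k" "i = j' \<oplus> a \<otimes> b"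
      by (auto simp: mem_sum mulset_def)
    have j': "j' \<in> J" using jb(1) prod_subset2[OF pK J(1)] by blast
    have "a \<otimes> (c \<ominus> b) = a \<otimes> c \<ominus> a \<otimes> b" using ac c pc[OF jb(2)] by algebra
    also have "\<dots> = j \<oplus> j'" unfolding ji(3) jb(3) using Jc[OF ji(1)] Jc[OF j'] ac pc[OF jb(2)] by algebra
    finally have "a \<otimes> (c \<ominus> b) \<in> J" using idl_add[OF J(1) ji(1) j'] by simp
    hence cb: "c \<ominus> b \<in> J" by (rule regD[OF a, rotated]) (use c pc[OF jb(2)] in simp)
    have "c = (c \<ominus> b) \<oplus> b" using c pc[OF jb(2)] by algebra
    thus ?thesis unfolding F_def using sumI[OF cb jb(2)] by simp
  qed
  have fin: "c \<in> F m" if m: "m \<ge> g + m1" and c: "c \<in> carrier R" and acF: "a \<otimes> c \<in> F (Suc m)" for m c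
  proof -
    \<comment> \<open>The power that Artin-Rees guarantees; at most g - 1 steps of
      \<open>step1\<close> are left from here to m.\<close>
    define k where "k = Suc m - g"
    have k: "Suc m = g + k" "m1 \<le> k" using m by (auto simp: k_def)
    have ck: "c \<in> F k" by (rule step2[OF c]) (use acF k in simp)
    show ?thesis
    proof (cases "k \<le> m")
      case True
      have "c \<in> F j" if "k \<le> j" "j \<le> m" for j
        using that
      proof (induct j rule: dec_induct)
        case base show ?case by (rule ck)
      next
        case (step j)
        have "a \<otimes> c \<in> F (Suc (Suc j))" using acF Fmono[of "Suc (Suc j)" "Suc m"] step by auto
        thus ?case using step1[of j c] step k by simp
      qed
      thus ?thesis using True by simp
    next
      case False
      thus ?thesis using ck Fmono[of m k] by auto
    qed
  qed
  show thesis by (rule that[OF a0(1) a a0(2)]) (use fin in \<open>auto simp: F_def\<close>)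
qed

subsection \<open>The Hilbert polynomial\<close>

lemma len_adjoin:
  assumes "idl N" "a \<in> carrier R"
  shows "len N (carrier R) = len (colon_in N a (carrier R)) (carrier R) + len (N \<boxplus> PIdl a) (carrier R)"
proof -
  have "len N (carrier R) = len N (N \<boxplus> PIdl a) + len (N \<boxplus> PIdl a) (carrier R)"
    using assms by (intro len_add adjoin_idl adjoin_ub oneideal idl_subset)
  thus ?thesis using len_mult[OF assms(1) oneideal assms(2)] by (simp add: mulset_carrier assms)
qed

text \<open>Superficiality identifies (J + K^(m+1)) : a with J + K^m. Hence the first difference of
  the Hilbert function of R/J is the Hilbert function of R/(J + (a)).\<close>

lemma hilbert_step:
  assumes K: "cofin K" and J: "idl J" and a: "a \<in> K" "a \<in> carrier R"
    and sup: "\<And>c. c \<in> carrier R \<Longrightarrow> a \<otimes> c \<in> J \<boxplus> pw K (Suc m) \<Longrightarrow> c \<in> J \<boxplus> pw K m"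
  shows "nlen (J \<boxplus> pw K (Suc m)) (carrier R) = nlen (J \<boxplus> pw K m) (carrier R)
    + nlen ((J \<boxplus> PIdl a) \<boxplus> pw K (Suc m)) (carrier R)"
proof -
  note Ki = cofin_idl[OF K]
  note pK = pw_idl[OF Ki]
  have F: "idl (J \<boxplus> pw K m)" for m using J pK by (rule add_ideals)
  have "colon_in (J \<boxplus> pw K (Suc m)) a (carrier R) = J \<boxplus> pw K m"
  proof (rule subset_antisym)
    show "colon_in (J \<boxplus> pw K (Suc m)) a (carrier R) \<subseteq> J \<boxplus> pw K m" using sup by (auto simp: colon_in_def)
    show "J \<boxplus> pw K m \<subseteq> colon_in (J \<boxplus> pw K (Suc m)) a (carrier R)"
    proof (rule sum_le)
      show "idl (colon_in (J \<boxplus> pw K (Suc m)) a (carrier R))" using F a(2) oneideal by (rule colon_in_idl)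
      show "J \<subseteq> colon_in (J \<boxplus> pw K (Suc m)) a (carrier R)"
        using idl_lmult[OF J _ a(2)] sum_ub1[OF J pK] idl_carr[OF J] by (auto simp: colon_in_def)
      show "pw K m \<subseteq> colon_in (J \<boxplus> pw K (Suc m)) a (carrier R)"
        using gseq_step[OF gseq_pw[OF Ki] a(1)] sum_ub2[OF J pK] idl_carr[OF pK] by (auto simp: colon_in_def)
    qed
  qed
  moreover have "(J \<boxplus> pw K (Suc m)) \<boxplus> PIdl a = (J \<boxplus> PIdl a) \<boxplus> pw K (Suc m)"
    using J pK pid_idl[OF a(2)] by (simp add: sum_assoc sum_comm[of "PIdl a"])
  ultimately have "len (J \<boxplus> pw K (Suc m)) (carrier R) = len (J \<boxplus> pw K m) (carrier R)
    + len ((J \<boxplus> PIdl a) \<boxplus> pw K (Suc m)) (carrier R)"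
    using len_adjoin[OF F a(2), of "Suc m"] by simp
  moreover have cof: "cofin (A \<boxplus> pw K m)" if "idl A" for A m
    by (rule cofin_mono[OF cofin_pw[OF K] sum_ub2[OF that pK] add_ideals[OF that pK]])
  ultimately have "enat (nlen (J \<boxplus> pw K (Suc m)) (carrier R)) = enat (nlen (J \<boxplus> pw K m) (carrier R))
    + enat (nlen ((J \<boxplus> PIdl a) \<boxplus> pw K (Suc m)) (carrier R))"
    using cof J adjoin_idl[OF J a(2)] oneideal by (simp add: enat_nlen)
  thus ?thesis by simp
qed

text \<open>Superficial elements are adjoined until J' is generated by a system of parameters, where
  the Hilbert function is eventually \<lambda>(R/J'). Summing back up never changes the leading
  coefficient, so e_0 = \<lambda>(R/J'). The last conjunct records that the n new elements are
  independent modulo J + \<mm>K.\<close>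

lemma hilbert_sequence:
  assumes inf: "infinite (carrier (R Quot \<mm>))" and dim: "krull_dim R = ereal (real d)"
    and K: "cofin K" "K \<subseteq> \<mm>"
  shows "regular_ext i J \<Longrightarrow> J \<subseteq> K \<Longrightarrow> depth_ge n J \<Longrightarrow> i + n = d \<Longrightarrow>
    \<exists>J' e m0. regular_ext d J' \<and> J \<subseteq> J' \<and> J' \<subseteq> K \<and> e 0 = int (nlen J' (carrier R)) \<and>
      (\<forall>m\<ge>m0. int (nlen (J \<boxplus> pw K m) (carrier R)) = hilb_poly n e m) \<and>
      enat n \<le> len (J \<boxplus> \<mm> \<cdot> K) (J' \<boxplus> \<mm> \<cdot> K)"
proof (induct n arbitrary: i J)
  case 0
  hence J: "regular_ext d J" by simp
  note Ji = regular_ext_idl[OF J]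
  note pK = pw_idl[OF cofin_idl[OF K(1)]]
  obtain N where N: "pw \<mm> N \<subseteq> J" using regular_ext_\<mm>_power[OF J dim] by blast
  have "J \<boxplus> pw K m = J" if "m \<ge> N" for m
  proof (rule sum_absorb1[OF Ji pK])
    have "pw K m \<subseteq> pw \<mm> m" by (rule pw_mono[OF K(2)])
    also have "\<dots> \<subseteq> pw \<mm> N" by (rule pw_antimono[OF \<mm>_idl that])
    finally show "pw K m \<subseteq> J" using N by blast
  qed
  thus ?case using J 0(2)
    by (intro exI[of _ J] exI[of _ "\<lambda>_. int (nlen J (carrier R))"] exI[of _ N])
       (simp add: hilb_poly_def zero_enat_def[symmetric])
next
  case (Suc n)
  note Ji = regular_ext_idl[OF Suc(2)]
  obtain a m0 where a: "a \<in> K" "reg J a" "a \<notin> J \<boxplus> \<mm> \<cdot> K"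
    and sup: "\<And>m c. m \<ge> m0 \<Longrightarrow> c \<in> carrier R \<Longrightarrow> a \<otimes> c \<in> J \<boxplus> pw K (Suc m) \<Longrightarrow> c \<in> J \<boxplus> pw K m"
    using superficial_element[OF inf K Ji Suc(3,4)] by blast
  have ac: "a \<in> carrier R" using a reg_carr by blast
  have am: "a \<in> \<mm>" using a K by blast
  let ?J = "J \<boxplus> PIdl a"
  have J1: "regular_ext (Suc i) ?J" by (rule regular_ext.adjoin[OF Suc(2) am a(2)])
  have JK: "?J \<subseteq> K" by (rule adjoin_le[OF Ji cofin_idl[OF K(1)] Suc(3) a(1)])
  have dJ: "depth_ge n ?J" by (rule depth_exchange[OF inf Ji Suc(4) am a(2)])
  have "Suc i + n = d" using Suc(5) by simp
  from Suc(1)[OF J1 JK dJ this] obtain J' e m1 where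
    h: "regular_ext d J'" "?J \<subseteq> J'" "J' \<subseteq> K" "e 0 = int (nlen J' (carrier R))"
      "\<forall>m\<ge>m1. int (nlen (?J \<boxplus> pw K m) (carrier R)) = hilb_poly n e m"
      "enat n \<le> len (?J \<boxplus> \<mm> \<cdot> K) (J' \<boxplus> \<mm> \<cdot> K)" by (elim exE conjE)
  have "int (nlen (J \<boxplus> pw K (Suc m)) (carrier R)) - int (nlen (J \<boxplus> pw K m) (carrier R)) = hilb_poly n e (Suc m)"
    if m: "m \<ge> m0 + m1" for m
    using hilbert_step[OF K(1) Ji a(1) ac sup, of m] m h(5) by simp
  from hilb_poly_sum[OF this] obtain e' where e': "\<forall>i\<le>n. e' i = e i"
    "\<forall>m\<ge>m0+m1. int (nlen (J \<boxplus> pw K m) (carrier R)) = hilb_poly (Suc n) e' m" by blast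
  note mKi = ideal_prod_is_ideal[OF \<mm>_idl cofin_idl[OF K(1)]]
  note J'i = regular_ext_idl[OF h(1)]
  have JJ': "J \<subseteq> J'" using adjoin_ub[OF Ji ac] h(2) by blast
  have i1: "idl (J \<boxplus> \<mm> \<cdot> K)" "idl (?J \<boxplus> \<mm> \<cdot> K)" "idl (J' \<boxplus> \<mm> \<cdot> K)"
    using Ji adjoin_idl[OF Ji ac] J'i mKi by (simp_all add: add_ideals)
  have i2: "J \<boxplus> \<mm> \<cdot> K \<subseteq> ?J \<boxplus> \<mm> \<cdot> K" "?J \<boxplus> \<mm> \<cdot> K \<subseteq> J' \<boxplus> \<mm> \<cdot> K"
    using adjoin_ub[OF Ji ac] h(2) by (intro sum_mono; simp)+
  have "a \<in> ?J \<boxplus> \<mm> \<cdot> K" using adjoin_self[OF Ji ac] sum_ub1[OF adjoin_idl[OF Ji ac] mKi] by blast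
  hence "J \<boxplus> \<mm> \<cdot> K \<subset> ?J \<boxplus> \<mm> \<cdot> K" using a(3) i2(1) by blast
  hence "ichain (J \<boxplus> \<mm> \<cdot> K) (?J \<boxplus> \<mm> \<cdot> K) (Suc 0)" using i1 by auto
  hence "enat (Suc 0) \<le> len (J \<boxplus> \<mm> \<cdot> K) (?J \<boxplus> \<mm> \<cdot> K)" by (simp add: enat_le_len)
  hence "enat (Suc 0) + enat n \<le> len (J \<boxplus> \<mm> \<cdot> K) (J' \<boxplus> \<mm> \<cdot> K)"
    unfolding len_add[OF i1 i2] using h(6) by (rule add_mono)
  hence len: "enat (Suc n) \<le> len (J \<boxplus> \<mm> \<cdot> K) (J' \<boxplus> \<mm> \<cdot> K)" by simp
  have "e' 0 = int (nlen J' (carrier R))" using e'(1) h(4) by simp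
  thus ?case using h(1,3) JJ' e'(2) len by blast
qed

text \<open>The number of monomials of degree \<open>m\<close> in \<open>d\<close> variables is \<open>(m + d - 1) choose m\<close>.\<close>

lemma len_power_gens:
  assumes "regular_ext d J" "idl X" "idl Y" "Y \<subseteq> X"
  shows "idl Z \<Longrightarrow> pw J m \<cdot> Y \<subseteq> Z \<Longrightarrow>
    len Z (Z \<boxplus> pw J m \<cdot> X) \<le> of_nat ((m + d - 1) choose m) * len Y X"
  using assms(1)
proof (induct arbitrary: m Z rule: regular_ext.induct)
  case zero
  have z: "idl {\<zero>}" by (rule zeroideal)
  show ?case
  proof (cases m)
    case 0
    have "len Z (Z \<boxplus> mulset \<one> X) \<le> len Y X"
      using zero 0 assms by (intro len_mult_le) (auto simp: mulset_one prod_carr_l)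
    thus ?thesis using 0 assms by (simp add: mulset_one prod_carr_l)
  next
    case (Suc k)
    have "pw {\<zero>} m \<cdot> X \<subseteq> {\<zero>}"
      using pw_le[OF z, of m] prod_subset1[OF pw_idl[OF z] assms(2), of m] Suc by auto
    hence "Z \<boxplus> pw {\<zero>} m \<cdot> X = Z"
      using zero idl_zero by (intro sum_absorb1 ideal_prod_is_ideal pw_idl z assms) auto
    thus ?thesis by simp
  qed
next
  case (adjoin d J a)
  let ?J = "J \<boxplus> PIdl a"
  note Ji = regular_ext_idl[OF adjoin(1)]
  have ac: "a \<in> carrier R" using adjoin reg_carr by blast
  note J1 = adjoin_idl[OF Ji ac]
  have JJ1: "J \<subseteq> ?J" and aJ1: "a \<in> ?J" using adjoin_ub[OF Ji ac] adjoin_self[OF Ji ac] by auto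
  note p1 = pw_idl[OF J1] and p0 = pw_idl[OF Ji]
  \<comment> \<open>Monomials of degree m + 1 either omit a or are divisible by it.\<close>
  have dec: "pw ?J (Suc m) = pw J (Suc m) \<boxplus> mulset a (pw ?J m)" for m
  proof (rule subset_antisym)
    have ms: "idl (mulset a (pw ?J m))" for m using ac p1 by (rule mulset_idl)
    show "pw J (Suc m) \<boxplus> mulset a (pw ?J m) \<subseteq> pw ?J (Suc m)"
    proof (rule sum_le[OF pw_mono[OF JJ1] _ p1])
      show "mulset a (pw ?J m) \<subseteq> pw ?J (Suc m)"
        using gseq_step[OF gseq_pw[OF J1] aJ1] by (auto simp: mulset_def)
    qed
    show "pw ?J (Suc m) \<subseteq> pw J (Suc m) \<boxplus> mulset a (pw ?J m)"
    proof (induct m)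
      case 0 show ?case by (simp add: pw_1 Ji J1 mulset_carrier ac)
    next
      case (Suc m)
      have tgt: "idl (pw J (Suc (Suc m)) \<boxplus> mulset a (pw ?J (Suc m)))" using p0 ms by (rule add_ideals)
      have e1: "pw ?J (Suc (Suc m)) = pw ?J (Suc m) \<cdot> J \<boxplus> pw ?J (Suc m) \<cdot> (PIdl a)"
        using pw_Suc[of ?J "Suc m"] prod_sum_r[OF p1 Ji pid_idl[OF ac]] by simp
      have e2: "pw ?J (Suc m) \<cdot> (PIdl a) = mulset a (pw ?J (Suc m))"
        using ideal_prod_commute[OF p1 pid_idl[OF ac]] pid_prod[OF ac p1] by simp
      have "pw ?J (Suc m) \<cdot> J \<subseteq> (pw J (Suc m) \<boxplus> mulset a (pw ?J m)) \<cdot> J" using Suc by (intro prod_mono) auto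
      also have "\<dots> = pw J (Suc m) \<cdot> J \<boxplus> mulset a (pw ?J m \<cdot> J)"
        using prod_sum_l[OF p0 ms Ji] mulset_prod[OF p1 Ji ac] by simp
      also have "\<dots> \<subseteq> pw J (Suc (Suc m)) \<boxplus> mulset a (pw ?J (Suc m))"
      proof (rule sum_mono)
        show "pw J (Suc m) \<cdot> J \<subseteq> pw J (Suc (Suc m))" by (simp only: pw_Suc order_refl)
        have "pw ?J m \<cdot> J \<subseteq> pw ?J (Suc m)" unfolding pw_Suc by (rule prod_mono[OF order_refl JJ1])
        thus "mulset a (pw ?J m \<cdot> J) \<subseteq> mulset a (pw ?J (Suc m))" by (rule mulset_mono)
      qed
      finally show ?case unfolding e1 e2 using sum_ub2[OF p0 ms] tgt by (intro sum_le)
    qed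
  qed
  show ?case using adjoin(5,6)
  proof (induct m arbitrary: Z)
    case 0
    have "len Z (Z \<boxplus> mulset \<one> X) \<le> len Y X"
      using 0 assms by (intro len_mult_le) (auto simp: mulset_one prod_carr_l)
    thus ?case using assms by (simp add: mulset_one prod_carr_l)
  next
    case (Suc m Z)
    let ?W = "pw ?J m \<cdot> X"
    let ?Z = "Z \<boxplus> pw J (Suc m) \<cdot> X"
    have i: "idl ?W" "idl (pw J (Suc m) \<cdot> X)" using p1 p0 assms by (simp_all add: ideal_prod_is_ideal)
    have Z': "idl ?Z" using Suc(2) i(2) by (rule add_ideals)
    have aW: "idl (mulset a ?W)" using ac i(1) by (rule mulset_idl)
    have "pw ?J (Suc m) \<cdot> X = pw J (Suc m) \<cdot> X \<boxplus> mulset a ?W"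
      unfolding dec using prod_sum_l[OF p0 mulset_idl[OF ac p1] assms(2)] mulset_prod[OF p1 assms(2) ac] by simp
    hence eq: "Z \<boxplus> pw ?J (Suc m) \<cdot> X = ?Z \<boxplus> mulset a ?W" using sum_assoc[OF Suc(2) i(2) aW] by simp
    have sub1: "pw J (Suc m) \<cdot> Y \<subseteq> Z"
      using Suc(3) prod_mono[OF pw_mono[OF JJ1] order_refl, of "Suc m" Y] by blast
    have sub2: "mulset a (pw ?J m \<cdot> Y) \<subseteq> Z"
    proof -
      have "mulset a (pw ?J m \<cdot> Y) = mulset a (pw ?J m) \<cdot> Y" by (rule mulset_prod[OF p1 assms(3) ac])
      also have "\<dots> \<subseteq> pw ?J (Suc m) \<cdot> Y"
        using dec[of m] sum_ub2[OF p0 mulset_idl[OF ac p1]] by (intro prod_mono) auto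
      finally show ?thesis using Suc(3) by blast
    qed
    have L1: "len Z ?Z \<le> of_nat ((Suc m + d - 1) choose (Suc m)) * len Y X"
      by (rule adjoin(2)[OF Suc(2) sub1])
    \<comment> \<open>The contribution of aW over \<open>?Z\<close> is that of W over this colon
      ideal, so the induction on m applies with \<open>?C\<close> in place of Z.\<close>
    let ?C = "colon_in ?Z a (carrier R)"
    have C: "idl ?C" by (rule colon_in_idl[OF Z' ac oneideal])
    have "pw ?J m \<cdot> Y \<subseteq> ?C"
      using sub2 sum_ub1[OF Suc(2) i(2)] idl_carr[OF ideal_prod_is_ideal[OF p1 assms(3)]]
      by (auto simp: colon_in_def mulset_def)
    hence L2: "len ?C (?C \<boxplus> ?W) \<le> of_nat ((m + Suc d - 1) choose m) * len Y X" by (rule Suc(1)[OF C])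
    have "?C \<inter> ?W = colon_in ?Z a ?W" using idl_subset[OF i(1)] by (auto simp: colon_in_def)
    hence L3: "len ?Z (?Z \<boxplus> mulset a ?W) = len ?C (?C \<boxplus> ?W)"
      using len_mult[OF Z' i(1) ac] len_sum[OF C i(1)] by simp
    have "len Z (?Z \<boxplus> mulset a ?W) = len Z ?Z + len ?Z (?Z \<boxplus> mulset a ?W)"
      using Suc(2) Z' add_ideals[OF Z' aW] sum_ub1[OF Suc(2) i(2)] sum_ub1[OF Z' aW] by (rule len_add)
    also have "\<dots> \<le> of_nat ((Suc m + d - 1) choose (Suc m)) * len Y X + of_nat ((m + Suc d - 1) choose m) * len Y X"
      unfolding L3 using L1 L2 by (rule add_mono)
    \<comment> \<open>Pascal's rule: monomials without a plus monomials divisible by a.\<close>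
    also have "\<dots> = of_nat ((Suc m + Suc d - 1) choose Suc m) * len Y X"
      by (simp add: distrib_right[symmetric] add.commute)
    finally show ?case unfolding eq .
  qed
qed

end

lemma (in cring) ichain_iff:
  assumes "idl M" "N \<subseteq> M"
  shows "ichain N M n \<longleftrightarrow> (\<exists>C. (\<forall>i\<le>n. idl (C i) \<and> N \<subseteq> C i \<and> C i \<subseteq> M) \<and> (\<forall>i<n. C i \<subset> C (Suc i)))"
proof
  assume "ichain N M n"
  thus "\<exists>C. (\<forall>i\<le>n. idl (C i) \<and> N \<subseteq> C i \<and> C i \<subseteq> M) \<and> (\<forall>i<n. C i \<subset> C (Suc i))"
    using assms
  proof (induct n arbitrary: M)
    case 0 thus ?case by (intro exI[of _ "\<lambda>_. M"]) simp
  next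
    case (Suc n)
    then obtain B where B: "idl B" "N \<subseteq> B" "B \<subset> M" "ichain N B n" by auto
    from Suc(1)[OF B(4,1,2)] obtain C where C: "\<And>i. i \<le> n \<Longrightarrow> idl (C i) \<and> N \<subseteq> C i \<and> C i \<subseteq> B"
      "\<And>i. i < n \<Longrightarrow> C i \<subset> C (Suc i)" by blast
    define C' where "C' = C(Suc n := M)"
    have "idl (C' i) \<and> N \<subseteq> C' i \<and> C' i \<subseteq> M" if "i \<le> Suc n" for i
      using that C(1)[of i] B Suc(3,4) by (cases "i = Suc n") (auto simp: C'_def)
    moreover have "C' i \<subset> C' (Suc i)" if "i < Suc n" for i
      using that C(1)[of i] C(2)[of i] B(3) by (cases "i = n") (auto simp: C'_def)
    ultimately show ?case by blast
  qed
next
  assume "\<exists>C. (\<forall>i\<le>n. idl (C i) \<and> N \<subseteq> C i \<and> C i \<subseteq> M) \<and> (\<forall>i<n. C i \<subset> C (Suc i))"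
  then obtain C where C: "\<And>i. i \<le> n \<Longrightarrow> idl (C i) \<and> N \<subseteq> C i \<and> C i \<subseteq> M"
    "\<And>i. i < n \<Longrightarrow> C i \<subset> C (Suc i)" by blast
  have "ichain N (C k) k" if "k \<le> n" for k
    using that
  proof (induct k)
    case (Suc k)
    thus ?case using C(1)[of k] C(2)[of k] by auto
  qed simp
  thus "ichain N M n" using ichain_mono C(1)[of n] by blast
qed

context cring
begin

subsection \<open>Length of the quotient module\<close>

lemma self_module_simps:
  "a_rcosets\<^bsub>self_module R\<^esub> K = a_rcosets K" "set_add (self_module R) = set_add R"
  "(+>\<^bsub>self_module R\<^esub>) = (+>)" "smult (self_module R) = (\<otimes>)"
  by (auto simp: A_RCOSETS_def RCOSETS_def set_add_def a_r_coset_def self_module_def fun_eq_iff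
      r_coset_def set_mult_def)

lemma quot_smult:
  assumes "idl K" "a \<in> carrier R" "x \<in> carrier R"
  shows "a \<odot>\<^bsub>quot_module (self_module R) K\<^esub> (K +> x) = K +> (a \<otimes> x)"
proof -
  interpret K: ideal K R by fact
  have "K +> (a \<otimes> y) = K +> (a \<otimes> x)" if "y \<in> K +> x" for y
  proof -
    obtain k where k: "k \<in> K" "y = k \<oplus> x" using \<open>y \<in> K +> x\<close> by (auto simp: a_r_coset_def')
    have kc: "k \<in> carrier R" using k idl_carr[OF assms(1)] by blast
    have "a \<otimes> y \<ominus> a \<otimes> x = a \<otimes> k" unfolding k(2) using kc assms by algebra
    hence "a \<otimes> y \<ominus> a \<otimes> x \<in> K" using idl_lmult[OF assms(1) k(1) assms(2)] by simp
    thus ?thesis using quotient_eq_iff_same_a_r_cos[OF assms(1)] k kc assms by simp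
  qed
  hence "(\<Union>y\<in>K +> x. K +> (a \<otimes> y)) = (\<Union>y\<in>K +> x. K +> (a \<otimes> x))" by (intro SUP_cong refl)
  also have "\<dots> = K +> (a \<otimes> x)" using K.a_rcos_self[OF assms(3)] by blast
  finally show ?thesis by (simp add: quot_module_def self_module_simps)
qed

lemma quot_module_add_monoid:
  "subgroup N (add_monoid (quot_module (self_module R) K)) \<longleftrightarrow> subgroup N (add_monoid (R Quot K))"
  by (simp add: subgroup_def m_inv_def quot_module_def self_module_simps FactRing_def)

text \<open>Preimage and image under R -> R/K match submodules of the quotient with ideals between K
  and R.\<close>

lemma module_length_quot:
  assumes K: "idl K"
  shows "module_length R (quot_module (self_module R) K) = len K (carrier R)"
proof (rule antisym)
  let ?M = "quot_module (self_module R) K"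
  interpret K: ideal K R by fact
  note Kc = idl_subset[OF K]
  show "module_length R ?M \<le> len K (carrier R)"
    unfolding module_length_def
  proof (rule Sup_least)
    fix z assume "z \<in> {enat n | n. \<exists>N. (\<forall>i\<le>n. submodule (N i) R ?M) \<and> (\<forall>i<n. N i \<subset> N (Suc i))}"
    then obtain n N where z: "z = enat n" and N: "\<And>i. i \<le> n \<Longrightarrow> submodule (N i) R ?M"
      "\<And>i. i < n \<Longrightarrow> N i \<subset> N (Suc i)" by blast
    define C where "C i = {r \<in> carrier R. K +> r \<in> N i}" for i
    have sub: "subgroup (N i) (add_monoid (R Quot K))" if "i \<le> n" for i
      using submodule.axioms(1)[OF N(1)[OF that]] by (simp add: quot_module_add_monoid)
    have zero: "K \<in> N i" if "i \<le> n" for i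
      using subgroup.one_closed[OF sub[OF that]] by (simp add: FactRing_def)
    have "idl (C i) \<and> K \<subseteq> C i \<and> C i \<subseteq> carrier R" if i: "i \<le> n" for i
    proof (intro conjI)
      show "C i \<subseteq> carrier R" by (auto simp: C_def)
      show "K \<subseteq> C i"
      proof
        fix k assume k: "k \<in> K"
        hence "K +> k = K" using K.a_rcos_const by blast
        thus "k \<in> C i" using zero[OF i] k Kc by (auto simp: C_def)
      qed
      show "idl (C i)"
      proof (rule idlI)
        show "C i \<subseteq> carrier R" by (auto simp: C_def)
        show "\<zero> \<in> C i" using \<open>K \<subseteq> C i\<close> idl_zero[OF K] by blast
        show "a \<oplus> b \<in> C i" if "a \<in> C i" "b \<in> C i" for a b
        proof -
          have "(K +> a) <+> (K +> b) \<in> N i"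
            using subgroup.m_closed[OF sub[OF i], of "K +> a" "K +> b"] that by (simp add: C_def FactRing_def)
          thus ?thesis using that K.a_rcos_sum by (simp add: C_def)
        qed
        show "x \<otimes> a \<in> C i" if "a \<in> C i" "x \<in> carrier R" for a x
          using submodule.smult_closed[OF N(1)[OF i], of x "K +> a"] that quot_smult[OF K] by (simp add: C_def)
      qed
    qed
    moreover have "C i \<subset> C (Suc i)" if i: "i < n" for i
    proof -
      obtain X where X: "X \<in> N (Suc i)" "X \<notin> N i" using N(2)[OF i] by blast
      have "X \<in> carrier (R Quot K)" using subgroup.subset[OF sub[of "Suc i"]] i X by auto
      then obtain x where x: "x \<in> carrier R" "X = K +> x" by (auto simp: FactRing_def A_RCOSETS_def')
      have "x \<in> C (Suc i)" "x \<notin> C i" using x X by (auto simp: C_def)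
      moreover have "C i \<subseteq> C (Suc i)" using N(2)[OF i] by (auto simp: C_def)
      ultimately show ?thesis by blast
    qed
    ultimately have "ichain K (carrier R) n" unfolding ichain_iff[OF oneideal Kc] by blast
    thus "z \<le> len K (carrier R)" by (simp add: z enat_le_len)
  qed
  show "len K (carrier R) \<le> module_length R ?M"
  proof (rule enat_leI)
    fix n assume "enat n \<le> len K (carrier R)"
    hence "ichain K (carrier R) n" by (simp add: enat_le_len)
    then obtain C where C: "\<And>i. i \<le> n \<Longrightarrow> idl (C i)" "\<And>i. i \<le> n \<Longrightarrow> K \<subseteq> C i"
      "\<And>i. i < n \<Longrightarrow> C i \<subset> C (Suc i)" unfolding ichain_iff[OF oneideal Kc] by blast
    define N where "N i = (+>) K ` C i" for i
    have "submodule (N i) R ?M" if i: "i \<le> n" for i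
    proof (rule submodule.intro)
      have "ideal (N i) (R Quot K)" unfolding N_def by (rule ring_ideal_imp_quot_ideal[OF K C(1)[OF i]])
      hence "subgroup (N i) (add_monoid (R Quot K))"
        by (rule additive_subgroup.a_subgroup[OF ideal.axioms(1)])
      thus "subgroup (N i) (add_monoid ?M)" by (simp add: quot_module_add_monoid)
      show "submodule_axioms (N i) R ?M"
      proof (unfold_locales)
        fix a X assume a: "a \<in> carrier R" and "X \<in> N i"
        then obtain x where x: "x \<in> C i" "X = K +> x" by (auto simp: N_def)
        have "a \<otimes> x \<in> C i" by (rule idl_lmult[OF C(1)[OF i] x(1) a])
        thus "a \<odot>\<^bsub>?M\<^esub> X \<in> N i"
          using quot_smult[OF K a idl_carr[OF C(1)[OF i] x(1)]] by (simp add: x(2) N_def)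
      qed
    qed
    moreover have "N i \<subset> N (Suc i)" if i: "i < n" for i
    proof -
      obtain c where c: "c \<in> C (Suc i)" "c \<notin> C i" using C(3)[OF i] by blast
      have cc: "c \<in> carrier R" using c idl_carr[OF C(1)[of "Suc i"]] i by simp
      have "K +> c \<notin> N i"
      proof
        assume "K +> c \<in> N i"
        then obtain b where b: "b \<in> C i" "K +> c = K +> b" by (auto simp: N_def)
        have "c \<in> K +> b" using K.a_rcos_self[OF cc] b(2) by simp
        then obtain k where "k \<in> K" "c = k \<oplus> b" by (auto simp: a_r_coset_def')
        hence "c \<in> C i" using C(1)[of i] C(2)[of i] i b(1) idl_add by (metis less_imp_le subsetD)
        thus False using c by blast
      qed
      moreover have "N i \<subseteq> N (Suc i)" using C(3)[OF i] by (auto simp: N_def)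
      moreover have "K +> c \<in> N (Suc i)" using c by (auto simp: N_def)
      ultimately show ?thesis by blast
    qed
    ultimately show "enat n \<le> module_length R ?M" unfolding module_length_def by (intro Sup_upper) blast
  qed
qed

end

context noetherian_local_ring
begin

lemma colength_eq: "idl K \<Longrightarrow> colength R K = nlen K (carrier R)"
  by (simp add: colength_def nlen_def module_length_quot)

subsection \<open>Minimal numbers of generators\<close>

text \<open>Every generator taken outside the current ideal uses up at least one unit of
  length.\<close>

lemma gens_of_len:
  assumes "idl N" "idl M" "N \<subseteq> M" "len N M \<le> enat k"
  shows "\<exists>S\<subseteq>carrier R. finite S \<and> card S \<le> k \<and> M = N \<boxplus> Idl S"
  using assms
proof (induct k arbitrary: N)
  case 0
  hence "N = M" using len_eq_0 by (simp add: zero_enat_def[symmetric])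
  thus ?case using 0 by (intro exI[of _ "{}"]) (simp add: genideal_empty sum_absorb1 zeroideal idl_zero)
next
  case (Suc k)
  show ?case
  proof (cases "N = M")
    case True
    thus ?thesis using Suc by (intro exI[of _ "{}"]) (simp add: genideal_empty sum_absorb1 zeroideal idl_zero)
  next
    case False
    then obtain x where x: "x \<in> M" "x \<notin> N" using Suc by blast
    have xc: "x \<in> carrier R" using x Suc idl_carr by blast
    let ?N = "N \<boxplus> PIdl x"
    have N: "idl ?N" "?N \<subseteq> M" "N \<subseteq> ?N"
      using adjoin_idl[OF Suc(2) xc] adjoin_le[OF Suc(2,3,4) x(1)] adjoin_ub[OF Suc(2) xc] by auto
    have "N \<subset> ?N" using adjoin_self[OF Suc(2) xc] x N(3) by blast
    hence "ichain N ?N (Suc 0)" using Suc(2) by auto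
    hence "enat (Suc 0) \<le> len N ?N" by (simp add: enat_le_len)
    hence "enat (Suc 0) + len ?N M \<le> len N M" unfolding len_add[OF Suc(2) N(1) Suc(3) N(3,2)] by (rule add_right_mono)
    hence "enat (Suc 0) + len ?N M \<le> enat (Suc k)" using Suc(5) by order
    hence "len ?N M \<le> enat k" by (cases "len ?N M") auto
    from Suc(1)[OF N(1) Suc(3) N(2) this] obtain S where S: "S \<subseteq> carrier R" "finite S" "card S \<le> k"
      "M = ?N \<boxplus> Idl S" by blast
    have e: "M = N \<boxplus> Idl (insert x S)"
      using S(4) sum_assoc[OF Suc(2) pid_idl[OF xc] genideal_ideal[OF S(1)]] genideal_insert[OF S(1) xc] by simp
    have c: "card (insert x S) \<le> Suc k" using S(2,3) by (simp add: card_insert_if)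
    have i: "insert x S \<subseteq> carrier R" using S(1) xc by simp
    have f: "finite (insert x S)" using S(2) by simp
    show ?thesis by (rule exI[of _ "insert x S"]) (rule conjI[OF i conjI[OF f conjI[OF c e]]])
  qed
qed

text \<open>A generator contributes at most length 1 to M/\<mm>M; conversely, as many elements as
  that length generate M modulo \<mm>M, hence M by Nakayama.\<close>

lemma min_gens_eq:
  assumes M: "idl M" shows "enat (min_gens R M) = len (\<mm> \<cdot> M) M"
proof (rule antisym)
  note mM = ideal_prod_is_ideal[OF \<mm>_idl M]
  note sub = prod_subset2[OF \<mm>_idl M]
  let ?P = "\<lambda>n. \<exists>S\<subseteq>carrier R. finite S \<and> card S = n \<and> M = Idl S"
  have le: "len (\<mm> \<cdot> M) M \<le> enat n" if Pn: "?P n" for n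
  proof -
    obtain S where S: "S \<subseteq> carrier R" "finite S" "card S = n" "M = Idl S" using Pn by metis
    have "len (\<mm> \<cdot> M) (\<mm> \<cdot> M \<boxplus> (Idl S) \<cdot> carrier R) \<le> of_nat (card S) * len \<mm> (carrier R)"
    proof (rule len_gens[OF S(2,1) oneideal \<mm>_idl mM idl_subset[OF \<mm>_idl]])
      show "(Idl S) \<cdot> \<mm> \<subseteq> \<mm> \<cdot> M" using ideal_prod_commute[OF M \<mm>_idl] S(4) by simp
    qed
    also have "\<mm> \<cdot> M \<boxplus> (Idl S) \<cdot> carrier R = M" using sum_absorb2[OF mM M sub] ideal_prod_one[OF M] S(4) by simp
    also have "of_nat (card S) * len \<mm> (carrier R) \<le> of_nat (card S) * 1" using len_\<mm> by (rule mult_left_mono) simp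
    finally show ?thesis using S(3) by (simp add: of_nat_eq_enat)
  qed
  have "\<exists>n. ?P n" using fin_gen[OF M] by metis
  hence P: "?P (min_gens R M)" unfolding min_gens_def by (rule LeastI_ex)
  thus "len (\<mm> \<cdot> M) M \<le> enat (min_gens R M)" by (rule le)
  then obtain l where l: "len (\<mm> \<cdot> M) M = enat l" by (cases "len (\<mm> \<cdot> M) M") auto
  from gens_of_len[OF mM M sub, of l] l obtain S where S: "S \<subseteq> carrier R" "finite S" "card S \<le> l"
    "M = \<mm> \<cdot> M \<boxplus> Idl S" by (metis order_refl)
  note Si = genideal_ideal[OF S(1)]
  have "M \<subseteq> Idl S \<boxplus> \<mm> \<cdot> M" using S(4) sum_comm[OF mM Si] by simp
  hence "M \<subseteq> Idl S" by (rule nakayama[OF Si M])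
  moreover have "Idl S \<subseteq> M" using sum_ub2[OF mM Si] S(4) by simp
  ultimately have "M = Idl S" by (rule subset_antisym)
  hence "?P (card S)" using S(1,2) by metis
  hence "min_gens R M \<le> card S" unfolding min_gens_def by (rule Least_le)
  thus "enat (min_gens R M) \<le> len (\<mm> \<cdot> M) M" using l S(3) by simp
qed

lemma min_gens_nlen: "idl M \<Longrightarrow> min_gens R M = nlen (\<mm> \<cdot> M) M"
  using min_gens_eq[of M] by (metis nlen_def the_enat.simps)

text \<open>The special fiber ring is divided by generic linear forms until nothing is left.\<close>

lemma fiber_polynomial:
  assumes inf: "infinite (carrier (R Quot \<mm>))" and I: "cofin I"
  shows "\<exists>n e m0. \<forall>m\<ge>m0. int (min_gens R (pw I m)) = hilb_poly n e m"
proof -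
  note Ii = cofin_idl[OF I]
  note pI = pw_idl[OF Ii]
  note pc = idl_carr[OF pI]
  note mp = ideal_prod_is_ideal[OF \<mm>_idl pI]
  \<comment> \<open>\<open>pw I m\<close> modulo \<open>N J m\<close> is the degree m part of the
    special fiber ring modulo the linear forms from J; in degree zero it is the residue
    field.\<close>
  define N where "N J m = (case m of 0 \<Rightarrow> \<mm> | Suc p \<Rightarrow> \<mm> \<cdot> pw I (Suc p) \<boxplus> J \<cdot> pw I p)" for J m
  have N0: "N J 0 = \<mm>" and NS: "N J (Suc p) = \<mm> \<cdot> pw I (Suc p) \<boxplus> J \<cdot> pw I p" for J p
    by (simp_all add: N_def)
  have Ni: "idl (N J m)" if "idl J" for J m
    using that \<mm>_idl by (cases m) (auto simp: N0 NS intro!: add_ideals mp ideal_prod_is_ideal pI)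
  have NI: "N J m \<subseteq> pw I m" if J: "idl J" "J \<subseteq> I" for J m
  proof (cases m)
    case (Suc p)
    have "J \<cdot> pw I p \<subseteq> pw I (Suc p)" unfolding pw_Suc2[OF Ii] using J by (intro prod_mono) auto
    thus ?thesis unfolding Suc NS by (intro sum_le prod_subset2 \<mm>_idl pI)
  qed (simp add: N0 idl_subset \<mm>_idl)
  have mN: "\<mm> \<cdot> pw I m \<subseteq> N J m" if "idl J" for J m
    using that by (cases m) (auto simp: N0 NS ideal_prod_one \<mm>_idl intro!: sum_ub1[THEN subsetD] mp ideal_prod_is_ideal pI)
  have Ng: "gseq I (N J)" if J: "idl J" "J \<subseteq> I" for J
    unfolding gseq_def
  proof (intro conjI allI)
    show "idl (N J m)" for m by (rule Ni[OF J(1)])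
    show "I \<cdot> N J m \<subseteq> N J (Suc m)" for m
    proof (cases m)
      case 0
      have "I \<cdot> \<mm> = \<mm> \<cdot> pw I (Suc 0)" using ideal_prod_commute[OF Ii \<mm>_idl] pw_1[OF Ii] by simp
      thus ?thesis using 0 sum_ub1[OF mp[of "Suc 0"] ideal_prod_is_ideal[OF J(1) pI[of 0]]] by (simp add: N0 NS)
    next
      case (Suc p)
      have "I \<cdot> N J (Suc p) = I \<cdot> (\<mm> \<cdot> pw I (Suc p)) \<boxplus> I \<cdot> (J \<cdot> pw I p)"
        unfolding NS by (rule prod_sum_r[OF Ii mp ideal_prod_is_ideal[OF J(1) pI]])
      also have "I \<cdot> (\<mm> \<cdot> pw I (Suc p)) = \<mm> \<cdot> pw I (Suc (Suc p))"
        using ideal_prod_assoc[OF Ii \<mm>_idl pI] ideal_prod_assoc[OF \<mm>_idl Ii pI] ideal_prod_commute[OF Ii \<mm>_idl]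
          pw_Suc2[OF Ii, of "Suc p"] by simp
      also have "I \<cdot> (J \<cdot> pw I p) = J \<cdot> pw I (Suc p)"
        using ideal_prod_assoc[OF Ii J(1) pI] ideal_prod_assoc[OF J(1) Ii pI] ideal_prod_commute[OF Ii J(1)]
          pw_Suc2[OF Ii, of p] by simp
      finally show ?thesis by (simp add: Suc NS)
    qed
  qed
  have Nc: "cofin (N J m)" if "idl J" for J m
    by (rule cofin_mono[OF cofin_prod[OF cofin_\<mm> cofin_pw[OF I]] mN[OF that] Ni[OF that]])
  define good where "good J \<longleftrightarrow> (\<exists>n e m0. \<forall>m\<ge>m0. int (nlen (N J m) (pw I m)) = hilb_poly n e m)" for J
  have all: "good J" if J: "idl J" "J \<subseteq> I" for J
  proof (rule ccontr)
    assume "\<not> good J"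
    \<comment> \<open>A maximal J for which the Hilbert function is not eventually polynomial is led
      to a contradiction.\<close>
    define P where "P J \<longleftrightarrow> idl J \<and> J \<subseteq> I \<and> \<not> good J" for J
    have PJ: "P J" using J \<open>\<not> good J\<close> by (simp add: P_def)
    obtain M where M: "P M" and max: "\<And>B. P B \<Longrightarrow> M \<subseteq> B \<Longrightarrow> B = M"
      by (rule obtain_maximal[of P, OF PJ]) (auto simp: P_def)
    have Mi: "idl M" "M \<subseteq> I" "\<not> good M" using M by (auto simp: P_def)
    note mI = ideal_prod_is_ideal[OF \<mm>_idl Ii]
    show False
    proof (cases "I \<subseteq> M \<boxplus> \<mm> \<cdot> I")
      \<comment> \<open>The linear forms from M span degree one, so nothing is left in positive
        degrees.\<close>
      case True
      have "nlen (N M m) (pw I m) = 0" if "m \<ge> 1" for m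
      proof -
        obtain p where p: "m = Suc p" using \<open>m \<ge> 1\<close> by (cases m) auto
        have "pw I m \<subseteq> (M \<boxplus> \<mm> \<cdot> I) \<cdot> pw I p"
          unfolding p pw_Suc2[OF Ii] using True by (intro prod_mono) auto
        also have "\<dots> = M \<cdot> pw I p \<boxplus> \<mm> \<cdot> pw I (Suc p)"
          using prod_sum_l[OF Mi(1) mI pI] ideal_prod_assoc[OF \<mm>_idl Ii pI] pw_Suc2[OF Ii] by simp
        also have "\<dots> = N M m" unfolding p NS by (rule sum_comm[OF ideal_prod_is_ideal[OF Mi(1) pI] mp])
        finally have "N M m = pw I m" using NI[OF Mi(1,2)] by blast
        thus ?thesis by (simp add: nlen_def zero_enat_def)
      qed
      hence "\<forall>m\<ge>1. int (nlen (N M m) (pw I m)) = hilb_poly 0 (\<lambda>_. 0) m" by (simp add: hilb_poly_def)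
      hence "good M" unfolding good_def by blast
      thus False using Mi by blast
    next
      case False
      have "gseq I (N M)" by (rule Ng[OF Mi(1,2)])
      from generic_element[OF Ii this NI[OF Mi(1,2)]] obtain m0 BB where
        BB: "finite BB" "\<forall>B\<in>BB. idl B \<and> B \<subset> I" and gen:
        "\<forall>a\<in>I. a \<notin> \<Union>BB \<longrightarrow> (\<forall>m\<ge>m0. \<forall>c\<in>pw I m. a \<otimes> c \<in> N M (Suc m) \<longrightarrow> c \<in> N M m)" by (elim exE conjE)
      \<comment> \<open>Avoiding this ideal keeps a outside M, so M + (a) is strictly larger and
        therefore good.\<close>
      let ?B0 = "M \<boxplus> \<mm> \<cdot> I"
      have B0: "idl ?B0 \<and> ?B0 \<subset> I"
        using add_ideals[OF Mi(1) mI] False sum_le[OF Mi(2) prod_subset2[OF \<mm>_idl Ii] Ii] by blast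
      have "\<exists>a\<in>I. a \<notin> \<Union>(insert ?B0 BB)"
      proof (rule ideal_avoidance[OF inf Ii])
        show "finite (insert ?B0 BB)" using BB by simp
        show "idl A \<and> A \<subset> I" if "A \<in> insert ?B0 BB" for A
          using that by (elim insertE) (simp add: B0, erule BB(2)[rule_format])
      qed
      then obtain a where a: "a \<in> I" "a \<notin> ?B0" "a \<notin> \<Union>BB" by auto
      have ac: "a \<in> carrier R" using a Ii idl_carr by blast
      let ?M = "M \<boxplus> PIdl a"
      have M': "idl ?M" "?M \<subseteq> I" using adjoin_idl[OF Mi(1) ac] adjoin_le[OF Mi(1) Ii Mi(2) a(1)] by auto
      have "a \<notin> M" using a(2) sum_ub1[OF Mi(1) mI] by blast
      hence "?M \<noteq> M" using adjoin_self[OF Mi(1) ac] by metis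
      hence "\<not> P ?M" using max[of ?M] adjoin_ub[OF Mi(1) ac] by blast
      hence "good ?M" using M' by (simp add: P_def)
      then obtain n e m1 where e: "\<forall>m\<ge>m1. int (nlen (N ?M m) (pw I m)) = hilb_poly n e m" unfolding good_def by blast
      have "int (nlen (N M (Suc m)) (pw I (Suc m))) - int (nlen (N M m) (pw I m)) = hilb_poly n e (Suc m)"
        if m: "m \<ge> m0 + m1" for m
      proof -
        have aW: "idl (mulset a (pw I m))" by (rule mulset_idl[OF ac pI])
        have eq: "N ?M (Suc m) = N M (Suc m) \<boxplus> mulset a (pw I m)"
          unfolding NS using prod_sum_l[OF Mi(1) pid_idl[OF ac] pI] pid_prod[OF ac pI]
            sum_assoc[OF mp ideal_prod_is_ideal[OF Mi(1) pI] aW] by simp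
        \<comment> \<open>A generic a is a nonzerodivisor in large degrees, so the Hilbert function
          for M + (a) is the first difference of the one for M.\<close>
        have col: "colon_in (N M (Suc m)) a (pw I m) = N M m"
        proof (rule subset_antisym)
          show "colon_in (N M (Suc m)) a (pw I m) \<subseteq> N M m"
            using gen[rule_format, OF a(1,3), of m] m by (auto simp: colon_in_def)
          show "N M m \<subseteq> colon_in (N M (Suc m)) a (pw I m)"
            using gseq_step[OF Ng[OF Mi(1,2)] a(1)] NI[OF Mi(1,2)] by (auto simp: colon_in_def)
        qed
        have "nlen (N M (Suc m)) (N ?M (Suc m)) = nlen (N M m) (pw I m)"
          unfolding eq nlen_def len_mult[OF Ni[OF Mi(1)] pI ac] col ..
        moreover have "nlen (N M (Suc m)) (pw I (Suc m)) = nlen (N M (Suc m)) (N ?M (Suc m)) + nlen (N ?M (Suc m)) (pw I (Suc m))"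
        proof (rule nlen_add[OF Nc[OF Mi(1)] Ni[OF M'(1)] pI _ NI[OF M']])
          show "N M (Suc m) \<subseteq> N ?M (Suc m)" unfolding eq by (rule sum_ub1[OF Ni[OF Mi(1)] aW])
        qed
        ultimately show ?thesis using e m by simp
      qed
      from hilb_poly_sum[OF this] have "good M" unfolding good_def by blast
      thus False using Mi by blast
    qed
  qed
  have "idl {\<zero>}" "{\<zero>} \<subseteq> I" using zeroideal idl_zero[OF Ii] by auto
  from all[OF this] obtain n e m0 where e: "\<forall>m\<ge>m0. int (nlen (N {\<zero>} m) (pw I m)) = hilb_poly n e m"
    unfolding good_def by blast
  have "int (min_gens R (pw I m)) = hilb_poly n e m" if m: "m \<ge> Suc m0" for m
  proof -
    obtain p where p: "m = Suc p" using m by (cases m) auto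
    have "{\<zero>} \<cdot> pw I p \<subseteq> \<mm> \<cdot> pw I (Suc p)"
      using prod_subset1[OF zeroideal pI] idl_zero[OF mp] by blast
    hence "N {\<zero>} m = \<mm> \<cdot> pw I m" unfolding p NS by (intro sum_absorb1 mp ideal_prod_is_ideal zeroideal pI)
    thus ?thesis using e[rule_format, of m] m min_gens_nlen[OF pI, of m] by simp
  qed
  thus ?thesis by blast
qed

subsection \<open>The main length estimate\<close>

text \<open>\<lambda>(Y/\<mm>Y) is at most \<lambda>(X/\<mm>X) + \<lambda>(\<mm>X/\<mm>Y), and the
  last term is at most s \<lambda>(X/Y) for s generators of \<mm>. The same s serves all pairs,
  hence all powers of I and K at once.\<close>

lemma min_gens_compare:
  "\<exists>s. \<forall>X Y. cofin X \<longrightarrow> cofin Y \<longrightarrow> Y \<subseteq> X \<longrightarrow> min_gens R Y \<le> min_gens R X + s * nlen Y X"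
proof -
  obtain S where S: "S \<subseteq> carrier R" "finite S" "\<mm> = Idl S" using fin_gen[OF \<mm>_idl] by blast
  have "min_gens R Y \<le> min_gens R X + card S * nlen Y X" if h: "cofin X" "cofin Y" "Y \<subseteq> X" for X Y
  proof -
    note X = cofin_idl[OF h(1)] and Y = cofin_idl[OF h(2)]
    note mX = ideal_prod_is_ideal[OF \<mm>_idl X] and mY = ideal_prod_is_ideal[OF \<mm>_idl Y]
    have cY: "cofin (\<mm> \<cdot> Y)" by (rule cofin_prod[OF cofin_\<mm> h(2)])
    have mYX: "\<mm> \<cdot> Y \<subseteq> \<mm> \<cdot> X" using h(3) by (intro prod_mono) auto
    have mXX: "\<mm> \<cdot> X \<subseteq> X" by (rule prod_subset2[OF \<mm>_idl X])
    have "len (\<mm> \<cdot> Y) (\<mm> \<cdot> Y \<boxplus> (Idl S) \<cdot> X) \<le> of_nat (card S) * len Y X"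
      by (rule len_gens[OF S(2,1) X Y mY h(3)]) (simp add: S(3)[symmetric])
    hence "len (\<mm> \<cdot> Y) (\<mm> \<cdot> X) \<le> of_nat (card S) * len Y X"
      by (simp add: S(3)[symmetric] sum_absorb2[OF mY mX mYX])
    hence "enat (nlen (\<mm> \<cdot> Y) (\<mm> \<cdot> X)) \<le> enat (card S * nlen Y X)"
      by (simp add: enat_nlen[OF cY mX] enat_nlen[OF h(2) X, symmetric] of_nat_eq_enat)
    hence 1: "nlen (\<mm> \<cdot> Y) (\<mm> \<cdot> X) \<le> card S * nlen Y X" by simp
    have "nlen (\<mm> \<cdot> Y) Y \<le> nlen (\<mm> \<cdot> Y) X"
      using cY Y cY X len_mono[OF order_refl h(3) Y] by (rule nlen_le)
    also have "\<dots> = nlen (\<mm> \<cdot> Y) (\<mm> \<cdot> X) + nlen (\<mm> \<cdot> X) X" by (rule nlen_add[OF cY mX X mYX mXX])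
    finally show ?thesis using 1 by (simp add: min_gens_nlen X Y)
  qed
  thus ?thesis by blast
qed

lemma choose_sym: "d > 0 \<Longrightarrow> (m + d - 1) choose m = (m + d - 1) choose (d - 1)"
  using binomial_symmetric[of m "m + d - 1"] by simp

text \<open>Each layer J^m/J^(m+1) is generated over R/J by the monomials of degree m; the layers
  add up by Pascal's rule.\<close>

lemma nlen_regular_power:
  assumes J: "regular_ext d J" "cofin J" "d > 0"
  shows "nlen (pw J m) (carrier R) \<le> ((m + d - 1) choose d) * nlen J (carrier R)"
proof (induct m)
  case 0 show ?case by (simp add: nlen_def zero_enat_def)
next
  case (Suc m)
  note Ji = cofin_idl[OF J(2)]
  note pJ = pw_idl[OF Ji]
  have sub: "pw J (Suc m) \<subseteq> pw J m" by (rule pw_antimono[OF Ji]) simp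
  have "len (pw J (Suc m)) (pw J (Suc m) \<boxplus> pw J m \<cdot> carrier R) \<le> of_nat ((m + d - 1) choose m) * len J (carrier R)"
    by (rule len_power_gens[OF J(1) oneideal Ji idl_subset[OF Ji] pJ]) (simp add: pw_Suc)
  hence "len (pw J (Suc m)) (pw J m) \<le> of_nat ((m + d - 1) choose m) * len J (carrier R)"
    by (simp add: ideal_prod_one[OF pJ] sum_absorb2[OF pJ pJ sub])
  hence "enat (nlen (pw J (Suc m)) (pw J m)) \<le> enat (((m + d - 1) choose m) * nlen J (carrier R))"
    by (simp add: enat_nlen[OF cofin_pw[OF J(2)] pJ] enat_nlen[OF J(2) oneideal, symmetric] of_nat_eq_enat)
  hence "nlen (pw J (Suc m)) (pw J m) \<le> ((m + d - 1) choose (d - 1)) * nlen J (carrier R)"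
    using choose_sym[OF J(3)] by simp
  moreover have "nlen (pw J (Suc m)) (carrier R) = nlen (pw J (Suc m)) (pw J m) + nlen (pw J m) (carrier R)"
    by (rule nlen_add[OF cofin_pw[OF J(2)] pJ oneideal sub idl_subset[OF pJ]])
  moreover have "(Suc m + d - 1) choose d = ((m + d - 1) choose (d - 1)) + ((m + d - 1) choose d)"
    using J(3) by (cases d) auto
  ultimately show ?case using Suc by (simp add: distrib_right)
qed

text \<open>J^m K is interposed between \<mm>K^(m+1) and K^(m+1): the part above it is bounded
  through the Sally module, the part below it by counting monomials. All terms are moved to the side
  where they are positive, so that the inequality lives in the natural numbers.\<close>

lemma main_estimate:
  assumes J: "regular_ext d J" "cofin J" "d > 0" and K: "cofin K" "J \<subseteq> K"
    and ind: "enat d \<le> len (\<mm> \<cdot> K) (J \<boxplus> \<mm> \<cdot> K)"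
  shows "min_gens R (pw K (Suc m)) + nlen (pw K (Suc m)) (carrier R) + ((m + d - 1) choose (d - 1)) * d \<le>
    ((m + d) choose (d - 1)) + ((m + d - 1) choose (d - 1)) * (min_gens R K + nlen K (carrier R))
    + ((m + d - 1) choose d) * nlen J (carrier R)"
proof -
  note Ji = cofin_idl[OF J(2)] and Ki = cofin_idl[OF K(1)]
  note pJ = pw_idl[OF Ji] and pK = pw_idl[OF Ki]
  let ?c = "(m + d - 1) choose (d - 1)"
  let ?Z = "\<mm> \<cdot> pw K (Suc m)" and ?L = "pw J m \<cdot> K" and ?T = "pw K (Suc m)"
  let ?B = "J \<boxplus> \<mm> \<cdot> K"
  have cZ: "cofin ?Z" by (rule cofin_prod[OF cofin_\<mm> cofin_pw[OF K(1)]])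
  have cL: "cofin ?L" by (rule cofin_prod[OF cofin_pw[OF J(2)] K(1)])
  note Z = cofin_idl[OF cZ] and L = cofin_idl[OF cL]
  note mK = ideal_prod_is_ideal[OF \<mm>_idl Ki]
  have mKK: "\<mm> \<cdot> K \<subseteq> K" by (rule prod_subset2[OF \<mm>_idl Ki])
  have B: "idl ?B" "?B \<subseteq> K" "\<mm> \<cdot> K \<subseteq> ?B"
    using add_ideals[OF Ji mK] sum_le[OF K(2) mKK Ki] sum_ub2[OF Ji mK] by auto
  have cB: "cofin ?B" by (rule cofin_mono[OF J(2) sum_ub1[OF Ji mK] B(1)])
  have ZT: "?Z \<subseteq> ?T" by (rule prod_subset2[OF \<mm>_idl pK])
  have LT: "?L \<subseteq> ?T" unfolding pw_Suc using pw_mono[OF K(2)] by (intro prod_mono) auto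
  have ZL: "idl (?Z \<boxplus> ?L)" "?Z \<boxplus> ?L \<subseteq> ?T" "?Z \<subseteq> ?Z \<boxplus> ?L" "?L \<subseteq> ?Z \<boxplus> ?L"
    using add_ideals[OF Z L] sum_le[OF ZT LT pK] sum_ub1[OF Z L] sum_ub2[OF Z L] by auto
  have 1: "min_gens R ?T = nlen ?Z (?Z \<boxplus> ?L) + nlen (?Z \<boxplus> ?L) ?T"
    unfolding min_gens_nlen[OF pK] by (rule nlen_add[OF cZ ZL(1) pK ZL(3,2)])
  \<comment> \<open>K^(m+1)/J^m K is a component of the Sally module. Its length follows from
    \<lambda>(R/J^m K), computed through the layer J^m/J^m K.\<close>
  have 2: "nlen (?Z \<boxplus> ?L) ?T \<le> nlen ?L ?T"
    by (rule nlen_le[OF cofin_mono[OF cZ ZL(3,1)] pK cL pK]) (rule len_mono[OF ZL(4) order_refl pK])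
  have 3: "nlen ?L (carrier R) = nlen ?L ?T + nlen ?T (carrier R)"
    by (rule nlen_add[OF cL pK oneideal LT idl_subset[OF pK]])
  have LJ: "?L \<subseteq> pw J m" by (rule prod_subset1[OF pJ Ki])
  have 4: "nlen ?L (carrier R) = nlen ?L (pw J m) + nlen (pw J m) (carrier R)"
    by (rule nlen_add[OF cL pJ oneideal LJ idl_subset[OF pJ]])
  have "len ?L (?L \<boxplus> pw J m \<cdot> carrier R) \<le> of_nat ((m + d - 1) choose m) * len K (carrier R)"
    by (rule len_power_gens[OF J(1) oneideal Ki idl_subset[OF Ki] L order_refl])
  hence "enat (nlen ?L (pw J m)) \<le> enat (((m + d - 1) choose m) * nlen K (carrier R))"
    by (simp add: ideal_prod_one[OF pJ] sum_absorb2[OF L pJ LJ] enat_nlen[OF cL pJ]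
        enat_nlen[OF K(1) oneideal, symmetric] of_nat_eq_enat)
  hence 5: "nlen ?L (pw J m) \<le> ?c * nlen K (carrier R)" using choose_sym[OF J(3)] by simp
  have 6: "nlen (pw J m) (carrier R) \<le> ((m + d - 1) choose d) * nlen J (carrier R)"
    by (rule nlen_regular_power[OF J])
  \<comment> \<open>J^(m+1) is split off first: its monomials cost at most one each, not \<mu>(K).
    What J^m K adds beyond it is J^m times K/(J + \<mm>K).\<close>
  let ?Z1 = "?Z \<boxplus> pw J (Suc m)"
  have Z1: "idl ?Z1" "?Z \<subseteq> ?Z1" using add_ideals[OF Z pJ] sum_ub1[OF Z pJ] by auto
  have cZ1: "cofin ?Z1" by (rule cofin_mono[OF cZ Z1(2,1)])
  have "pw J (Suc m) \<cdot> \<mm> \<subseteq> ?Z"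
    unfolding ideal_prod_commute[OF pJ \<mm>_idl] by (rule prod_mono[OF order_refl pw_mono[OF K(2)]])
  hence "len ?Z (?Z \<boxplus> pw J (Suc m) \<cdot> carrier R) \<le> of_nat ((Suc m + d - 1) choose (Suc m)) * len \<mm> (carrier R)"
    by (rule len_power_gens[OF J(1) oneideal \<mm>_idl idl_subset[OF \<mm>_idl] Z])
  also have "\<dots> \<le> of_nat ((Suc m + d - 1) choose (Suc m)) * 1" using len_\<mm> by (rule mult_left_mono) simp
  finally have "enat (nlen ?Z ?Z1) \<le> enat ((Suc m + d - 1) choose (Suc m))"
    by (simp add: ideal_prod_one[OF pJ] enat_nlen[OF cZ Z1(1)] of_nat_eq_enat)
  hence 7: "nlen ?Z ?Z1 \<le> (m + d) choose (d - 1)" using choose_sym[OF J(3), of "Suc m"] by simp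
  have Z1L: "idl (?Z1 \<boxplus> ?L)" "?Z1 \<subseteq> ?Z1 \<boxplus> ?L" using add_ideals[OF Z1(1) L] sum_ub1[OF Z1(1) L] by auto
  have "pw J m \<cdot> ?B \<subseteq> ?Z1"
  proof -
    have "pw J m \<cdot> ?B = pw J (Suc m) \<boxplus> pw J m \<cdot> (\<mm> \<cdot> K)"
      unfolding pw_Suc by (rule prod_sum_r[OF pJ Ji mK])
    also have "pw J m \<cdot> (\<mm> \<cdot> K) = \<mm> \<cdot> (pw J m \<cdot> K)"
      using ideal_prod_assoc[OF pJ \<mm>_idl Ki] ideal_prod_assoc[OF \<mm>_idl pJ Ki] ideal_prod_commute[OF pJ \<mm>_idl] by simp
    also have "\<mm> \<cdot> (pw J m \<cdot> K) \<subseteq> ?Z" by (rule prod_mono[OF order_refl LT])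
    finally have "pw J m \<cdot> ?B \<subseteq> pw J (Suc m) \<boxplus> ?Z" by (meson order_refl subset_trans sum_mono)
    thus ?thesis using sum_comm[OF pJ Z] by simp
  qed
  hence "len ?Z1 (?Z1 \<boxplus> ?L) \<le> of_nat ((m + d - 1) choose m) * len ?B K"
    by (rule len_power_gens[OF J(1) Ki B(1,2) Z1(1)])
  hence "enat (nlen ?Z1 (?Z1 \<boxplus> ?L)) \<le> enat (((m + d - 1) choose m) * nlen ?B K)"
    by (simp add: enat_nlen[OF cZ1 Z1L(1)] enat_nlen[OF cB Ki, symmetric] of_nat_eq_enat)
  hence 8: "nlen ?Z1 (?Z1 \<boxplus> ?L) \<le> ?c * nlen ?B K" using choose_sym[OF J(3)] by simp
  have 9: "nlen ?Z (?Z \<boxplus> ?L) \<le> nlen ?Z (?Z1 \<boxplus> ?L)"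
    by (rule nlen_le[OF cZ ZL(1) cZ Z1L(1)]) (rule len_mono[OF order_refl sum_mono[OF Z1(2) order_refl] ZL(1)])
  have 10: "nlen ?Z (?Z1 \<boxplus> ?L) = nlen ?Z ?Z1 + nlen ?Z1 (?Z1 \<boxplus> ?L)"
    by (rule nlen_add[OF cZ Z1(1) Z1L(1) Z1(2) Z1L(2)])
  have cmK: "cofin (\<mm> \<cdot> K)" by (rule cofin_prod[OF cofin_\<mm> K(1)])
  \<comment> \<open>Independence of the d superficial elements lowers the cost per monomial of
    degree m to \<mu>(K) - d.\<close>
  have "d \<le> nlen (\<mm> \<cdot> K) ?B" using ind enat_nlen[OF cmK B(1)] by (metis enat_ord_simps(1))
  moreover have "min_gens R K = nlen (\<mm> \<cdot> K) ?B + nlen ?B K"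
    unfolding min_gens_nlen[OF Ki] by (rule nlen_add[OF cmK B(1) Ki B(3,2)])
  ultimately have "?c * (nlen ?B K + d) \<le> ?c * min_gens R K" by simp
  thus ?thesis using 1 2 3 4 5 6 7 8 9 10 by (simp add: distrib_left)
qed

end

subsection \<open>Growth of Hilbert functions\<close>

text \<open>\<open>slow s f\<close> means \<open>f m = O(m\<^sup>s\<^sup>-\<^sup>1)\<close>, where \<open>O(m\<^sup>-\<^sup>1)\<close> is read as: eventually zero.\<close>

primrec slow :: "nat \<Rightarrow> (nat \<Rightarrow> nat) \<Rightarrow> bool" where
  "slow 0 f = (\<exists>m0. \<forall>m\<ge>m0. f m = 0)"
| "slow (Suc s) f = (\<exists>C m0. \<forall>m\<ge>m0. f m \<le> C * m ^ s)"

lemma slow_0I: "(\<And>m. m \<ge> m0 \<Longrightarrow> f m = 0) \<Longrightarrow> slow 0 f"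
  by auto

lemma slow_SucI: "(\<And>m. m \<ge> m0 \<Longrightarrow> f m \<le> C * m ^ s) \<Longrightarrow> slow (Suc s) f"
  by auto

lemma slow_zero: "slow 0 f \<Longrightarrow> slow s f"
  by (cases s) (auto, metis le0)

lemma slow_mono:
  assumes "slow s g" "\<And>m. m \<ge> m1 \<Longrightarrow> f m \<le> c * g m" shows "slow s f"
proof (cases s)
  case 0
  then obtain m0 where "\<forall>m\<ge>m0. g m = 0" using assms(1) by auto
  hence "f m = 0" if "m \<ge> max m0 m1" for m using assms(2)[of m] that by simp
  thus ?thesis unfolding 0 by (rule slow_0I)
next
  case (Suc t)
  then obtain C m0 where C: "\<And>m. m \<ge> m0 \<Longrightarrow> g m \<le> C * m ^ t" using assms(1) by auto
  have "f m \<le> (c * C) * m ^ t" if "m \<ge> max m0 m1" for m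
  proof -
    have "f m \<le> c * g m" using assms(2) that by simp
    also have "\<dots> \<le> c * (C * m ^ t)" using C[of m] that by (intro mult_left_mono) auto
    finally show ?thesis by (simp add: mult.assoc)
  qed
  thus ?thesis unfolding Suc by (rule slow_SucI)
qed

lemma slow_add: "slow s f \<Longrightarrow> slow s g \<Longrightarrow> slow s (\<lambda>m. f m + g m)"
proof (cases s)
  case 0
  assume "slow s f" "slow s g"
  then obtain m0 m1 where "\<forall>m\<ge>m0. f m = 0" "\<forall>m\<ge>m1. g m = 0" using 0 by auto
  hence "f m + g m = 0" if "m \<ge> max m0 m1" for m using that by simp
  thus ?thesis unfolding 0 by (rule slow_0I)
next
  case (Suc t)
  assume "slow s f" "slow s g"
  then obtain C D m0 m1 where C: "\<forall>m\<ge>m0. f m \<le> C * m ^ t" and D: "\<forall>m\<ge>m1. g m \<le> D * m ^ t" using Suc by auto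
  have "f m + g m \<le> (C + D) * m ^ t" if "m \<ge> max m0 m1" for m
    using C[rule_format, of m] D[rule_format, of m] that by (simp add: distrib_right)
  thus ?thesis unfolding Suc by (rule slow_SucI)
qed

lemma slow_shift: "slow s f \<Longrightarrow> slow s (\<lambda>m. f (m - j))"
proof (cases s)
  case 0
  assume "slow s f"
  then obtain m0 where "\<forall>m\<ge>m0. f m = 0" using 0 by auto
  hence "f (m - j) = 0" if "m \<ge> m0 + j" for m using that by simp
  thus ?thesis unfolding 0 by (rule slow_0I)
next
  case (Suc t)
  assume "slow s f"
  then obtain C m0 where C: "\<forall>m\<ge>m0. f m \<le> C * m ^ t" using Suc by auto
  have "f (m - j) \<le> C * m ^ t" if "m \<ge> m0 + j" for m
  proof -
    have "f (m - j) \<le> C * (m - j) ^ t" using C that by simp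
    also have "\<dots> \<le> C * m ^ t" by (intro mult_left_mono power_mono) auto
    finally show ?thesis .
  qed
  thus ?thesis unfolding Suc by (rule slow_SucI)
qed

text \<open>Summation raises the order of growth by at most one.\<close>

lemma slow_sum:
  assumes g: "slow s g" and f: "\<And>m. f (Suc m) \<le> f m + g (Suc m)"
  shows "slow (Suc s) f"
proof (cases s)
  case 0
  then obtain m0 where m0: "\<forall>m\<ge>m0. g m = 0" using g by auto
  have "f m \<le> f m0" if "m \<ge> m0" for m
    using that
  proof (induct m rule: dec_induct)
    case (step m) thus ?case using f[of m] m0 by simp
  qed simp
  hence "f m \<le> f m0 * m ^ 0" if "m \<ge> m0" for m using that by simp
  thus ?thesis unfolding 0 by (rule slow_SucI)
next
  case (Suc t)
  then obtain C m0 where C: "\<forall>m\<ge>m0. g m \<le> C * m ^ t" using g by auto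
  define m1 where "m1 = max m0 1"
  \<comment> \<open>The summand \<open>f m1\<close> starts the induction, C absorbs the increments;
    \<open>m1\<close> is at least 1, so its powers are too.\<close>
  define D where "D = f m1 + C"
  have "f m \<le> D * m ^ Suc t" if "m \<ge> m1" for m
    using that
  proof (induct m rule: dec_induct)
    case base
    have "f m1 * 1 \<le> D * m1 ^ Suc t" by (rule mult_mono) (auto simp: D_def m1_def)
    thus ?case by simp
  next
    case (step m)
    have "f (Suc m) \<le> f m + g (Suc m)" by (rule f)
    also have "\<dots> \<le> D * m ^ Suc t + C * Suc m ^ t" using step C by (intro add_mono) (auto simp: m1_def)
    also have "\<dots> \<le> D * (m * Suc m ^ t) + D * Suc m ^ t"
      by (intro add_mono mult_left_mono mult_right_mono) (auto simp: D_def power_mono)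
    also have "\<dots> = D * Suc m ^ Suc t" by (simp add: algebra_simps)
    finally show ?case .
  qed
  thus ?thesis unfolding Suc by (rule slow_SucI)
qed

context noetherian_local_ring
begin

subsection \<open>Graded ideals and primes of Rees algebras\<close>

definition graded_ideal :: "'a set \<Rightarrow> (nat \<Rightarrow> 'a set) \<Rightarrow> bool" where
  "graded_ideal I Q \<longleftrightarrow> gseq I Q \<and> (\<forall>m. Q m \<subseteq> pw I m)"

text \<open>Primality is tested on homogeneous elements only; \<open>rees_ideal_prime\<close> shows
  that this suffices.\<close>

definition graded_prime :: "'a set \<Rightarrow> (nat \<Rightarrow> 'a set) \<Rightarrow> bool" where
  "graded_prime I Q \<longleftrightarrow> graded_ideal I Q \<and> \<one> \<notin> Q 0 \<and>
     (\<forall>i j. \<forall>a\<in>pw I i. \<forall>b\<in>pw I j. a \<otimes> b \<in> Q (i + j) \<longrightarrow> a \<in> Q i \<or> b \<in> Q j)"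

definition graded_chain :: "'a set \<Rightarrow> nat \<Rightarrow> (nat \<Rightarrow> nat \<Rightarrow> 'a set) \<Rightarrow> bool" where
  "graded_chain I n P \<longleftrightarrow> (\<forall>i\<le>n. graded_prime I (P i)) \<and> (\<forall>i<n. P i < P (Suc i))"

lemma graded_chain_cons:
  assumes "graded_chain I n P" "graded_prime I Q" "Q < P 0"
  shows "graded_chain I (Suc n) (case_nat Q P)"
proof -
  have "graded_prime I (case_nat Q P i)" if "i \<le> Suc n" for i
    using that assms by (cases i) (auto simp: graded_chain_def)
  moreover have "case_nat Q P i < case_nat Q P (Suc i)" if "i < Suc n" for i
    using that assms by (cases i) (auto simp: graded_chain_def)
  ultimately show ?thesis unfolding graded_chain_def by blast
qed

text \<open>The components of the graded ideal Q + (a t^i).\<close>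

definition adjoin_hom :: "'a set \<Rightarrow> (nat \<Rightarrow> 'a set) \<Rightarrow> nat \<Rightarrow> 'a \<Rightarrow> nat \<Rightarrow> 'a set" where
  "adjoin_hom I Q i a m = (if m < i then Q m else Q m \<boxplus> mulset a (pw I (m - i)))"

lemma adjoin_hom:
  assumes I: "idl I" and Q: "graded_ideal I Q" and a: "a \<in> pw I i"
  shows "graded_ideal I (adjoin_hom I Q i a)" "\<And>m. Q m \<subseteq> adjoin_hom I Q i a m" "a \<in> adjoin_hom I Q i a i"
proof -
  note pI = pw_idl[OF I]
  have gQ: "gseq I Q" and QI: "\<And>m. Q m \<subseteq> pw I m" using Q by (auto simp: graded_ideal_def)
  note Qi = gseq_idl[OF gQ]
  have ac: "a \<in> carrier R" using a pI idl_carr by blast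
  have aW: "idl (mulset a (pw I j))" for j by (rule mulset_idl[OF ac pI])
  show sub: "Q m \<subseteq> adjoin_hom I Q i a m" for m using sum_ub1[OF Qi aW] by (simp add: adjoin_hom_def)
  have "a \<otimes> \<one> \<in> Q i \<boxplus> mulset a (pw I 0)"
    using sum_ub2[OF Qi aW] mulsetI[of "\<one>" "pw I 0" a] by (metis one_closed pw_0 subsetD)
  thus "a \<in> adjoin_hom I Q i a i" using ac by (simp add: adjoin_hom_def)
  show "graded_ideal I (adjoin_hom I Q i a)" unfolding graded_ideal_def
  proof (intro conjI allI)
    show "adjoin_hom I Q i a m \<subseteq> pw I m" for m
    proof (cases "m < i")
      case True thus ?thesis using QI by (simp add: adjoin_hom_def)
    next
      case False
      have "mulset a (pw I (m - i)) \<subseteq> pw I i \<cdot> pw I (m - i)" using a by (auto simp: mulset_def prodI)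
      also have "\<dots> = pw I m" using pw_add[OF I, of i "m - i"] False by simp
      finally show ?thesis using False QI pI by (simp add: adjoin_hom_def sum_le)
    qed
    show "gseq I (adjoin_hom I Q i a)"
    proof (rule gseqI)
      show "idl (adjoin_hom I Q i a m)" for m using Qi add_ideals[OF Qi aW] by (simp add: adjoin_hom_def)
      fix m b z assume b: "b \<in> I" and z: "z \<in> adjoin_hom I Q i a m"
      show "b \<otimes> z \<in> adjoin_hom I Q i a (Suc m)"
      proof (cases "m < i")
        case True
        hence "b \<otimes> z \<in> Q (Suc m)" using z gseq_step[OF gQ b] by (simp add: adjoin_hom_def)
        thus ?thesis using sub by blast
      next
        case False
        then obtain q w where qw: "q \<in> Q m" "w \<in> pw I (m - i)" "z = q \<oplus> a \<otimes> w"
          using z by (auto simp: adjoin_hom_def mem_sum mulset_def)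
        have bc: "b \<in> carrier R" using b I idl_carr by blast
        have "b \<otimes> z = b \<otimes> q \<oplus> a \<otimes> (b \<otimes> w)"
          unfolding qw(3) using bc ac idl_carr[OF Qi qw(1)] idl_carr[OF pI qw(2)] by algebra
        moreover have "b \<otimes> w \<in> pw I (Suc m - i)"
          using gseq_step[OF gseq_pw[OF I] b qw(2)] False by (simp add: Suc_diff_le)
        ultimately show ?thesis using gseq_step[OF gQ b qw(1)] False
          by (simp add: adjoin_hom_def sumI mulsetI)
      qed
    qed
  qed
qed

text \<open>The contraction of P R[t] to the Rees algebra.\<close>

lemma graded_prime_ideal_contraction:
  assumes "idl I" "primeideal P R" shows "graded_prime I (\<lambda>m. P \<inter> pw I m)"
  unfolding graded_prime_def graded_ideal_def
proof (intro conjI allI ballI impI)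
  note Pi = primeideal_idl[OF assms(2)]
  show "gseq I (\<lambda>m. P \<inter> pw I m)"
  proof (rule gseqI)
    show "idl (P \<inter> pw I m)" for m by (rule idl_Int[OF Pi pw_idl[OF assms(1)]])
    show "b \<otimes> z \<in> P \<inter> pw I (Suc m)" if "b \<in> I" "z \<in> P \<inter> pw I m" for m b z
      using that gseq_step[OF gseq_pw[OF assms(1)]] idl_lmult[OF Pi] idl_carr[OF assms(1)] by blast
  qed
  show "P \<inter> pw I m \<subseteq> pw I m" for m by blast
  show "\<one> \<notin> P \<inter> pw I 0" using primeideal_one[OF assms(2)] by blast
  show "a \<in> P \<inter> pw I i \<or> b \<in> P \<inter> pw I j"
    if "a \<in> pw I i" "b \<in> pw I j" "a \<otimes> b \<in> P \<inter> pw I (i + j)" for i j a b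
    using that primeideal_mem[OF assms(2)] idl_carr[OF pw_idl[OF assms(1)]] by blast
qed

text \<open>A graded ideal maximal with the property that its quotient grows fast is prime.\<close>

lemma growth_maximal:
  assumes I: "cofin I" "I \<subseteq> \<mm>" and Q: "graded_ideal I Q" "cofin (Q 0)"
    and ns: "\<not> slow s (\<lambda>m. nlen (Q m) (pw I m))"
  obtains Q' where "graded_prime I Q'" "Q \<le> Q'" "cofin (Q' 0)" "\<not> slow s (\<lambda>m. nlen (Q' m) (pw I m))"
proof -
  note Ii = cofin_idl[OF I(1)]
  note pI = pw_idl[OF Ii]
  define F where "F = {Q'. graded_ideal I Q' \<and> Q \<le> Q' \<and> \<not> slow s (\<lambda>m. nlen (Q' m) (pw I m))}"
  have "Q \<in> F" using Q(1) ns by (simp add: F_def)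
  from wfE_min[OF wf_gseq_rel[OF Ii] this] obtain M where M: "M \<in> F"
    and max: "\<And>N. (N, M) \<in> gseq_rel I \<Longrightarrow> N \<notin> F" by blast
  have Mg: "graded_ideal I M" and QM: "Q \<le> M" and Ms: "\<not> slow s (\<lambda>m. nlen (M m) (pw I m))"
    using M by (auto simp: F_def)
  have gM: "gseq I M" and MI: "\<And>m. M m \<subseteq> pw I m" using Mg by (auto simp: graded_ideal_def)
  note Mi = gseq_idl[OF gM]
  have big: "slow s (\<lambda>m. nlen (N m) (pw I m))" if N: "graded_ideal I N" "\<And>m. M m \<subseteq> N m" "N \<noteq> M" for N
  proof (rule ccontr)
    assume "\<not> ?thesis"
    hence "N \<in> F" using N(1,2) QM by (auto simp: F_def le_fun_def)
    moreover have "(N, M) \<in> gseq_rel I" using N gM by (auto simp: gseq_rel_def graded_ideal_def)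
    ultimately show False using max by blast
  qed
  have cof0: "cofin (M 0)" using QM by (intro cofin_mono[OF Q(2) _ Mi]) (simp add: le_fun_def)
  have cof: "cofin (M m)" for m
  proof (rule cofin_mono[OF cofin_prod[OF cofin_pw[OF I(1), of m] cof0] _ Mi])
    show "pw I m \<cdot> M 0 \<subseteq> M m" using gseq_pow[OF Ii gM, of _ m _ 0] by (intro prod_le[OF Mi]) simp
  qed
  have "graded_prime I M"
    unfolding graded_prime_def
  proof (intro conjI allI ballI impI)
    show "graded_ideal I M" by (rule Mg)
    show "\<one> \<notin> M 0"
    proof
      assume "\<one> \<in> M 0"
      hence "a \<in> M m" if a: "a \<in> pw I m" for a m using gseq_pow[OF Ii gM a, of "\<one>" 0] a idl_carr[OF pI] by simp
      hence "M m = pw I m" for m using MI by blast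
      hence "slow 0 (\<lambda>m. nlen (M m) (pw I m))" by (simp add: nlen_def zero_enat_def)
      thus False using Ms slow_zero by blast
    qed
    fix i j a b assume a: "a \<in> pw I i" and b: "b \<in> pw I j" and ab: "a \<otimes> b \<in> M (i + j)"
    show "a \<in> M i \<or> b \<in> M j"
    proof (rule ccontr)
      assume "\<not> ?thesis"
      hence na: "a \<notin> M i" and nb: "b \<notin> M j" by auto
      have ac: "a \<in> carrier R" using a idl_carr[OF pI] by blast
      \<comment> \<open>With A the Rees algebra, \<open>N1\<close> is M + (a t^i) and
        \<open>N2\<close> below is M : (a t^i). Both are strictly larger than M, and A/M is an
        extension of A/N1 by A/N2 shifted by i.\<close>
      define N1 where "N1 = adjoin_hom I M i a"
      define N2 where "N2 m = colon_in (M (m + i)) a (pw I m)" for m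
      note N1 = adjoin_hom[OF Ii Mg a, folded N1_def]
      have N2i: "idl (N2 m)" for m unfolding N2_def by (rule colon_in_idl[OF Mi ac pI])
      have N2: "graded_ideal I N2" unfolding graded_ideal_def
      proof (intro conjI allI)
        show "N2 m \<subseteq> pw I m" for m by (simp add: N2_def colon_in_subset)
        show "gseq I N2"
        proof (rule gseqI[OF N2i])
          fix m c z assume c: "c \<in> I" and "z \<in> N2 m"
          hence z: "z \<in> pw I m" "a \<otimes> z \<in> M (m + i)" by (auto simp: N2_def colon_in_def)
          have "a \<otimes> (c \<otimes> z) = c \<otimes> (a \<otimes> z)" using ac idl_carr[OF Ii c] idl_carr[OF pI z(1)] by algebra
          thus "c \<otimes> z \<in> N2 (Suc m)" using gseq_step[OF gM c z(2)] gseq_step[OF gseq_pw[OF Ii] c z(1)]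
            by (simp add: N2_def colon_in_def)
        qed
      qed
      have MN2: "M m \<subseteq> N2 m" for m
        using gseq_pow[OF Ii gM a, of _ m] MI by (auto simp: N2_def colon_in_def)
      have "b \<in> N2 j" using b ab by (simp add: N2_def colon_in_def add.commute)
      hence s2: "slow s (\<lambda>m. nlen (N2 m) (pw I m))" using nb by (intro big[OF N2 MN2]) metis
      have s1: "slow s (\<lambda>m. nlen (N1 m) (pw I m))" using N1(3) na by (intro big[OF N1(1,2)]) metis
      have "nlen (M m) (pw I m) \<le> 1 * (nlen (N2 (m - i)) (pw I (m - i)) + nlen (N1 m) (pw I m))" if m: "m \<ge> i" for m
      proof -
        have "idl (N1 m)" "N1 m \<subseteq> pw I m" using N1(1) gseq_idl by (auto simp: graded_ideal_def)
        hence "nlen (M m) (pw I m) = nlen (M m) (N1 m) + nlen (N1 m) (pw I m)"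
          by (intro nlen_add[OF cof _ pI N1(2)])
        moreover have "nlen (M m) (N1 m) = nlen (N2 (m - i)) (pw I (m - i))"
          using len_mult[OF Mi pI ac, of m "m - i"] m by (simp add: N1_def adjoin_hom_def N2_def nlen_def)
        ultimately show ?thesis by simp
      qed
      \<comment> \<open>Both ends of the extension grow slowly by maximality of M, hence so does
        A/M.\<close>
      from slow_mono[OF slow_add[OF slow_shift[OF s2] s1] this] show False using Ms by blast
    qed
  qed
  thus thesis using that QM cof0 Ms by blast
qed

text \<open>Otherwise Q would contain all positive degrees, and the quotient would eventually
  vanish.\<close>

lemma growth_chain_aux:
  assumes I: "cofin I" "I \<subseteq> \<mm>" and Q: "graded_prime I Q" "cofin (Q 0)"
    and ns: "\<not> slow s (\<lambda>m. nlen (Q m) (pw I m))"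
  shows "\<exists>x\<in>I. x \<notin> Q 1"
proof (rule ccontr)
  assume n: "\<not> ?thesis"
  note Ii = cofin_idl[OF I(1)]
  note pI = pw_idl[OF Ii]
  have gQ: "gseq I Q" and QI: "\<And>m. Q m \<subseteq> pw I m" using Q by (auto simp: graded_prime_def graded_ideal_def)
  have "Q m = pw I m" if "m \<ge> 1" for m
  proof (rule subset_antisym[OF QI])
    obtain p where p: "m = 1 + p" using \<open>m \<ge> 1\<close> le_Suc_ex by blast
    have "pw I m = pw I p \<cdot> I" using p by (simp add: pw_Suc)
    also have "\<dots> \<subseteq> Q m" unfolding p
      using gseq_pow[OF Ii gQ] n by (intro prod_le gseq_idl[OF gQ]) blast
    finally show "pw I m \<subseteq> Q m" .
  qed
  hence "\<forall>m\<ge>1. nlen (Q m) (pw I m) = 0" by (simp add: nlen_def zero_enat_def)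
  hence "slow 0 (\<lambda>m. nlen (Q m) (pw I m))" by auto
  thus False using ns slow_zero by blast
qed

lemma graded_maximal_prime:
  assumes I: "idl I" shows "graded_prime I (\<lambda>m. if m = 0 then \<mm> else pw I m)"
  unfolding graded_prime_def graded_ideal_def
proof (intro conjI allI ballI impI)
  show "gseq I (\<lambda>m. if m = 0 then \<mm> else pw I m)"
  proof (rule gseqI)
    show "idl (if m = 0 then \<mm> else pw I m)" for m using \<mm>_idl pw_idl[OF I] by simp
    show "b \<otimes> z \<in> (if Suc m = 0 then \<mm> else pw I (Suc m))" if "b \<in> I" "z \<in> (if m = 0 then \<mm> else pw I m)" for m b z
    proof -
      have "z \<in> pw I m" using that(2) idl_carr[OF \<mm>_idl] by (cases "m = 0") auto
      thus ?thesis using gseq_step[OF gseq_pw[OF I] that(1)] by simp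
    qed
  qed
  show "(if m = 0 then \<mm> else pw I m) \<subseteq> pw I m" for m using idl_subset[OF \<mm>_idl] by simp
  show "\<one> \<notin> (if (0::nat) = 0 then \<mm> else pw I 0)" using one_notin_\<mm> by simp
  show "a \<in> (if i = 0 then \<mm> else pw I i) \<or> b \<in> (if j = 0 then \<mm> else pw I j)"
    if "a \<in> pw I i" "b \<in> pw I j" "a \<otimes> b \<in> (if i + j = 0 then \<mm> else pw I (i + j))" for i j a b
    using that primeideal_mem[OF \<mm>_prime, of a b] by (cases "i = 0"; cases "j = 0") auto
qed

text \<open>Fast growth forces large dimension. Pass to a prime M with a fast growing quotient and
  adjoin x t with x outside \<open>M 1\<close>: by \<open>slow_sum\<close> this lowers the order of
  growth by at most one. At order zero the homogeneous maximal ideal still lies strictly above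
  M.\<close>

lemma growth_chain:
  assumes I: "cofin I" "I \<subseteq> \<mm>"
  shows "graded_ideal I Q \<Longrightarrow> cofin (Q 0) \<Longrightarrow> \<not> slow s (\<lambda>m. nlen (Q m) (pw I m)) \<Longrightarrow>
    \<exists>P. graded_chain I (Suc s) P \<and> Q \<le> P 0"
proof (induct s arbitrary: Q)
  case (0 Q)
  note Ii = cofin_idl[OF I(1)]
  obtain M where M: "graded_prime I M" "Q \<le> M" "cofin (M 0)" "\<not> slow 0 (\<lambda>m. nlen (M m) (pw I m))"
    by (rule growth_maximal[OF I 0])
  obtain x where x: "x \<in> I" "x \<notin> M 1" using growth_chain_aux[OF I M(1,3,4)] by blast
  let ?T = "\<lambda>m. if m = 0 then \<mm> else pw I m"
  have MI: "M m \<subseteq> pw I m" for m using M(1) by (auto simp: graded_prime_def graded_ideal_def)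
  have "M 0 \<noteq> carrier R" using M(1) by (auto simp: graded_prime_def)
  hence "M 0 \<subseteq> \<mm>" by (rule proper_le_\<mm>[OF cofin_idl[OF M(3)]])
  hence "M \<le> ?T" using MI by (auto simp: le_fun_def)
  moreover have "x \<in> ?T 1" using x pw_1[OF Ii] by simp
  hence "M \<noteq> ?T" using x by metis
  ultimately have "M < ?T" by simp
  moreover have "graded_chain I 0 (\<lambda>_. ?T)" using graded_maximal_prime[OF Ii] by (simp add: graded_chain_def)
  ultimately have "graded_chain I (Suc 0) (case_nat M (\<lambda>_. ?T))" using M(1) by (intro graded_chain_cons)
  thus ?case using M(2) by (intro exI[of _ "case_nat M (\<lambda>_. ?T)"]) simp
next
  case (Suc s Q)
  note Ii = cofin_idl[OF I(1)]
  note pI = pw_idl[OF Ii]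
  obtain M where M: "graded_prime I M" "Q \<le> M" "cofin (M 0)" "\<not> slow (Suc s) (\<lambda>m. nlen (M m) (pw I m))"
    by (rule growth_maximal[OF I Suc(2-4)])
  obtain x where x: "x \<in> I" "x \<notin> M 1" using growth_chain_aux[OF I M(1,3,4)] by blast
  have Mg: "graded_ideal I M" using M(1) by (simp add: graded_prime_def)
  have gM: "gseq I M" and MI: "\<And>m. M m \<subseteq> pw I m" using Mg by (auto simp: graded_ideal_def)
  note Mi = gseq_idl[OF gM]
  have xc: "x \<in> carrier R" using x(1) idl_carr[OF Ii] by blast
  have cof: "cofin (M m)" for m
  proof (rule cofin_mono[OF cofin_prod[OF cofin_pw[OF I(1), of m] M(3)] _ Mi])
    show "pw I m \<cdot> M 0 \<subseteq> M m" using gseq_pow[OF Ii gM, of _ m _ 0] by (intro prod_le[OF Mi]) simp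
  qed
  have x1: "x \<in> pw I 1" using x pw_1[OF Ii] by simp
  define N where "N = adjoin_hom I M 1 x"
  note N = adjoin_hom[OF Ii Mg x1, folded N_def]
  have Ni: "idl (N m)" "N m \<subseteq> pw I m" for m using N(1) gseq_idl by (auto simp: graded_ideal_def)
  have step: "nlen (M (Suc m)) (pw I (Suc m)) \<le> nlen (M m) (pw I m) + nlen (N (Suc m)) (pw I (Suc m))" for m
  proof -
    have "nlen (M (Suc m)) (pw I (Suc m)) = nlen (M (Suc m)) (N (Suc m)) + nlen (N (Suc m)) (pw I (Suc m))"
      by (rule nlen_add[OF cof Ni(1) pI N(2) Ni(2)])
    moreover have "nlen (M (Suc m)) (N (Suc m)) \<le> nlen (M m) (pw I m)"
    proof (rule nlen_le[OF cof Ni(1) cof pI])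
      have "len (M (Suc m)) (N (Suc m)) = len (colon_in (M (Suc m)) x (pw I m)) (pw I m)"
        using len_mult[OF Mi pI xc, of "Suc m" m] by (simp add: N_def adjoin_hom_def)
      also have "\<dots> \<le> len (M m) (pw I m)"
      proof (rule len_mono[OF _ order_refl pI])
        show "M m \<subseteq> colon_in (M (Suc m)) x (pw I m)"
          using gseq_step[OF gM x(1), of _ m] MI[of m] by (auto simp: colon_in_def)
      qed
      finally show "len (M (Suc m)) (N (Suc m)) \<le> len (M m) (pw I m)" .
    qed
    ultimately show ?thesis by simp
  qed
  have "\<not> slow s (\<lambda>m. nlen (N m) (pw I m))"
    using slow_sum[of s "\<lambda>m. nlen (N m) (pw I m)" "\<lambda>m. nlen (M m) (pw I m)", OF _ step] M(4) by blast
  moreover have "cofin (N 0)" by (rule cofin_mono[OF M(3) N(2) Ni(1)])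
  ultimately obtain P where P: "graded_chain I (Suc s) P" "N \<le> P 0" using Suc(1)[OF N(1)] by blast
  have "M \<le> N" using N(2) by (simp add: le_fun_def)
  moreover have "M \<noteq> N" using N(3) x(2) by metis
  ultimately have "M < P 0" using P(2) by order
  hence "graded_chain I (Suc (Suc s)) (case_nat M P)" using P(1) M(1) by (intro graded_chain_cons)
  thus ?case using M(2) by (intro exI[of _ "case_nat M P"]) simp
qed

subsection \<open>Ideals with a small Rees cokernel\<close>

text \<open>Degree m of the conductor of R(K) into R(I), which is the annihilator of the cokernel
  (see \<open>rees_annihilator\<close>).\<close>

definition rees_conductor :: "'a set \<Rightarrow> 'a set \<Rightarrow> nat \<Rightarrow> 'a set" where
  "rees_conductor I K m = {a \<in> pw I m. \<forall>j. \<forall>k\<in>pw K j. a \<otimes> k \<in> pw I (m + j)}"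

lemma rees_conductor_graded:
  assumes I: "idl I" and K: "idl K" shows "graded_ideal I (rees_conductor I K)"
  unfolding graded_ideal_def
proof (intro conjI allI)
  note pI = pw_idl[OF I] and pK = pw_idl[OF K]
  note Ic = idl_carr[OF pI] and Kc = idl_carr[OF pK]
  show "rees_conductor I K m \<subseteq> pw I m" for m by (auto simp: rees_conductor_def)
  show "gseq I (rees_conductor I K)"
  proof (rule gseqI)
    show "idl (rees_conductor I K m)" for m
    proof (rule idlI)
      show "rees_conductor I K m \<subseteq> carrier R" using Ic by (auto simp: rees_conductor_def)
      show "\<zero> \<in> rees_conductor I K m" using idl_zero[OF pI] Kc by (simp add: rees_conductor_def)
      show "a \<oplus> b \<in> rees_conductor I K m" if "a \<in> rees_conductor I K m" "b \<in> rees_conductor I K m" for a b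
      proof -
        have "(a \<oplus> b) \<otimes> k = a \<otimes> k \<oplus> b \<otimes> k" if k: "k \<in> pw K j" for j k
          using \<open>a \<in> _\<close> \<open>b \<in> _\<close> Ic Kc[OF k] by (auto simp: rees_conductor_def l_distr)
        thus ?thesis using that idl_add[OF pI] by (simp add: rees_conductor_def)
      qed
      show "x \<otimes> a \<in> rees_conductor I K m" if "a \<in> rees_conductor I K m" "x \<in> carrier R" for a x
      proof -
        have "(x \<otimes> a) \<otimes> k = x \<otimes> (a \<otimes> k)" if k: "k \<in> pw K j" for j k
          using \<open>a \<in> _\<close> \<open>x \<in> _\<close> Ic Kc[OF k] by (auto simp: rees_conductor_def m_assoc)
        thus ?thesis using that idl_lmult[OF pI] by (simp add: rees_conductor_def)
      qed
    qed
    fix m b z assume b: "b \<in> I" and z: "z \<in> rees_conductor I K m"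
    have bc: "b \<in> carrier R" using b idl_carr[OF I] by blast
    have "(b \<otimes> z) \<otimes> k \<in> pw I (Suc m + j)" if k: "k \<in> pw K j" for j k
    proof -
      have "z \<otimes> k \<in> pw I (m + j)" using z k by (simp add: rees_conductor_def)
      hence "b \<otimes> (z \<otimes> k) \<in> pw I (Suc (m + j))" by (rule gseq_step[OF gseq_pw[OF I] b])
      moreover have "z \<in> carrier R" using z Ic by (auto simp: rees_conductor_def)
      ultimately show ?thesis using bc Kc[OF k] by (simp add: m_assoc)
    qed
    moreover have "b \<otimes> z \<in> pw I (Suc m)" using gseq_step[OF gseq_pw[OF I] b] z by (simp add: rees_conductor_def)
    ultimately show "b \<otimes> z \<in> rees_conductor I K (Suc m)" by (simp add: rees_conductor_def)
  qed
qed

text \<open>Otherwise the degree zero conductor lies in an associated prime of R. By depth that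
  prime starts a chain of length d in R, and contraction from R[t] makes it a chain of graded primes
  over the conductor.\<close>

lemma rees_conductor_regular:
  assumes inf: "infinite (carrier (R Quot \<mm>))" and dep: "depth_ge d {\<zero>}"
    and I: "idl I" and K: "idl K"
    and nochain: "\<And>n P. graded_chain I n P \<Longrightarrow> rees_conductor I K \<le> P 0 \<Longrightarrow> n < d"
  shows "\<exists>a\<in>rees_conductor I K 0. reg {\<zero>} a"
proof -
  let ?L = "rees_conductor I K"
  have Li: "idl (?L m)" for m using rees_conductor_graded[OF I K] gseq_idl unfolding graded_ideal_def by blast
  \<comment> \<open>From a K^j in I^(m+j) follows a K^j in I^j, so containment of the conductor in a
    prime of R is decided in degree zero.\<close>
  have L0: "?L m \<subseteq> ?L 0" for m
  proof
    fix a assume a: "a \<in> ?L m"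
    have "a \<otimes> k \<in> pw I (0 + j)" if "k \<in> pw K j" for j k
      using a that pw_antimono[OF I, of "0 + j" "m + j"] by (auto simp: rees_conductor_def)
    thus "a \<in> ?L 0" using idl_carr[OF Li a] by (simp add: rees_conductor_def)
  qed
  show ?thesis
  proof (cases "\<forall>z\<in>carrier R. (\<forall>b\<in>?L 0. b \<otimes> z \<in> {\<zero>}) \<longrightarrow> z \<in> {\<zero>}")
    case True
    obtain BB where BB: "finite BB" "\<forall>A\<in>BB. idl A \<and> A \<subset> ?L 0" "\<forall>a\<in>?L 0. a \<notin> \<Union>BB \<longrightarrow> reg {\<zero>} a"
      using generic_regular[OF Li zeroideal, of 0] True by blast
    have "\<exists>a\<in>?L 0. a \<notin> \<Union>BB" by (rule ideal_avoidance[OF inf Li BB(1) BB(2)[rule_format]])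
    thus ?thesis using BB(3) by blast
  next
    case False
    then obtain z where z: "z \<in> carrier R" "z \<notin> {\<zero>}" "\<forall>b\<in>?L 0. b \<otimes> z \<in> {\<zero>}" by blast
    obtain e where e: "e \<in> carrier R" "e \<notin> {\<zero>}" "colon_in {\<zero>} z (carrier R) \<subseteq> colon_in {\<zero>} e (carrier R)"
      "primeideal (colon_in {\<zero>} e (carrier R)) R" using ann_prime_exists[OF zeroideal z(1,2)] by blast
    obtain C where C: "prime_chain R d C" "C 0 = colon_in {\<zero>} e (carrier R)"
      using depth_prime_chain[OF zeroideal dep e(1,2,4)] by blast
    have LC: "?L 0 \<subseteq> C 0"
    proof
      fix b assume b: "b \<in> ?L 0"
      have bc: "b \<in> carrier R" by (rule idl_carr[OF Li b])
      have "z \<otimes> b = \<zero>" using z(3) b m_comm[OF z(1) bc] by simp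
      hence "b \<in> colon_in {\<zero>} z (carrier R)" using bc by (simp add: colon_in_def)
      thus "b \<in> C 0" using e(3) C(2) by blast
    qed
    define P where "P i m = C i \<inter> pw I m" for i m
    have "graded_prime I (P i)" if "i \<le> d" for i
      using graded_prime_ideal_contraction[OF I, of "C i"] C(1) that by (simp add: prime_chain_def P_def[abs_def])
    moreover have "P i < P (Suc i)" if i: "i < d" for i
    proof -
      have Ci: "C i \<subset> C (Suc i)" using C(1) i by (simp add: prime_chain_def)
      have "idl (C (Suc i))" using C(1) i by (auto simp: prime_chain_def intro!: primeideal_idl)
      hence "P i 0 \<noteq> P (Suc i) 0" using Ci idl_subset by (auto simp: P_def)
      hence "P i \<noteq> P (Suc i)" by metis
      moreover have "P i \<le> P (Suc i)" using Ci by (auto simp: P_def le_fun_def)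
      ultimately show ?thesis by simp
    qed
    ultimately have "graded_chain I d P" by (simp add: graded_chain_def)
    moreover have "?L \<le> P 0"
    proof (rule le_funI)
      fix m
      have "?L m \<subseteq> pw I m" by (auto simp: rees_conductor_def)
      thus "?L m \<subseteq> P 0 m" using L0[of m] LC by (auto simp: P_def)
    qed
    ultimately have "d < d" by (rule nochain)
    thus ?thesis by simp
  qed
qed

text \<open>With a regular conductor element a, the graded ideal a R(K) of R(I) is generated in
  bounded degree. Cancelling a shows that I is a reduction of K. Hence K is proper and I^r lies in
  the conductor, which makes \<open>growth_chain\<close> applicable; growth modulo the conductor
  bounds that of the cokernel.\<close>

lemma rees_cokernel_small:
  assumes inf: "infinite (carrier (R Quot \<mm>))" and dep: "depth_ge (Suc s) {\<zero>}"
    and I: "cofin I" "I \<subseteq> \<mm>" and K: "idl K" "I \<subseteq> K"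
    and nochain: "\<And>n P. graded_chain I n P \<Longrightarrow> rees_conductor I K \<le> P 0 \<Longrightarrow> n < Suc s"
  shows "slow s (\<lambda>m. nlen (pw I m) (pw K m))" "K \<subseteq> \<mm>"
proof -
  note Ii = cofin_idl[OF I(1)]
  note pI = pw_idl[OF Ii] and pK = pw_idl[OF K(1)]
  let ?L = "rees_conductor I K"
  have Lg: "graded_ideal I ?L" by (rule rees_conductor_graded[OF Ii K(1)])
  have LI: "?L m \<subseteq> pw I m" for m using Lg by (simp add: graded_ideal_def)
  have Li: "idl (?L m)" for m using Lg gseq_idl by (auto simp: graded_ideal_def)
  obtain a where a: "a \<in> ?L 0" "reg {\<zero>} a"
    using rees_conductor_regular[OF inf dep Ii K(1)] nochain by blast
  have ac: "a \<in> carrier R" using a reg_carr by blast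
  have "gseq I (\<lambda>j. mulset a (pw K j))"
  proof (rule gseqI)
    show "idl (mulset a (pw K m))" for m by (rule mulset_idl[OF ac pK])
    fix m b z assume b: "b \<in> I" and "z \<in> mulset a (pw K m)"
    then obtain k where k: "k \<in> pw K m" "z = a \<otimes> k" by (auto simp: mulset_def)
    have "b \<otimes> z = a \<otimes> (b \<otimes> k)" unfolding k(2) using ac idl_carr[OF Ii b] idl_carr[OF pK k(1)] by algebra
    moreover have "b \<otimes> k \<in> pw K (Suc m)" using gseq_step[OF gseq_pw[OF K(1)] _ k(1)] b K(2) by blast
    ultimately show "b \<otimes> z \<in> mulset a (pw K (Suc m))" by (simp add: mulsetI)
  qed
  moreover have "mulset a (pw K m) \<subseteq> pw I m" for m using a(1) by (auto simp: mulset_def rees_conductor_def)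
  ultimately obtain r where r: "\<And>m. m \<ge> r \<Longrightarrow> mulset a (pw K (Suc m)) = I \<cdot> mulset a (pw K m)"
    using hilbert_basis[OF Ii] by blast
  \<comment> \<open>a is a nonzerodivisor, so containments between multiples can be
    cancelled.\<close>
  have inj: "A \<subseteq> B" if AB: "mulset a A \<subseteq> mulset a B" "idl A" "idl B" for A B
  proof
    fix x assume x: "x \<in> A"
    then obtain y where y: "y \<in> B" "a \<otimes> x = a \<otimes> y" using AB(1) by (auto simp: mulset_def)
    have c: "x \<in> carrier R" "y \<in> carrier R" using x y AB idl_carr by blast+
    have "a \<otimes> (x \<ominus> y) = a \<otimes> x \<ominus> a \<otimes> y" using c ac by algebra
    hence "a \<otimes> (x \<ominus> y) \<in> {\<zero>}" unfolding y(2) using c ac by (simp add: r_neg a_minus_def)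
    hence "x \<ominus> y = \<zero>" using regD[OF a(2), of "x \<ominus> y"] c by simp
    hence "x = y" using c by simp
    thus "x \<in> B" using y by simp
  qed
  have red: "pw K (Suc m) \<subseteq> I \<cdot> pw K m" if m: "m \<ge> r" for m
  proof (rule inj[OF _ pK ideal_prod_is_ideal[OF Ii pK]])
    have "I \<cdot> mulset a (pw K m) = mulset a (pw K m) \<cdot> I" by (rule ideal_prod_commute[OF Ii mulset_idl[OF ac pK]])
    also have "\<dots> = mulset a (I \<cdot> pw K m)"
      using mulset_prod[OF pK Ii ac] ideal_prod_commute[OF Ii pK] by simp
    finally show "mulset a (pw K (Suc m)) \<subseteq> mulset a (I \<cdot> pw K m)" using r[OF m] by simp
  qed
  show "K \<subseteq> \<mm>"
  proof (rule proper_le_\<mm>[OF K(1)])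
    show "K \<noteq> carrier R"
    proof
      assume "K = carrier R"
      hence "carrier R \<subseteq> I" using red[of r] ideal_prod_one[OF Ii] by (simp add: pw_carrier)
      thus False using I(2) one_notin_\<mm> by blast
    qed
  qed
  have red': "pw K (r + j) \<subseteq> pw I j \<cdot> pw K r" for j
  proof (induct j)
    case 0 show ?case using prod_carr_l[OF pK] by simp
  next
    case (Suc j)
    have "pw K (r + Suc j) \<subseteq> I \<cdot> pw K (r + j)" using red[of "r + j"] by simp
    also have "\<dots> \<subseteq> I \<cdot> (pw I j \<cdot> pw K r)" using Suc by (intro prod_mono) auto
    also have "\<dots> = pw I (Suc j) \<cdot> pw K r" using ideal_prod_assoc[OF Ii pI pK] pw_Suc2[OF Ii] by simp
    finally show ?case .
  qed
  \<comment> \<open>For j beyond r, K^j already lies in I^(j-r); for smaller j, I^r lies in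
    I^j.\<close>
  have "pw I r \<subseteq> ?L 0"
  proof
    fix x assume x: "x \<in> pw I r"
    have "x \<otimes> k \<in> pw I j" if k: "k \<in> pw K j" for j k
    proof (cases "j \<ge> r")
      case True
      have "k \<in> pw I (j - r) \<cdot> pw K r" using red'[of "j - r"] k True by auto
      hence "k \<in> pw I (j - r)" using prod_subset1[OF pI pK] by blast
      hence "x \<otimes> k \<in> pw I r \<cdot> pw I (j - r)" using x by (intro prodI)
      thus ?thesis using pw_add[OF Ii, of r "j - r"] True by simp
    next
      case False
      hence "x \<in> pw I j" using x pw_antimono[OF Ii, of j r] by auto
      thus ?thesis using idl_rmult[OF pI] idl_carr[OF pK k] by blast
    qed
    thus "x \<in> ?L 0" using idl_carr[OF pI x] by (simp add: rees_conductor_def)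
  qed
  hence cL: "cofin (?L 0)" by (rule cofin_mono[OF cofin_pw[OF I(1)] _ Li])
  have cLm: "cofin (?L m)" for m
  proof (rule cofin_mono[OF cofin_prod[OF cofin_pw[OF I(1), of m] cL] _ Li])
    show "pw I m \<cdot> ?L 0 \<subseteq> ?L m" using Lg gseq_pow[OF Ii, of ?L _ m _ 0]
      by (intro prod_le[OF Li]) (simp add: graded_ideal_def)
  qed
  have sL: "slow s (\<lambda>m. nlen (?L m) (pw I m))"
    using growth_chain[OF I Lg cL, of s] nochain by blast
  obtain S where S: "S \<subseteq> carrier R" "finite S" "pw K r = Idl S" using fin_gen[OF pK] by blast
  \<comment> \<open>K^m = I^m + K^r I^(m-r), and the conductor in degree m - r sends K^r into I^m.
    So K^m/I^m is covered by one copy of I^(m-r) modulo the conductor per generator of K^r.\<close>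
  have "nlen (pw I m) (pw K m) \<le> card S * nlen (?L (m - r)) (pw I (m - r))" if m: "m \<ge> r" for m
  proof -
    let ?X = "pw I (m - r)" and ?Y = "?L (m - r)"
    have IK: "pw I m \<subseteq> pw K m" by (rule pw_mono[OF K(2)])
    have "pw K r \<cdot> ?Y \<subseteq> pw I m"
    proof (rule prod_le[OF pI])
      fix k y assume k: "k \<in> pw K r" and y: "y \<in> ?Y"
      have "y \<otimes> k \<in> pw I (m - r + r)" using k y by (simp add: rees_conductor_def)
      thus "k \<otimes> y \<in> pw I m" using m m_comm[OF idl_carr[OF pK k] idl_carr[OF Li y]] by simp
    qed
    hence "len (pw I m) (pw I m \<boxplus> (Idl S) \<cdot> ?X) \<le> of_nat (card S) * len ?Y ?X"
      by (intro len_gens[OF S(2,1) pI Li pI LI]) (simp add: S(3)[symmetric])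
    moreover have "pw K m = pw I m \<boxplus> (Idl S) \<cdot> ?X"
    proof (rule subset_antisym)
      have p: "idl (pw K r \<cdot> ?X)" by (rule ideal_prod_is_ideal[OF pK pI])
      have "pw K m \<subseteq> ?X \<cdot> pw K r" using red'[of "m - r"] m by simp
      thus "pw K m \<subseteq> pw I m \<boxplus> (Idl S) \<cdot> ?X"
        using sum_ub2[OF pI p] ideal_prod_commute[OF pI pK] unfolding S(3)[symmetric] by auto
      have "pw K r \<cdot> ?X \<subseteq> pw K r \<cdot> pw K (m - r)" by (rule prod_mono[OF order_refl pw_mono[OF K(2)]])
      also have "\<dots> = pw K m" using pw_add[OF K(1), of r "m - r"] m by simp
      finally show "pw I m \<boxplus> (Idl S) \<cdot> ?X \<subseteq> pw K m" unfolding S(3)[symmetric] using IK by (intro sum_le pK)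
    qed
    ultimately have "len (pw I m) (pw K m) \<le> of_nat (card S) * len ?Y ?X" by simp
    hence "enat (nlen (pw I m) (pw K m)) \<le> enat (card S * nlen ?Y ?X)"
      by (simp add: enat_nlen[OF cofin_pw[OF I(1)] pK] enat_nlen[OF cLm pI, symmetric] of_nat_eq_enat)
    thus ?thesis by simp
  qed
  from slow_mono[OF slow_shift[OF sL] this] show "slow s (\<lambda>m. nlen (pw I m) (pw K m))" .
qed

end

context cring
begin

subsection \<open>Krull dimension of a quotient\<close>

lemma quot_image_mem:
  assumes "idl a" "idl P" "a \<subseteq> P" "x \<in> carrier R"
  shows "a +> x \<in> (+>) a ` P \<longleftrightarrow> x \<in> P"
proof
  interpret a: ideal a R by fact
  assume "a +> x \<in> (+>) a ` P"
  then obtain y where y: "y \<in> P" "a +> x = a +> y" by auto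
  have "x \<in> a +> y" using a.a_rcos_self[OF assms(4)] y by simp
  then obtain k where "k \<in> a" "x = k \<oplus> y" by (auto simp: a_r_coset_def')
  thus "x \<in> P" using assms y idl_add by blast
qed simp

lemma primeideal_quot_image:
  assumes a: "idl a" and P: "primeideal P R" "a \<subseteq> P"
  shows "primeideal ((+>) a ` P) (R Quot a)"
proof (rule primeidealI)
  interpret a: ideal a R by fact
  have Pi: "idl P" by (rule primeideal.axioms(1)[OF P(1)])
  note mem = quot_image_mem[OF a Pi P(2)]
  show "ideal ((+>) a ` P) (R Quot a)" by (rule ring_ideal_imp_quot_ideal[OF a Pi])
  show "cring (R Quot a)" by (rule a.quotient_is_cring[OF cring_axioms])
  have nP: "\<one> \<notin> P" using idl_one_eq[OF Pi] primeideal.I_notcarr[OF P(1)] by auto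
  have "a +> \<one> \<in> carrier (R Quot a)" by (auto simp: FactRing_def A_RCOSETS_def')
  thus "carrier (R Quot a) \<noteq> (+>) a ` P" using mem[OF one_closed] nP by blast
  fix X Y assume X: "X \<in> carrier (R Quot a)" and Y: "Y \<in> carrier (R Quot a)"
    and XY: "X \<otimes>\<^bsub>R Quot a\<^esub> Y \<in> (+>) a ` P"
  obtain x where x: "x \<in> carrier R" "X = a +> x" using X by (auto simp: FactRing_def A_RCOSETS_def')
  obtain y where y: "y \<in> carrier R" "Y = a +> y" using Y by (auto simp: FactRing_def A_RCOSETS_def')
  have "a +> (x \<otimes> y) \<in> (+>) a ` P" using XY a.rcoset_mult_add[OF x(1) y(1)] by (simp add: FactRing_def x y)
  hence "x \<otimes> y \<in> P" using mem x y by simp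
  hence "x \<in> P \<or> y \<in> P" using primeideal.I_prime[OF P(1) x(1) y(1)] by blast
  thus "X \<in> (+>) a ` P \<or> Y \<in> (+>) a ` P" using x y by auto
qed

text \<open>Chains of primes of the quotient are the chains of R over a; only the bottom prime has
  to be checked.\<close>

lemma krull_dim_quot_le:
  assumes a: "idl a"
  shows "krull_dim (R Quot a) \<le> x \<longleftrightarrow> (\<forall>n P. prime_chain R n P \<longrightarrow> a \<subseteq> P 0 \<longrightarrow> ereal (real n) \<le> x)"
proof (intro iffI allI impI)
  interpret a: ideal a R by fact
  fix n P assume d: "krull_dim (R Quot a) \<le> x" and P: "prime_chain R n P" "a \<subseteq> P 0"
  have Pp: "primeideal (P i) R" if "i \<le> n" for i using P(1) that by (simp add: prime_chain_def)
  have mono: "P i \<subset> P (Suc i)" if "i < n" for i using P(1) that by (simp add: prime_chain_def)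
  have aP: "a \<subseteq> P i" if "i \<le> n" for i
    using that
  proof (induct i)
    case (Suc i) thus ?case using mono[of i] by auto
  qed (rule P(2))
  have "prime_chain (R Quot a) n (\<lambda>i. (+>) a ` P i)"
    unfolding prime_chain_def
  proof (intro conjI allI impI)
    show "primeideal ((+>) a ` P i) (R Quot a)" if "i \<le> n" for i
      by (rule primeideal_quot_image[OF a Pp[OF that] aP[OF that]])
    show "(+>) a ` P i \<subset> (+>) a ` P (Suc i)" if i: "i < n" for i
    proof -
      obtain z where z: "z \<in> P (Suc i)" "z \<notin> P i" using mono[OF i] by blast
      have Pi: "idl (P i)" "idl (P (Suc i))" using Pp i by (auto intro!: primeideal.axioms(1))
      have "a +> z \<notin> (+>) a ` P i" using quot_image_mem[OF a Pi(1) aP] z idl_carr[OF Pi(2)] i by simp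
      moreover have "a +> z \<in> (+>) a ` P (Suc i)" using z by simp
      moreover have "(+>) a ` P i \<subseteq> (+>) a ` P (Suc i)" using mono[OF i] by (intro image_mono) simp
      ultimately show ?thesis by blast
    qed
  qed
  thus "ereal (real n) \<le> x" using prime_chain_krull_dim d order_trans by blast
next
  interpret a: ideal a R by fact
  assume h: "\<forall>n P. prime_chain R n P \<longrightarrow> a \<subseteq> P 0 \<longrightarrow> ereal (real n) \<le> x"
  show "krull_dim (R Quot a) \<le> x"
    unfolding krull_dim_def
  proof (rule Sup_least)
    fix z assume "z \<in> {ereal (real n) | n. \<exists>P. (\<forall>i\<le>n. primeideal (P i) (R Quot a)) \<and> (\<forall>i<n. P i \<subset> P (Suc i))}"
    then obtain n P where z: "z = ereal (real n)" and P: "\<And>i. i \<le> n \<Longrightarrow> primeideal (P i) (R Quot a)"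
      "\<And>i. i < n \<Longrightarrow> P i \<subset> P (Suc i)" by blast
    define Q where "Q i = {r \<in> carrier R. a +> r \<in> P i}" for i
    have car: "P i \<subseteq> carrier (R Quot a)" if "i \<le> n" for i
      using P(1)[OF that] by (simp add: primeideal_def ideal_def additive_subgroup.a_subset)
    have "prime_chain R n Q" unfolding prime_chain_def
    proof (intro conjI allI impI)
      show "primeideal (Q i) R" if "i \<le> n" for i
        unfolding Q_def by (rule ring_hom_ring.primeideal_vimage[OF a.rcos_ring_hom_ring cring_axioms P(1)[OF that]])
      show "Q i \<subset> Q (Suc i)" if i: "i < n" for i
      proof -
        obtain X where X: "X \<in> P (Suc i)" "X \<notin> P i" using P(2)[OF i] by blast
        then obtain r where r: "r \<in> carrier R" "X = a +> r"
          using car[of "Suc i"] i by (auto simp: FactRing_def A_RCOSETS_def')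
        have "r \<in> Q (Suc i)" "r \<notin> Q i" using X r by (auto simp: Q_def)
        moreover have "Q i \<subseteq> Q (Suc i)" using P(2)[OF i] by (auto simp: Q_def)
        ultimately show ?thesis by blast
      qed
    qed
    moreover have "a \<subseteq> Q 0"
    proof
      fix k assume k: "k \<in> a"
      have "a \<in> P 0" using P(1)[of 0] additive_subgroup.zero_closed[of "P 0" "R Quot a"]
        by (simp add: primeideal_def ideal_def FactRing_def)
      thus "k \<in> Q 0" using k a.a_rcos_const[OF k] idl_carr[OF a k] by (simp add: Q_def)
    qed
    ultimately show "z \<le> x" using h z by blast
  qed
qed

lemma finsum_idl: "idl J \<Longrightarrow> finite A \<Longrightarrow> (\<And>i. i \<in> A \<Longrightarrow> f i \<in> J) \<Longrightarrow> finsum R f A \<in> J"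
proof -
  assume J: "idl J" and A: "finite A" and f: "\<And>i. i \<in> A \<Longrightarrow> f i \<in> J"
  show "finsum R f A \<in> J" using A f
  proof (induct A)
    case empty thus ?case by (simp add: idl_zero J)
  next
    case (insert x A)
    have "f x \<in> carrier R" "f \<in> A \<rightarrow> carrier R" using insert idl_carr[OF J] by auto
    thus ?case using insert idl_add[OF J] by (simp add: finsum_insert)
  qed
qed

end

subsection \<open>Rees algebras\<close>

context noetherian_local_ring
begin

interpretation U: UP_cring R "UP R"
  by unfold_locales simp_all

abbreviation cf :: "(nat \<Rightarrow> 'a) \<Rightarrow> nat \<Rightarrow> 'a" where "cf \<equiv> coeff (UP R)"

lemma rees_carrier: "p \<in> carrier (rees_algebra R K) \<longleftrightarrow> p \<in> carrier (UP R) \<and> (\<forall>m. cf p m \<in> pw K m)"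
  by (simp add: rees_algebra_def pw_def)

lemma rees_ops:
  "monoid.mult (rees_algebra R K) = monoid.mult (UP R)" "one (rees_algebra R K) = one (UP R)"
  "add (rees_algebra R K) = add (UP R)" "zero (rees_algebra R K) = zero (UP R)"
  by (simp_all add: rees_algebra_def)

lemma cf_mult_mem:
  assumes "p \<in> carrier (UP R)" "q \<in> carrier (UP R)" "idl J" "\<And>i. i \<le> n \<Longrightarrow> cf p i \<otimes> cf q (n - i) \<in> J"
  shows "cf (p \<otimes>\<^bsub>UP R\<^esub> q) n \<in> J"
  unfolding U.coeff_mult[OF assms(1,2)] using assms(4) by (intro finsum_idl[OF assms(3)]) auto

lemma rees_cring:
  assumes K: "idl K" shows "cring (rees_algebra R K)"
proof -
  let ?H = "carrier (rees_algebra R K)"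
  note pK = pw_idl[OF K]
  have sub: "?H \<subseteq> carrier (UP R)" by (auto simp: rees_carrier)
  have "subring ?H (UP R)"
  proof (rule U.P.subringI[OF sub])
    show "\<one>\<^bsub>UP R\<^esub> \<in> ?H" using idl_zero[OF pK] by (auto simp: rees_carrier)
    show "\<ominus>\<^bsub>UP R\<^esub> p \<in> ?H" if "p \<in> ?H" for p using that idl_neg[OF pK] by (auto simp: rees_carrier)
    show "p \<oplus>\<^bsub>UP R\<^esub> q \<in> ?H" if "p \<in> ?H" "q \<in> ?H" for p q using that idl_add[OF pK] by (auto simp: rees_carrier)
    show "p \<otimes>\<^bsub>UP R\<^esub> q \<in> ?H" if pq: "p \<in> ?H" "q \<in> ?H" for p q
    proof -
      have "cf (p \<otimes>\<^bsub>UP R\<^esub> q) n \<in> pw K n" for n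
      proof (rule cf_mult_mem[OF _ _ pK])
        show "cf p i \<otimes> cf q (n - i) \<in> pw K n" if "i \<le> n" for i
          using prodI[of "cf p i" "pw K i" "cf q (n - i)" "pw K (n - i)"] pw_add[OF K, of i "n - i"] pq that
          by (simp add: rees_carrier)
      qed (use pq in \<open>auto simp: rees_carrier\<close>)
      thus ?thesis using pq by (simp add: rees_carrier)
    qed
  qed
  hence "subcring ?H (UP R)" by (rule U.P.subcringI')
  hence "cring ((UP R)\<lparr>carrier := ?H\<rparr>)" using U.P.subcring_iff[OF sub] by blast
  moreover have "(UP R)\<lparr>carrier := ?H\<rparr> = rees_algebra R K" by (simp add: rees_algebra_def)
  ultimately show ?thesis by simp
qed

lemma monom_rees: "idl K \<Longrightarrow> k \<in> pw K j \<Longrightarrow> monom (UP R) k j \<in> carrier (rees_algebra R K)"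
  using idl_carr[OF pw_idl, of K k j] idl_zero[OF pw_idl, of K] by (auto simp: rees_carrier)

lemma rees_annihilator:
  assumes I: "idl I" and K: "idl K" "I \<subseteq> K"
  shows "annihilator (rees_algebra R I) (rees_cokernel R I K) =
    {p \<in> carrier (rees_algebra R I). \<forall>m. cf p m \<in> rees_conductor I K m}" (is "?ann = _")
proof -
  let ?A = "rees_algebra R I" and ?B = "rees_algebra R K"
  let ?N = "carrier ?A"
  interpret A: cring ?A by (rule rees_cring[OF I])
  interpret B: cring ?B by (rule rees_cring[OF K(1)])
  note pI = pw_idl[OF I] and pK = pw_idl[OF K(1)]
  have NB: "?N \<subseteq> carrier ?B" using subsetD[OF pw_mono[OF K(2)]] by (auto simp: rees_carrier)
  have ops: "monoid.mult ?B = monoid.mult ?A" "add ?B = add ?A" "zero ?B = zero ?A" by (simp_all add: rees_ops)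
  have cos: "?N +>\<^bsub>?B\<^esub> y = {n \<oplus>\<^bsub>?A\<^esub> y | n. n \<in> ?N}" for y by (auto simp: a_r_coset_def' ops)
  have Nc: "?N +>\<^bsub>?B\<^esub> y = ?N" if y: "y \<in> ?N" for y
  proof
    show "?N +>\<^bsub>?B\<^esub> y \<subseteq> ?N" using y by (auto simp: cos)
    show "?N \<subseteq> ?N +>\<^bsub>?B\<^esub> y"
    proof
      fix z assume z: "z \<in> ?N"
      have "z = (z \<ominus>\<^bsub>?A\<^esub> y) \<oplus>\<^bsub>?A\<^esub> y" using z y by algebra
      thus "z \<in> ?N +>\<^bsub>?B\<^esub> y" using z y by (auto simp: cos)
    qed
  qed
  have car: "carrier (rees_cokernel R I K) = {?N +>\<^bsub>?B\<^esub> q | q. q \<in> carrier ?B}"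
    unfolding rees_cokernel_def quot_module_def B.self_module_simps by (auto simp: A_RCOSETS_def')
  have sm: "p \<odot>\<^bsub>rees_cokernel R I K\<^esub> X = (\<Union>x\<in>X. ?N +>\<^bsub>?B\<^esub> (p \<otimes>\<^bsub>?A\<^esub> x))" for p X
    by (simp add: rees_cokernel_def quot_module_def B.self_module_simps ops)
  have z: "\<zero>\<^bsub>rees_cokernel R I K\<^esub> = ?N" by (simp add: rees_cokernel_def quot_module_def)
  have self: "q \<in> ?N +>\<^bsub>?B\<^esub> q" if q: "q \<in> carrier ?B" for q
  proof -
    have "q = \<zero>\<^bsub>?A\<^esub> \<oplus>\<^bsub>?A\<^esub> q" using B.l_zero[OF q] by (simp add: ops)
    thus ?thesis using A.zero_closed unfolding cos by blast
  qed
  have ann1: "p \<in> ?ann \<longleftrightarrow> p \<in> ?N \<and> (\<forall>q\<in>carrier ?B. p \<otimes>\<^bsub>?A\<^esub> q \<in> ?N)" for p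
  proof (cases "p \<in> ?N")
    case p: True
    \<comment> \<open>Scalar multiplication on the cokernel is a union of cosets; it collapses to
      the zero class exactly when p q has coefficients in the powers of I.\<close>
    have "(\<Union>x\<in>?N +>\<^bsub>?B\<^esub> q. ?N +>\<^bsub>?B\<^esub> (p \<otimes>\<^bsub>?A\<^esub> x)) = ?N \<longleftrightarrow> p \<otimes>\<^bsub>?A\<^esub> q \<in> ?N" if q: "q \<in> carrier ?B" for q
    proof
      assume h: "(\<Union>x\<in>?N +>\<^bsub>?B\<^esub> q. ?N +>\<^bsub>?B\<^esub> (p \<otimes>\<^bsub>?A\<^esub> x)) = ?N"
      have "p \<otimes>\<^bsub>?A\<^esub> q \<in> carrier ?B" using B.m_closed[of p q] p q NB by (auto simp: ops)
      hence "p \<otimes>\<^bsub>?A\<^esub> q \<in> ?N +>\<^bsub>?B\<^esub> (p \<otimes>\<^bsub>?A\<^esub> q)" by (rule self)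
      thus "p \<otimes>\<^bsub>?A\<^esub> q \<in> ?N" using h self[OF q] by blast
    next
      assume h: "p \<otimes>\<^bsub>?A\<^esub> q \<in> ?N"
      have "?N +>\<^bsub>?B\<^esub> (p \<otimes>\<^bsub>?A\<^esub> x) = ?N" if "x \<in> ?N +>\<^bsub>?B\<^esub> q" for x
      proof (rule Nc)
        obtain n where n: "n \<in> ?N" "x = n \<oplus>\<^bsub>?A\<^esub> q" using \<open>x \<in> _\<close> by (auto simp: cos)
        have "p \<otimes>\<^bsub>?A\<^esub> x = p \<otimes>\<^bsub>?A\<^esub> n \<oplus>\<^bsub>?A\<^esub> p \<otimes>\<^bsub>?A\<^esub> q"
          unfolding n(2) using B.r_distr[of n q p] n(1) p q NB by (auto simp: ops)
        thus "p \<otimes>\<^bsub>?A\<^esub> x \<in> ?N" using h n(1) p by simp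
      qed
      thus "(\<Union>x\<in>?N +>\<^bsub>?B\<^esub> q. ?N +>\<^bsub>?B\<^esub> (p \<otimes>\<^bsub>?A\<^esub> x)) = ?N" using self[OF q] by blast
    qed
    thus ?thesis using p unfolding annihilator_def car sm z by blast
  qed (auto simp: annihilator_def)
  have ann2: "(\<forall>q\<in>carrier ?B. p \<otimes>\<^bsub>?A\<^esub> q \<in> ?N) \<longleftrightarrow> (\<forall>m. cf p m \<in> rees_conductor I K m)" if p: "p \<in> ?N" for p
  proof
    have pU: "p \<in> carrier (UP R)" and pc: "\<And>m. cf p m \<in> pw I m" using p by (auto simp: rees_carrier)
    assume h: "\<forall>q\<in>carrier ?B. p \<otimes>\<^bsub>?A\<^esub> q \<in> ?N"
    show "\<forall>m. cf p m \<in> rees_conductor I K m"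
    proof
      fix m
      have "cf p m \<otimes> k \<in> pw I (m + j)" if k: "k \<in> pw K j" for j k
      proof -
        have kc: "k \<in> carrier R" using k idl_carr[OF pK] by blast
        \<comment> \<open>Multiplying by a monomial k t^j isolates a single coefficient of
          p.\<close>
        have "p \<otimes>\<^bsub>UP R\<^esub> monom (UP R) k j \<in> ?N" using h monom_rees[OF K(1) k] by (simp add: rees_ops)
        hence "cf (p \<otimes>\<^bsub>UP R\<^esub> monom (UP R) k j) (m + j) \<in> pw I (m + j)" by (simp add: rees_carrier del: U.coeff_mult)
        moreover have "cf (p \<otimes>\<^bsub>UP R\<^esub> monom (UP R) k j) (m + j) = k \<otimes> cf p m"
          using U.coeff_monom_mult[OF kc pU, of j m] U.P.m_comm[OF pU U.monom_closed[OF kc]]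
          by (simp add: add.commute del: U.coeff_mult)
        ultimately show ?thesis using m_comm kc idl_carr[OF pI pc] by simp
      qed
      thus "cf p m \<in> rees_conductor I K m" using pc by (simp add: rees_conductor_def)
    qed
  next
    have pU: "p \<in> carrier (UP R)" using p by (auto simp: rees_carrier)
    assume h: "\<forall>m. cf p m \<in> rees_conductor I K m"
    show "\<forall>q\<in>carrier ?B. p \<otimes>\<^bsub>?A\<^esub> q \<in> ?N"
    proof
      fix q assume "q \<in> carrier ?B"
      hence qU: "q \<in> carrier (UP R)" and qc: "\<And>m. cf q m \<in> pw K m" by (auto simp: rees_carrier)
      have "cf (p \<otimes>\<^bsub>UP R\<^esub> q) n \<in> pw I n" for n
      proof (rule cf_mult_mem[OF pU qU pI])
        fix i assume i: "i \<le> n"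
        have "cf p i \<otimes> cf q (n - i) \<in> pw I (i + (n - i))" using h qc by (simp add: rees_conductor_def)
        thus "cf p i \<otimes> cf q (n - i) \<in> pw I n" using i by simp
      qed
      thus "p \<otimes>\<^bsub>?A\<^esub> q \<in> ?N" using pU qU by (simp add: rees_carrier rees_ops)
    qed
  qed
  show ?thesis using ann1 ann2 by blast
qed

definition rees_ideal :: "'a set \<Rightarrow> (nat \<Rightarrow> 'a set) \<Rightarrow> (nat \<Rightarrow> 'a) set" where
  "rees_ideal I Q = {p \<in> carrier (rees_algebra R I). \<forall>m. cf p m \<in> Q m}"

lemma rees_ideal_idl:
  assumes I: "idl I" and Q: "graded_ideal I Q"
  shows "ideal (rees_ideal I Q) (rees_algebra R I)"
proof -
  let ?A = "rees_algebra R I"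
  interpret A: cring ?A by (rule rees_cring[OF I])
  have gQ: "gseq I Q" and QI: "\<And>m. Q m \<subseteq> pw I m" using Q by (auto simp: graded_ideal_def)
  note Qi = gseq_idl[OF gQ]
  show ?thesis
  proof (rule A.idlI)
    show "rees_ideal I Q \<subseteq> carrier ?A" by (auto simp: rees_ideal_def)
    show "\<zero>\<^bsub>?A\<^esub> \<in> rees_ideal I Q" using idl_zero[OF Qi] A.zero_closed by (simp add: rees_ideal_def rees_ops)
    show "p \<oplus>\<^bsub>?A\<^esub> q \<in> rees_ideal I Q" if "p \<in> rees_ideal I Q" "q \<in> rees_ideal I Q" for p q
      using that A.a_closed[of p q] idl_add[OF Qi] by (simp add: rees_ideal_def rees_ops rees_carrier)
    show "q \<otimes>\<^bsub>?A\<^esub> p \<in> rees_ideal I Q" if p: "p \<in> rees_ideal I Q" and q: "q \<in> carrier ?A" for p q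
    proof -
      have "cf (q \<otimes>\<^bsub>UP R\<^esub> p) n \<in> Q n" for n
      proof (rule cf_mult_mem[OF _ _ Qi])
        fix i assume i: "i \<le> n"
        have "cf q i \<otimes> cf p (n - i) \<in> Q (n - i + i)"
          using p q by (intro gseq_pow[OF I gQ]) (auto simp: rees_ideal_def rees_carrier)
        thus "cf q i \<otimes> cf p (n - i) \<in> Q n" using i by simp
      qed (use p q in \<open>auto simp: rees_ideal_def rees_carrier\<close>)
      moreover have "q \<otimes>\<^bsub>?A\<^esub> p \<in> carrier ?A" using p q by (auto simp: rees_ideal_def)
      ultimately show ?thesis by (simp add: rees_ideal_def rees_ops)
    qed
  qed
qed

text \<open>If p and q are both outside, take the lowest degrees i and j with a coefficient outside
  Q. Every other summand of coefficient i + j of p q lies in Q, so the product of the two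
  coefficients does as well.\<close>

lemma rees_ideal_prime:
  assumes I: "idl I" and Q: "graded_prime I Q"
  shows "primeideal (rees_ideal I Q) (rees_algebra R I)"
proof (rule primeidealI)
  let ?A = "rees_algebra R I"
  interpret A: cring ?A by (rule rees_cring[OF I])
  have Qg: "graded_ideal I Q" using Q by (simp add: graded_prime_def)
  have gQ: "gseq I Q" and QI: "\<And>m. Q m \<subseteq> pw I m" using Qg by (auto simp: graded_ideal_def)
  note Qi = gseq_idl[OF gQ]
  show "ideal (rees_ideal I Q) ?A" by (rule rees_ideal_idl[OF I Qg])
  show "cring ?A" by (rule A.cring_axioms)
  have "\<one>\<^bsub>?A\<^esub> \<notin> rees_ideal I Q"
  proof
    assume "\<one>\<^bsub>?A\<^esub> \<in> rees_ideal I Q"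
    hence "cf \<one>\<^bsub>UP R\<^esub> 0 \<in> Q 0" by (simp add: rees_ideal_def rees_ops del: U.coeff_one)
    thus False using Q by (simp add: graded_prime_def)
  qed
  thus "carrier ?A \<noteq> rees_ideal I Q" using A.one_closed by metis
  fix p q assume p: "p \<in> carrier ?A" and q: "q \<in> carrier ?A" and pq: "p \<otimes>\<^bsub>?A\<^esub> q \<in> rees_ideal I Q"
  show "p \<in> rees_ideal I Q \<or> q \<in> rees_ideal I Q"
  proof (rule ccontr)
    assume "\<not> ?thesis"
    hence np: "\<exists>m. cf p m \<notin> Q m" and nq: "\<exists>m. cf q m \<notin> Q m" using p q by (auto simp: rees_ideal_def)
    define i where "i = (LEAST m. cf p m \<notin> Q m)"
    define j where "j = (LEAST m. cf q m \<notin> Q m)"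
    have i: "cf p i \<notin> Q i" "\<And>k. k < i \<Longrightarrow> cf p k \<in> Q k"
      using LeastI_ex[OF np] not_less_Least unfolding i_def by blast+
    have j: "cf q j \<notin> Q j" "\<And>k. k < j \<Longrightarrow> cf q k \<in> Q k"
      using LeastI_ex[OF nq] not_less_Least unfolding j_def by blast+
    have U: "p \<in> carrier (UP R)" "q \<in> carrier (UP R)" and mem: "\<And>m. cf p m \<in> pw I m" "\<And>m. cf q m \<in> pw I m"
      using p q by (auto simp: rees_carrier)
    have c: "cf p m \<in> carrier R" "cf q m \<in> carrier R" for m using U by simp_all
    let ?f = "\<lambda>k. cf p k \<otimes> cf q (i + j - k)"
    have trm: "?f k \<in> Q (i + j)" if k: "k \<in> {..i + j} - {i}" for k
    proof (cases "k < i")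
      case True
      have "cf q (i + j - k) \<otimes> cf p k \<in> Q (k + (i + j - k))"
        by (rule gseq_pow[OF I gQ mem(2) i(2)[OF True]])
      thus ?thesis using True m_comm[OF c(1) c(2)] by simp
    next
      case False
      hence ik: "i < k" "k \<le> i + j" using k by auto
      have "cf p k \<otimes> cf q (i + j - k) \<in> Q (i + j - k + k)"
        using ik by (intro gseq_pow[OF I gQ mem(1)] j(2)) simp
      thus ?thesis using ik by simp
    qed
    have rest: "(\<Oplus>k\<in>{..i + j} - {i}. ?f k) \<in> Q (i + j)" by (rule finsum_idl[OF Qi]) (use trm in auto)
    have "cf (p \<otimes>\<^bsub>UP R\<^esub> q) (i + j) = (\<Oplus>k\<in>insert i ({..i + j} - {i}). ?f k)"
      using U by (simp add: U.coeff_mult insert_absorb)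
    also have "\<dots> = ?f i \<oplus> (\<Oplus>k\<in>{..i + j} - {i}. ?f k)" using c by (intro finsum_insert) auto
    finally have "cf (p \<otimes>\<^bsub>UP R\<^esub> q) (i + j) = ?f i \<oplus> (\<Oplus>k\<in>{..i + j} - {i}. ?f k)" .
    moreover have "cf (p \<otimes>\<^bsub>UP R\<^esub> q) (i + j) \<in> Q (i + j)" using pq by (simp add: rees_ideal_def rees_ops del: U.coeff_mult)
    ultimately have "?f i \<in> Q (i + j)" using idl_cancel_add[OF Qi _ rest, of "?f i"] c by simp
    hence "cf p i \<otimes> cf q j \<in> Q (i + j)" by simp
    thus False using Q mem i(1) j(1) unfolding graded_prime_def by blast
  qed
qed

lemma graded_chain_rees:
  assumes I: "idl I" and P: "graded_chain I n P"
  shows "prime_chain (rees_algebra R I) n (\<lambda>i. rees_ideal I (P i))"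
  unfolding prime_chain_def
proof (intro conjI allI impI)
  show "primeideal (rees_ideal I (P i)) (rees_algebra R I)" if "i \<le> n" for i
    using P that by (intro rees_ideal_prime[OF I]) (simp add: graded_chain_def)
  show "rees_ideal I (P i) \<subset> rees_ideal I (P (Suc i))" if i: "i < n" for i
  proof -
    have lt: "P i < P (Suc i)" using P i by (simp add: graded_chain_def)
    have le: "P i m \<subseteq> P (Suc i) m" for m using lt by (simp add: less_fun_def le_fun_def)
    obtain m where m: "\<not> P (Suc i) m \<subseteq> P i m" using lt by (auto simp: less_fun_def le_fun_def)
    then obtain a where a: "a \<in> P (Suc i) m" "a \<notin> P i m" by blast
    have g: "graded_ideal I (P (Suc i))" using P i by (simp add: graded_chain_def graded_prime_def)
    hence aI: "a \<in> pw I m" using a by (auto simp: graded_ideal_def)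
    have ac: "a \<in> carrier R" using aI idl_carr[OF pw_idl[OF I]] by blast
    have "idl (P (Suc i) k)" for k using g gseq_idl by (auto simp: graded_ideal_def)
    hence "monom (UP R) a m \<in> rees_ideal I (P (Suc i))"
      using monom_rees[OF I aI] a ac idl_zero by (auto simp: rees_ideal_def)
    moreover have "monom (UP R) a m \<notin> rees_ideal I (P i)"
    proof
      assume "monom (UP R) a m \<in> rees_ideal I (P i)"
      hence "cf (monom (UP R) a m) m \<in> P i m" by (simp add: rees_ideal_def del: U.coeff_monom)
      thus False using a ac by simp
    qed
    moreover have "rees_ideal I (P i) \<subseteq> rees_ideal I (P (Suc i))" using le by (auto simp: rees_ideal_def)
    ultimately show ?thesis by blast
  qed
qed

subsection \<open>Existence of the check ideal\<close>

definition admissible :: "ereal \<Rightarrow> 'a set \<Rightarrow> 'a set \<Rightarrow> bool" where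
  "admissible x I K \<longleftrightarrow> idl K \<and> I \<subseteq> K \<and> module_dim (rees_algebra R I) (rees_cokernel R I K) \<le> x"

lemma admissible_iff:
  assumes I: "idl I" and K: "idl K" "I \<subseteq> K"
  shows "admissible x I K \<longleftrightarrow> (\<forall>n P. prime_chain (rees_algebra R I) n P \<longrightarrow>
    rees_ideal I (rees_conductor I K) \<subseteq> P 0 \<longrightarrow> ereal (real n) \<le> x)"
proof -
  have e: "annihilator (rees_algebra R I) (rees_cokernel R I K) = rees_ideal I (rees_conductor I K)"
    using rees_annihilator[OF I K] by (simp add: rees_ideal_def)
  show ?thesis unfolding admissible_def module_dim_def e
    using cring.krull_dim_quot_le[OF rees_cring[OF I] rees_ideal_idl[OF I rees_conductor_graded[OF I K(1)]]] K
    by simp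
qed

lemma admissible_no_chain:
  assumes I: "idl I" and K: "admissible x I K" and P: "graded_chain I n P" "rees_conductor I K \<le> P 0"
  shows "ereal (real n) \<le> x"
proof -
  have K': "idl K" "I \<subseteq> K" using K by (auto simp: admissible_def)
  have "rees_ideal I (rees_conductor I K) \<subseteq> rees_ideal I (P 0)" using P(2) by (auto simp: rees_ideal_def le_fun_def)
  thus ?thesis using admissible_iff[OF I K', of x] K graded_chain_rees[OF I P(1)] by blast
qed

lemma admissible_self:
  assumes I: "idl I" shows "admissible x I I"
proof -
  have "rees_ideal I (rees_conductor I I) = carrier (rees_algebra R I)"
  proof -
    have "a \<in> rees_conductor I I m" if a: "a \<in> pw I m" for a m
      using a prodI[OF a] pw_add[OF I, of m] by (simp add: rees_conductor_def)
    thus ?thesis by (auto simp: rees_ideal_def rees_carrier)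
  qed
  moreover have "\<not> carrier (rees_algebra R I) \<subseteq> P 0" if P: "prime_chain (rees_algebra R I) n P" for n P
  proof
    assume sub: "carrier (rees_algebra R I) \<subseteq> P 0"
    have p: "primeideal (P 0) (rees_algebra R I)" using P by (simp add: prime_chain_def)
    have "P 0 \<subseteq> carrier (rees_algebra R I)" by (rule cring.idl_subset[OF rees_cring[OF I] primeideal.axioms(1)[OF p]])
    thus False using sub primeideal.I_notcarr[OF p] by simp
  qed
  ultimately show ?thesis unfolding admissible_iff[OF I I order_refl] by simp
qed

text \<open>A factor k1 + k2 of a product from (K1 + K2)^l is absorbed summand by summand: k1 into
  a, k2 into b. Induction on l.\<close>

lemma conductor_prod:
  assumes I: "idl I" and K: "idl K1" "idl K2" "I \<subseteq> K1" "I \<subseteq> K2"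
  shows "a \<in> rees_conductor I K1 i \<Longrightarrow> b \<in> rees_conductor I K2 j \<Longrightarrow> a \<otimes> b \<in> rees_conductor I (K1 \<boxplus> K2) (i + j)"
proof -
  note pI = pw_idl[OF I]
  note Kc = idl_carr[OF K(1)] idl_carr[OF K(2)]
  have K12: "idl (K1 \<boxplus> K2)" using K by (simp add: add_ideals)
  have cI: "c \<in> pw I m" if "c \<in> rees_conductor I K m" for c K m using that by (simp add: rees_conductor_def)
  \<comment> \<open>Multiplying a conductor element by an element of K keeps it in the conductor,
    one degree higher.\<close>
  have shift: "c \<otimes> k \<in> rees_conductor I K (Suc m)" if c: "c \<in> rees_conductor I K m" and k: "k \<in> K" and Ki: "idl K" for c k K m
  proof -
    have kc: "k \<in> carrier R" using k Ki idl_carr by blast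
    have cc: "c \<in> carrier R" using cI[OF c] idl_carr[OF pI] by blast
    have "(c \<otimes> k) \<otimes> l \<in> pw I (Suc m + j)" if l: "l \<in> pw K j" for l j
    proof -
      have "k \<otimes> l \<in> pw K (Suc j)" by (rule gseq_step[OF gseq_pw[OF Ki] k l])
      hence "c \<otimes> (k \<otimes> l) \<in> pw I (m + Suc j)" using c unfolding rees_conductor_def by blast
      thus ?thesis using cc kc idl_carr[OF pw_idl[OF Ki] l] by (simp add: m_assoc)
    qed
    moreover have "c \<otimes> k \<in> pw I (m + 1)" using c k pw_1[OF Ki] unfolding rees_conductor_def
      by (metis (no_types, lifting) One_nat_def mem_Collect_eq)
    ultimately show ?thesis by (simp add: rees_conductor_def)
  qed
  have main: "(a \<otimes> b) \<otimes> k \<in> pw I (i + j + l)" if "a \<in> rees_conductor I K1 i" "b \<in> rees_conductor I K2 j"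
    "k \<in> pw (K1 \<boxplus> K2) l" for a b k i j l
    using that
  proof (induct l arbitrary: a b k i j)
    case 0
    have "a \<otimes> b \<in> pw I (i + j)" using 0 cI pw_add[OF I] prodI by simp
    thus ?case using 0 idl_rmult[OF pI] by simp
  next
    case (Suc l)
    have c: "a \<in> carrier R" "b \<in> carrier R" using Suc(2,3) cI idl_carr[OF pI] by blast+
    have "k \<in> (K1 \<boxplus> K2) \<cdot> pw (K1 \<boxplus> K2) l" using Suc(4) pw_Suc2[OF K12] by simp
    thus ?case
    proof induct
      case (prod u v)
      have vc: "v \<in> carrier R" using prod(2) idl_carr[OF pw_idl[OF K12]] by blast
      obtain k1 k2 where u: "k1 \<in> K1" "k2 \<in> K2" "u = k1 \<oplus> k2" using prod(1) by (auto simp: mem_sum)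
      have kc: "k1 \<in> carrier R" "k2 \<in> carrier R" using u Kc by blast+
      have "((a \<otimes> k1) \<otimes> b) \<otimes> v \<in> pw I (Suc i + j + l)"
        by (rule Suc(1)[OF shift[OF Suc(2) u(1) K(1)] Suc(3) prod(2)])
      moreover have "(a \<otimes> (b \<otimes> k2)) \<otimes> v \<in> pw I (i + Suc j + l)"
        by (rule Suc(1)[OF Suc(2) shift[OF Suc(3) u(2) K(2)] prod(2)])
      ultimately have "((a \<otimes> k1) \<otimes> b) \<otimes> v \<oplus> (a \<otimes> (b \<otimes> k2)) \<otimes> v \<in> pw I (i + j + Suc l)"
        using idl_add[OF pI] by simp
      moreover have "((a \<otimes> k1) \<otimes> b) \<otimes> v \<oplus> (a \<otimes> (b \<otimes> k2)) \<otimes> v = (a \<otimes> b) \<otimes> (u \<otimes> v)"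
        unfolding u(3) using c kc vc by algebra
      ultimately show ?case by simp
    next
      case (sum s t)
      have "s \<in> carrier R" "t \<in> carrier R"
        using sum idl_carr[OF ideal_prod_is_ideal[OF K12 pw_idl[OF K12]]] by blast+
      thus ?case using sum c idl_add[OF pI] by (simp add: r_distr)
    qed
  qed
  assume a: "a \<in> rees_conductor I K1 i" and b: "b \<in> rees_conductor I K2 j"
  show "a \<otimes> b \<in> rees_conductor I (K1 \<boxplus> K2) (i + j)"
    using main[OF a b] cI[OF a] cI[OF b] pw_add[OF I] prodI by (simp add: rees_conductor_def)
qed

text \<open>By \<open>conductor_prod\<close>, a prime over the conductor of K1 + K2 contains the
  conductor of K1 or that of K2, so its chains are bounded too.\<close>

lemma admissible_sum:
  assumes I: "idl I" and K: "admissible x I K1" "admissible x I K2"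
  shows "admissible x I (K1 \<boxplus> K2)"
proof -
  let ?A = "rees_algebra R I"
  have k: "idl K1" "idl K2" "I \<subseteq> K1" "I \<subseteq> K2" using K by (auto simp: admissible_def)
  have K12: "idl (K1 \<boxplus> K2)" "I \<subseteq> K1 \<boxplus> K2" using k add_ideals sum_ub1[OF k(1,2)] by auto
  let ?a1 = "rees_ideal I (rees_conductor I K1)" and ?a2 = "rees_ideal I (rees_conductor I K2)"
  let ?a12 = "rees_ideal I (rees_conductor I (K1 \<boxplus> K2))"
  have g12: "graded_ideal I (rees_conductor I (K1 \<boxplus> K2))" by (rule rees_conductor_graded[OF I K12(1)])
  have ci: "idl (rees_conductor I (K1 \<boxplus> K2) m)" for m using g12 gseq_idl by (auto simp: graded_ideal_def)
  interpret A: cring ?A by (rule rees_cring[OF I])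
  have prod: "p \<otimes>\<^bsub>?A\<^esub> q \<in> ?a12" if p: "p \<in> ?a1" and q: "q \<in> ?a2" for p q
  proof -
    have "cf (p \<otimes>\<^bsub>UP R\<^esub> q) n \<in> rees_conductor I (K1 \<boxplus> K2) n" for n
    proof (rule cf_mult_mem[OF _ _ ci])
      fix i assume i: "i \<le> n"
      have "cf p i \<otimes> cf q (n - i) \<in> rees_conductor I (K1 \<boxplus> K2) (i + (n - i))"
        using p q by (intro conductor_prod[OF I k]) (auto simp: rees_ideal_def)
      thus "cf p i \<otimes> cf q (n - i) \<in> rees_conductor I (K1 \<boxplus> K2) n" using i by simp
    qed (use p q in \<open>auto simp: rees_ideal_def rees_carrier\<close>)
    moreover have "p \<otimes>\<^bsub>?A\<^esub> q \<in> carrier ?A" using p q by (simp add: rees_ideal_def)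
    ultimately show ?thesis by (simp add: rees_ideal_def rees_ops)
  qed
  show ?thesis unfolding admissible_iff[OF I K12]
  proof (intro allI impI)
    fix n P assume P: "prime_chain ?A n P" "?a12 \<subseteq> P 0"
    have P0: "primeideal (P 0) ?A" using P(1) by (simp add: prime_chain_def)
    have "?a1 \<subseteq> P 0 \<or> ?a2 \<subseteq> P 0"
    proof (rule ccontr)
      assume "\<not> ?thesis"
      then obtain p q where pq: "p \<in> ?a1" "p \<notin> P 0" "q \<in> ?a2" "q \<notin> P 0" by blast
      have "p \<otimes>\<^bsub>?A\<^esub> q \<in> P 0" using prod pq P(2) by blast
      moreover have "p \<in> carrier ?A" "q \<in> carrier ?A" using pq by (auto simp: rees_ideal_def)
      ultimately show False using primeideal.I_prime[OF P0] pq by blast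
    qed
    thus "ereal (real n) \<le> x"
      using K admissible_iff[OF I k(1,3), of x] admissible_iff[OF I k(2,4), of x] P(1) by blast
  qed
qed

lemma check_ideal_admissible:
  assumes I: "idl I" shows "admissible (ereal (real d - 1)) I (check_ideal R d I)"
proof -
  let ?P = "admissible (ereal (real d - 1)) I"
  obtain K where K: "?P K" and max: "\<And>B. ?P B \<Longrightarrow> K \<subseteq> B \<Longrightarrow> B = K"
    by (rule obtain_maximal[of ?P, OF admissible_self[OF I]]) (auto simp: admissible_def)
  have Ki: "idl K" using K by (simp add: admissible_def)
  have "check_ideal R d I = K"
    unfolding check_ideal_def
  proof (rule Greatest_equality)
    show "idl K \<and> I \<subseteq> K \<and> module_dim (rees_algebra R I) (rees_cokernel R I K) \<le> ereal (real d - 1)"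
      using K by (simp add: admissible_def)
    fix B assume "idl B \<and> I \<subseteq> B \<and> module_dim (rees_algebra R I) (rees_cokernel R I B) \<le> ereal (real d - 1)"
    hence B: "?P B" by (simp add: admissible_def)
    have Bi: "idl B" using B by (simp add: admissible_def)
    have "K \<boxplus> B = K" by (rule max[OF admissible_sum[OF I K B] sum_ub1[OF Ki Bi]])
    thus "B \<subseteq> K" using sum_ub2[OF Ki Bi] by simp
  qed
  thus ?thesis using K by simp
qed

end

subsection \<open>Asymptotics of numerical polynomials\<close>

lemma ratio_lim: "(\<lambda>m. (real m + c) / real m) \<longlonglongrightarrow> 1"
proof -
  have "(\<lambda>m. 1 + c * inverse (real m)) \<longlonglongrightarrow> 1 + c * 0"
    by (intro tendsto_intros lim_inverse_n)
  moreover have "\<forall>\<^sub>F m in sequentially. 1 + c * inverse (real m) = (real m + c) / real m"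
    using eventually_gt_at_top[of 0] by eventually_elim (simp add: field_simps)
  ultimately show ?thesis using Lim_transform_eventually by fastforce
qed

lemma binomial_lim: "(\<lambda>m. real ((m + a) choose k) / real m ^ k) \<longlonglongrightarrow> 1 / fact k"
proof (induct k)
  case (Suc k)
  have "(\<lambda>m. real ((m + a) choose k) / real m ^ k * ((real m + (real a - real k)) / real m) / real (Suc k))
      \<longlonglongrightarrow> 1 / fact k * 1 / real (Suc k)"
    by (intro tendsto_intros Suc ratio_lim) simp
  moreover have "\<forall>\<^sub>F m in sequentially.
      real ((m + a) choose k) / real m ^ k * ((real m + (real a - real k)) / real m) / real (Suc k)
      = real ((m + a) choose Suc k) / real m ^ Suc k"
    using eventually_gt_at_top[of k]
  proof eventually_elim
    case (elim m)
    obtain n where n: "m + a = Suc n" using elim by (cases "m + a") auto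
    have "Suc k * ((m + a) choose Suc k) = (m + a) * (n choose k)" unfolding n by (rule Suc_times_binomial)
    also have "\<dots> = (m + a - k) * ((m + a) choose k)"
      using binomial_absorb_comp[of "m + a" k] n by simp
    finally have "real (Suc k) * real ((m + a) choose Suc k) = real (m + a - k) * real ((m + a) choose k)"
      unfolding of_nat_mult[symmetric] by simp
    moreover have "real (m + a - k) = real m + (real a - real k)" using elim by (simp add: of_nat_diff)
    ultimately have "real ((m + a) choose Suc k) = (real m + (real a - real k)) * real ((m + a) choose k) / real (Suc k)"
      by (simp add: field_simps)
    thus ?case by (simp add: mult_ac)
  qed
  ultimately have "(\<lambda>m. real ((m + a) choose Suc k) / real m ^ Suc k) \<longlonglongrightarrow> 1 / fact k * 1 / real (Suc k)"
    by (rule Lim_transform_eventually)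
  thus ?case by (simp add: field_simps)
qed simp

lemma lim_div_power:
  assumes "(\<lambda>m. f m / real m ^ k) \<longlonglongrightarrow> L" shows "(\<lambda>m. f m / real m ^ Suc k) \<longlonglongrightarrow> 0"
proof -
  have "(\<lambda>m. f m / real m ^ k * inverse (real m)) \<longlonglongrightarrow> L * 0"
    by (intro tendsto_mult assms lim_inverse_n)
  thus ?thesis by (simp add: field_simps)
qed

text \<open>Splits off the leading coefficient. The alternating signs turn the rest into a negated
  polynomial of the same shape.\<close>

lemma hilb_poly_shift:
  "hilb_poly (Suc D) e m = e 0 * int ((m + D) choose Suc D) - hilb_poly D (\<lambda>i. e (Suc i)) m"
  unfolding hilb_poly_def by (simp add: sum.atMost_Suc_shift sum_negf[symmetric] del: sum.atMost_Suc)

text \<open>Evaluated at \<open>Suc m\<close>, where the leading binomial coefficient is (m + D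
  choose D), without subtraction.\<close>

lemma hilb_poly_lim: "(\<lambda>m. real_of_int (hilb_poly D e (Suc m)) / real m ^ D) \<longlonglongrightarrow> real_of_int (e 0) / fact D"
proof (induct D arbitrary: e)
  case 0 show ?case by (simp add: hilb_poly_def)
next
  case (Suc D)
  have "(\<lambda>m. real_of_int (e 0) * (real ((m + Suc D) choose Suc D) / real m ^ Suc D)
      - real_of_int (hilb_poly D (\<lambda>i. e (Suc i)) (Suc m)) / real m ^ Suc D) \<longlonglongrightarrow> real_of_int (e 0) * (1 / fact (Suc D)) - 0"
    by (intro tendsto_diff tendsto_mult tendsto_const binomial_lim lim_div_power[OF Suc])
  moreover have "real_of_int (hilb_poly (Suc D) e (Suc m)) / real m ^ Suc D =
      real_of_int (e 0) * (real ((m + Suc D) choose Suc D) / real m ^ Suc D)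
      - real_of_int (hilb_poly D (\<lambda>i. e (Suc i)) (Suc m)) / real m ^ Suc D" for m
    unfolding hilb_poly_shift by (simp add: diff_divide_distrib del: binomial_Suc_Suc)
  ultimately show ?case by (simp only: mult_1_right times_divide_eq_right diff_zero)
qed

lemma Suc_power_lim: "(\<lambda>m. real (Suc m) ^ k / real m ^ k) \<longlonglongrightarrow> 1"
proof -
  have "(\<lambda>m. ((real m + 1) / real m) ^ k) \<longlonglongrightarrow> 1 ^ k" by (intro tendsto_power ratio_lim)
  thus ?thesis by (simp add: power_divide add.commute)
qed

lemma lim_Suc:
  assumes "(\<lambda>m. f m / real m ^ k) \<longlonglongrightarrow> L" shows "(\<lambda>m. f (Suc m) / real m ^ k) \<longlonglongrightarrow> L"
proof -
  have "(\<lambda>m. f (Suc m) / real (Suc m) ^ k * (real (Suc m) ^ k / real m ^ k)) \<longlonglongrightarrow> L * 1"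
    by (intro tendsto_mult Suc_power_lim LIMSEQ_Suc[OF assms])
  thus ?thesis by simp
qed

lemma slow_lim: "slow s f \<Longrightarrow> (\<lambda>m. real (f m) / real m ^ s) \<longlonglongrightarrow> 0"
proof (cases s)
  case 0
  assume "slow s f"
  then obtain m0 where m0: "\<And>m. m \<ge> m0 \<Longrightarrow> f m = 0" using 0 by auto
  have "\<forall>\<^sub>F m in sequentially. 0 = real (f m) / real m ^ s"
    using eventually_ge_at_top[of m0] by eventually_elim (simp add: m0)
  thus ?thesis by (rule Lim_transform_eventually[OF tendsto_const])
next
  case (Suc t)
  assume "slow s f"
  then obtain C m0 where C: "\<And>m. m \<ge> m0 \<Longrightarrow> f m \<le> C * m ^ t" using Suc by auto
  have "(\<lambda>m. real C * inverse (real m)) \<longlonglongrightarrow> real C * 0" by (intro tendsto_intros lim_inverse_n)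
  moreover have "\<forall>\<^sub>F m in sequentially. real (f m) / real m ^ s \<le> real C * inverse (real m)"
    using eventually_gt_at_top[of m0]
  proof eventually_elim
    case (elim m)
    have "real (f m) \<le> real (C * m ^ t)" using C[of m] elim by (simp only: of_nat_le_iff less_imp_le)
    hence "real (f m) / real m ^ s \<le> real (C * m ^ t) / real m ^ s" by (intro divide_right_mono) auto
    also have "\<dots> = real C * inverse (real m)" using elim Suc by (simp add: field_simps)
    finally show ?case .
  qed
  ultimately show ?thesis
    by (intro tendsto_sandwich[of "\<lambda>_. 0" "\<lambda>m. real (f m) / real m ^ s" sequentially "\<lambda>m. real C * inverse (real m)"]) auto
qed

lemma hilb_poly_raise: "hilb_poly (Suc n) (\<lambda>i. case i of 0 \<Rightarrow> 0 | Suc i \<Rightarrow> - e i) m = hilb_poly n e m"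
  unfolding hilb_poly_shift by (simp add: hilb_poly_def sum_negf)

text \<open>\<open>fiber_polynomial\<close> says nothing about the degree n. Values between 0 and
  O(m^D) force leading coefficients above degree D to vanish one after another; a smaller n is
  padded by \<open>hilb_poly_raise\<close>.\<close>

lemma hilb_poly_degree:
  assumes lim: "(\<lambda>m. X m / real m ^ D) \<longlonglongrightarrow> L"
    and bnd: "\<And>m. m \<ge> m0 \<Longrightarrow> 0 \<le> hilb_poly n e (Suc m) \<and> real_of_int (hilb_poly n e (Suc m)) \<le> X m"
  shows "\<exists>e'. \<forall>m. hilb_poly n e m = hilb_poly D e' m"
proof (cases "n \<le> D")
  case True
  thus ?thesis
  proof (induct D rule: dec_induct)
    case base show ?case by blast
  next
    case (step k)
    then obtain e' where "\<forall>m. hilb_poly n e m = hilb_poly k e' m" by blast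
    thus ?case using hilb_poly_raise[of k e'] by metis
  qed
next
  case False
  hence "D \<le> n" by simp
  thus ?thesis using bnd
  proof (induct n arbitrary: e rule: dec_induct)
    case base show ?case by blast
  next
    case (step n e)
    have X: "(\<lambda>m. X m / real m ^ Suc n) \<longlonglongrightarrow> 0" using step(1)
    proof (induct n rule: dec_induct)
      case base show ?case by (rule lim_div_power[OF lim])
    next
      case (step k) thus ?case using lim_div_power by blast
    qed
    have lo: "\<forall>\<^sub>F m in sequentially. 0 \<le> real_of_int (hilb_poly (Suc n) e (Suc m)) / real m ^ Suc n"
      using eventually_ge_at_top[of m0] by eventually_elim (simp add: step(4) del: power_Suc)
    have hi: "\<forall>\<^sub>F m in sequentially. real_of_int (hilb_poly (Suc n) e (Suc m)) / real m ^ Suc n \<le> X m / real m ^ Suc n"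
      using eventually_ge_at_top[of m0] by eventually_elim (simp add: step(4) divide_right_mono del: power_Suc)
    have "(\<lambda>m. real_of_int (hilb_poly (Suc n) e (Suc m)) / real m ^ Suc n) \<longlonglongrightarrow> 0"
      by (rule tendsto_sandwich[OF lo hi tendsto_const X])
    hence "real_of_int (e 0) / fact (Suc n) = 0" by (rule LIMSEQ_unique[OF hilb_poly_lim])
    hence e0: "e 0 = 0" by simp
    have eq: "hilb_poly (Suc n) e m = hilb_poly n (\<lambda>i. - e (Suc i)) m" for m
      unfolding hilb_poly_shift e0 by (simp add: hilb_poly_def sum_negf)
    show ?case unfolding eq using step(4) by (intro step(3)) (simp add: eq)
  qed
qed

text \<open>Real polynomials of degree below s, the terms of lower degree in
  \<open>fiber_multiplicity\<close>.\<close>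

definition poly_fun :: "nat \<Rightarrow> (nat \<Rightarrow> real) \<Rightarrow> bool" where
  "poly_fun s h \<longleftrightarrow> (\<exists>c. \<forall>m. h m = (\<Sum>j<s. c j * real m ^ j))"

lemma poly_fun_add: "poly_fun s f \<Longrightarrow> poly_fun s g \<Longrightarrow> poly_fun s (\<lambda>m. f m + g m)"
proof -
  assume "poly_fun s f" "poly_fun s g"
  then obtain c c' where "\<forall>m. f m = (\<Sum>j<s. c j * real m ^ j)" "\<forall>m. g m = (\<Sum>j<s. c' j * real m ^ j)"
    unfolding poly_fun_def by blast
  hence "\<forall>m. f m + g m = (\<Sum>j<s. (c j + c' j) * real m ^ j)" by (simp add: sum.distrib distrib_right)
  thus ?thesis unfolding poly_fun_def by (intro exI[of _ "\<lambda>j. c j + c' j"])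
qed

lemma poly_fun_cmult: "poly_fun s f \<Longrightarrow> poly_fun s (\<lambda>m. b * f m)"
proof -
  assume "poly_fun s f"
  then obtain c where "\<forall>m. f m = (\<Sum>j<s. c j * real m ^ j)" unfolding poly_fun_def by blast
  hence "\<forall>m. b * f m = (\<Sum>j<s. (b * c j) * real m ^ j)" by (simp add: sum_distrib_left mult.assoc)
  thus ?thesis unfolding poly_fun_def by (intro exI[of _ "\<lambda>j. b * c j"])
qed

lemma poly_fun_Suc: "poly_fun s f \<Longrightarrow> poly_fun (Suc s) f"
proof -
  assume "poly_fun s f"
  then obtain c where "\<forall>m. f m = (\<Sum>j<s. c j * real m ^ j)" unfolding poly_fun_def by blast
  hence "\<forall>m. f m = (\<Sum>j<Suc s. (c(s := 0)) j * real m ^ j)" by simp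
  thus ?thesis unfolding poly_fun_def by (intro exI[of _ "c(s := 0)"])
qed

lemma poly_fun_mult: "poly_fun s f \<Longrightarrow> poly_fun (Suc s) (\<lambda>m. real m * f m)"
proof -
  assume "poly_fun s f"
  then obtain c where "\<forall>m. f m = (\<Sum>j<s. c j * real m ^ j)" unfolding poly_fun_def by blast
  hence "\<forall>m. real m * f m = (\<Sum>j<Suc s. (case j of 0 \<Rightarrow> 0 | Suc i \<Rightarrow> c i) * real m ^ j)"
    by (simp add: sum.lessThan_Suc_shift sum_distrib_left mult.left_commute del: sum.lessThan_Suc)
  thus ?thesis unfolding poly_fun_def by (intro exI[of _ "\<lambda>j. case j of 0 \<Rightarrow> 0 | Suc i \<Rightarrow> c i"])
qed

lemma poly_fun_binomial: "poly_fun (Suc k) (\<lambda>m. real ((m + k) choose k))"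
proof (induct k)
  case 0
  have "\<forall>m. real ((m + 0) choose 0) = (\<Sum>j<Suc 0. 1 * real m ^ j)" by simp
  thus ?case unfolding poly_fun_def by (intro exI[of _ "\<lambda>_. 1"])
next
  case (Suc k)
  have "real ((m + Suc k) choose Suc k) = inverse (real (Suc k)) * (real m * real ((m + k) choose k)
      + real (Suc k) * real ((m + k) choose k))" for m
  proof -
    have "Suc k * ((m + Suc k) choose Suc k) = Suc (m + k) * ((m + k) choose k)"
      using Suc_times_binomial[of k "m + k"] by (simp only: add_Suc_right)
    hence "real (Suc k * ((m + Suc k) choose Suc k)) = real (Suc (m + k) * ((m + k) choose k))" by (rule arg_cong)
    hence "real (Suc k) * real ((m + Suc k) choose Suc k) = real (Suc (m + k)) * real ((m + k) choose k)"
      by (simp only: of_nat_mult)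
    hence "real ((m + Suc k) choose Suc k) = inverse (real (Suc k)) * (real (Suc (m + k)) * real ((m + k) choose k))"
      by (simp add: field_simps del: binomial_Suc_Suc of_nat_Suc)
    thus ?thesis by (simp add: algebra_simps)
  qed
  moreover have "poly_fun (Suc (Suc k)) (\<lambda>m. inverse (real (Suc k)) * (real m * real ((m + k) choose k)
      + real (Suc k) * real ((m + k) choose k)))"
    by (intro poly_fun_cmult poly_fun_add poly_fun_mult poly_fun_Suc Suc)
  ultimately show ?case by presburger
qed

text \<open>\<open>hilb_poly\<close> starts with (m + D - 1 choose D),
  \<open>fiber_multiplicity\<close> with (m + D choose D). The shift changes lower terms only, so
  \<open>e 0\<close> is the multiplicity.\<close>

lemma poly_fun_hilb_poly:
  "poly_fun D (\<lambda>m. real_of_int (hilb_poly D e m) - real_of_int (e 0) * real ((m + D) choose D))"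
proof (induct D arbitrary: e)
  case 0
  show ?case unfolding poly_fun_def by (simp add: hilb_poly_def)
next
  case (Suc D)
  let ?e = "\<lambda>i. e (Suc i)"
  have "poly_fun (Suc D) (\<lambda>m. (-1) * ((real_of_int (hilb_poly D ?e m) - real_of_int (?e 0) * real ((m + D) choose D)))
     + (- real_of_int (e 0) - real_of_int (?e 0)) * real ((m + D) choose D))"
    by (intro poly_fun_add poly_fun_cmult poly_fun_Suc[OF Suc] poly_fun_binomial)
  moreover have "real_of_int (hilb_poly (Suc D) e m) - real_of_int (e 0) * real ((m + Suc D) choose Suc D)
    = (-1) * ((real_of_int (hilb_poly D ?e m) - real_of_int (?e 0) * real ((m + D) choose D)))
     + (- real_of_int (e 0) - real_of_int (?e 0)) * real ((m + D) choose D)" for m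
  proof -
    have "real ((m + Suc D) choose Suc D) = real ((m + D) choose D) + real ((m + D) choose Suc D)" by simp
    thus ?thesis unfolding hilb_poly_shift by (simp add: algebra_simps del: binomial_Suc_Suc)
  qed
  ultimately show ?case by presburger
qed

lemma power_lim: "j < D \<Longrightarrow> (\<lambda>m. real m ^ j / real m ^ D) \<longlonglongrightarrow> 0"
proof (induct D)
  case (Suc D)
  show ?case
  proof (cases "j = D")
    case True
    have "\<forall>\<^sub>F m in sequentially. (1::real) = real m ^ j / real m ^ D"
      using eventually_gt_at_top[of 0] by eventually_elim (simp add: True)
    hence "(\<lambda>m. real m ^ j / real m ^ D) \<longlonglongrightarrow> 1" by (rule Lim_transform_eventually[OF tendsto_const])
    thus ?thesis by (rule lim_div_power)
  next
    case False
    hence "(\<lambda>m. real m ^ j / real m ^ D) \<longlonglongrightarrow> 0" using Suc by simp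
    thus ?thesis by (rule lim_div_power)
  qed
qed simp

lemma leading_coeff_unique:
  assumes "\<forall>\<^sub>F m in sequentially. u m = real_of_int f * real ((m + D) choose D) + (\<Sum>j<D. c j * real m ^ j)"
  shows "(\<lambda>m. u m / real m ^ D) \<longlonglongrightarrow> real_of_int f / fact D"
proof -
  have "(\<lambda>m. real_of_int f * (real ((m + D) choose D) / real m ^ D) + (\<Sum>j<D. c j * (real m ^ j / real m ^ D)))
    \<longlonglongrightarrow> real_of_int f * (1 / fact D) + (\<Sum>j<D. c j * 0)"
    by (intro tendsto_add tendsto_mult tendsto_const tendsto_sum binomial_lim power_lim) simp
  moreover have "\<forall>\<^sub>F m in sequentially. real_of_int f * (real ((m + D) choose D) / real m ^ D)
      + (\<Sum>j<D. c j * (real m ^ j / real m ^ D)) = u m / real m ^ D"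
    using assms by eventually_elim (simp add: add_divide_distrib sum_divide_distrib)
  ultimately have "(\<lambda>m. u m / real m ^ D) \<longlonglongrightarrow> real_of_int f * (1 / fact D) + (\<Sum>j<D. c j * 0)"
    by (rule Lim_transform_eventually)
  thus ?thesis by simp
qed

section \<open>The coefficients selected by the definite descriptions\<close>

context noetherian_local_ring
begin

lemma fiber_multiplicity_eq:
  assumes "d = Suc D" and g: "\<And>m. m \<ge> m0 \<Longrightarrow> int (min_gens R (pw I m)) = hilb_poly D g m"
  shows "fiber_multiplicity R d I = g 0"
  unfolding fiber_multiplicity_def
proof (rule the_equality)
  have d: "m + d - 1 = m + D" "d - 1 = D" for m using assms(1) by auto
  obtain c where c: "\<And>m. real_of_int (hilb_poly D g m) - real_of_int (g 0) * real ((m + D) choose D)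
    = (\<Sum>j<D. c j * real m ^ j)" using poly_fun_hilb_poly[of D g] unfolding poly_fun_def by blast
  have "\<forall>\<^sub>F m in sequentially. real (min_gens R (ideal_power R I m)) =
      real_of_int (g 0) * real ((m + d - 1) choose (d - 1)) + (\<Sum>j<d - 1. c j * real m ^ j)"
    using eventually_ge_at_top[of m0]
  proof eventually_elim
    case (elim m)
    have "real (min_gens R (pw I m)) = real_of_int (hilb_poly D g m)" using g[OF elim] by (metis of_int_of_nat_eq)
    thus ?case using c[of m] unfolding d by (simp add: pw_def)
  qed
  thus ex: "\<exists>c. \<forall>\<^sub>F m in sequentially. real (min_gens R (ideal_power R I m)) =
      real_of_int (g 0) * real ((m + d - 1) choose (d - 1)) + (\<Sum>j<d - 1. c j * real m ^ j)" by blast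
  fix f assume "\<exists>c. \<forall>\<^sub>F m in sequentially. real (min_gens R (ideal_power R I m)) =
      real_of_int f * real ((m + d - 1) choose (d - 1)) + (\<Sum>j<d - 1. c j * real m ^ j)"
  then obtain c' where c': "\<forall>\<^sub>F m in sequentially. real (min_gens R (ideal_power R I m)) =
      real_of_int f * real ((m + D) choose D) + (\<Sum>j<D. c' j * real m ^ j)" unfolding d by blast
  obtain c where c: "\<forall>\<^sub>F m in sequentially. real (min_gens R (ideal_power R I m)) =
      real_of_int (g 0) * real ((m + D) choose D) + (\<Sum>j<D. c j * real m ^ j)" using ex unfolding d by blast
  have "real_of_int f / fact D = real_of_int (g 0) / fact D"
    by (rule LIMSEQ_unique[OF leading_coeff_unique[OF c'] leading_coeff_unique[OF c]])
  thus "f = g 0" by simp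
qed

lemma hilbert_coeff_eq:
  assumes I: "idl I" and e: "\<And>m. m \<ge> m0 \<Longrightarrow> int (nlen (pw I m) (carrier R)) = hilb_poly d e m" and i: "i \<le> d"
  shows "hilbert_coeff R d I i = e i"
proof -
  have col: "int (colength R (ideal_power R I m)) = int (nlen (pw I m) (carrier R))" for m
    using colength_eq[OF pw_idl[OF I]] by (simp add: pw_def)
  \<comment> \<open>Cut off above d, as the description in \<open>hilbert_coeff\<close> demands for
    uniqueness.\<close>
  let ?e = "\<lambda>i. if i \<le> d then e i else 0"
  have "hilbert_coeff R d I = ?e"
    unfolding hilbert_coeff_def hilb_poly_def[symmetric] col
  proof (rule the_equality)
    have "\<forall>\<^sub>F m in sequentially. int (nlen (pw I m) (carrier R)) = hilb_poly d ?e m"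
      using eventually_ge_at_top[of m0]
    proof eventually_elim
      case (elim m)
      have "hilb_poly d e m = hilb_poly d ?e m" by (rule hilb_poly_cong) simp
      thus ?case using e[OF elim] by simp
    qed
    thus "(\<forall>i>d. ?e i = 0) \<and> (\<forall>\<^sub>F m in sequentially. int (nlen (pw I m) (carrier R)) = hilb_poly d ?e m)" by simp
    fix e' assume e': "(\<forall>i>d. e' i = 0) \<and> (\<forall>\<^sub>F m in sequentially. int (nlen (pw I m) (carrier R)) = hilb_poly d e' m)"
    then obtain m1 where m1: "\<And>m. m \<ge> m1 \<Longrightarrow> int (nlen (pw I m) (carrier R)) = hilb_poly d e' m"
      unfolding eventually_sequentially by blast
    have "\<forall>i\<le>d. e' i = e i"
      by (rule hilb_poly_unique[of "max m0 m1"]) (use m1 e in \<open>metis max.bounded_iff\<close>)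
    thus "e' = ?e" using e' by (auto simp: fun_eq_iff)
  qed
  thus ?thesis using i by simp
qed

end

section \<open>The bound\<close>

context cohen_macaulay_local_ring
begin

lemma fiber_multiplicity_bound:
  assumes dim: "krull_dim R = ereal (real d)" and "d > 0"
    and inf: "infinite (carrier (R Quot \<mm>))"
    and "primary_to R \<mm> I"
  shows "fiber_multiplicity R d I \<le>
    hilbert_coeff R d I 1 - hilbert_coeff R d I 0 + int (colength R (check_ideal R d I))
      + int (min_gens R (check_ideal R d I)) - int d + 1"
proof -
  obtain D where D: "d = Suc D" using assms(2) by (cases d) auto
  have dep: "depth_ge d {\<zero>}"
  proof -
    have "\<exists>xs. set xs \<subseteq> \<mm> \<and> regular_sequence R xs \<and> d \<le> length xs"
    proof (rule ccontr)
      assume n: "\<not> ?thesis"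
      have "depth R \<mm> \<le> ereal (real D)"
        unfolding depth_def
      proof (rule Sup_least)
        fix z assume "z \<in> {ereal (real (length xs)) | xs. set xs \<subseteq> \<mm> \<and> regular_sequence R xs}"
        then obtain xs where xs: "set xs \<subseteq> \<mm>" "regular_sequence R xs" "z = ereal (real (length xs))" by blast
        hence "\<not> d \<le> length xs" using n by blast
        thus "z \<le> ereal (real D)" using xs(3) D by simp
      qed
      thus False using depth_eq_dim dim D by simp
    qed
    then obtain xs where xs: "set xs \<subseteq> \<mm>" "regular_sequence R xs" "d \<le> length xs" by blast
    show ?thesis by (rule depth_ge_le[OF regular_sequence_depth_ge[OF xs(1,2)] xs(3)])
  qed
  have Ii: "idl I" and rad: "radical R I = \<mm>" using assms(4) by (auto simp: primary_to_def primary_ideal_def)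
  have I\<mm>: "I \<subseteq> \<mm>"
  proof
    fix a assume a: "a \<in> I"
    have "a [^] (1::nat) \<in> I" using a idl_carr[OF Ii] by simp
    hence "a \<in> radical R I" unfolding radical_def using idl_carr[OF Ii a] by blast
    thus "a \<in> \<mm>" using rad by simp
  qed
  have I: "cofin I"
  proof -
    obtain S where S: "S \<subseteq> carrier R" "finite S" "\<mm> = Idl S" using fin_gen[OF \<mm>_idl] by blast
    have "\<exists>n::nat. s [^] n \<in> I" if "s \<in> S" for s
    proof -
      have "s \<in> radical R I" using rad S(3) genideal_self[OF S(1)] that by blast
      thus ?thesis by (simp add: radical_def)
    qed
    from pw_gen_le[OF S(2,1) Ii this] have "\<exists>N. pw \<mm> N \<subseteq> I" by (simp only: S(3)[symmetric])
    thus ?thesis using Ii by (simp add: cofin_def)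
  qed
  define K where "K = check_ideal R d I"
  have adm: "admissible (ereal (real d - 1)) I K" unfolding K_def by (rule check_ideal_admissible[OF Ii])
  have K: "idl K" "I \<subseteq> K" using adm by (auto simp: admissible_def)
  \<comment> \<open>Dimension at most d - 1 = D leaves no room for a chain of length d over the
    conductor.\<close>
  have nochain: "n < Suc D" if "graded_chain I n P" "rees_conductor I K \<le> P 0" for n P
    using admissible_no_chain[OF Ii adm that] D by simp
  have dep': "depth_ge (Suc D) {\<zero>}" using dep D by simp
  define \<delta> where "\<delta> m = nlen (pw I m) (pw K m)" for m
  have slow: "slow D \<delta>" and K\<mm>: "K \<subseteq> \<mm>"
    using rees_cokernel_small[OF inf dep' I I\<mm> K nochain] by (simp_all add: \<delta>_def[abs_def])
  have cK: "cofin K" by (rule cofin_mono[OF I K(2,1)])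
  note pI = pw_idl[OF Ii] and pK = pw_idl[OF K(1)]
  have zsum: "{\<zero>} \<boxplus> A = A" if "idl A" for A using that by (intro sum_absorb2 zeroideal) (simp_all add: idl_zero)
  have z: "regular_ext 0 {\<zero>}" by (rule regular_ext.zero)
  obtain e m0 where e: "\<And>m. m \<ge> m0 \<Longrightarrow> int (nlen (pw I m) (carrier R)) = hilb_poly d e m"
    using hilbert_sequence[OF inf dim I I\<mm> z _ dep] idl_zero[OF Ii] by (auto simp: zsum[OF pI])
  obtain J eK m1 where J: "regular_ext d J" "J \<subseteq> K" and eK0: "eK 0 = int (nlen J (carrier R))"
    and eK: "\<And>m. m \<ge> m1 \<Longrightarrow> int (nlen (pw K m) (carrier R)) = hilb_poly d eK m"
    and ind: "enat d \<le> len (\<mm> \<cdot> K) (J \<boxplus> \<mm> \<cdot> K)"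
    using hilbert_sequence[OF inf dim cK K\<mm> z _ dep] idl_zero[OF K(1)]
    by (auto simp: zsum[OF pK] zsum[OF ideal_prod_is_ideal[OF \<mm>_idl K(1)]])
  have cJ: "cofin J" using regular_ext_\<mm>_power[OF J(1) dim] regular_ext_idl[OF J(1)] by (simp add: cofin_def)
  have lenIK: "nlen (pw I m) (carrier R) = \<delta> m + nlen (pw K m) (carrier R)" for m
    unfolding \<delta>_def by (rule nlen_add[OF cofin_pw[OF I] pK oneideal pw_mono[OF K(2)] idl_subset[OF pK]])
  have \<delta>_lim: "(\<lambda>m. real (\<delta> (Suc m)) / real m ^ D) \<longlonglongrightarrow> 0" by (rule lim_Suc[OF slow_lim[OF slow]])
  \<comment> \<open>The defect \<delta> is of lower order than m^D, so both Hilbert polynomials have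
    the same leading term.\<close>
  have e0: "e 0 = eK 0"
  proof -
    have "(\<lambda>m. real_of_int (hilb_poly d eK (Suc m)) / real m ^ d + real (\<delta> (Suc m)) / real m ^ d) \<longlonglongrightarrow>
      real_of_int (eK 0) / fact d + 0"
      unfolding D by (intro tendsto_add hilb_poly_lim lim_div_power[OF \<delta>_lim])
    moreover have "\<forall>\<^sub>F m in sequentially. real_of_int (hilb_poly d eK (Suc m)) / real m ^ d + real (\<delta> (Suc m)) / real m ^ d
      = real_of_int (hilb_poly d e (Suc m)) / real m ^ d"
      using eventually_ge_at_top[of "max m0 m1"]
    proof eventually_elim
      case (elim m)
      have "hilb_poly d e (Suc m) = hilb_poly d eK (Suc m) + int (\<delta> (Suc m))"
        using e[of "Suc m"] eK[of "Suc m"] lenIK[of "Suc m"] elim by simp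
      thus ?case by (simp add: add_divide_distrib)
    qed
    ultimately have "(\<lambda>m. real_of_int (hilb_poly d e (Suc m)) / real m ^ d) \<longlonglongrightarrow> real_of_int (eK 0) / fact d + 0"
      by (rule Lim_transform_eventually)
    hence "real_of_int (e 0) / fact d = real_of_int (eK 0) / fact d + 0" by (rule LIMSEQ_unique[OF hilb_poly_lim])
    thus ?thesis by simp
  qed
  \<comment> \<open>Since I lies in \<mm>, I^m/\<mm>I^m is a quotient of I^m/I^(m+1). This bounds
    the degree of the fiber polynomial by D.\<close>
  have min_le: "min_gens R (pw I m) \<le> nlen (pw I (Suc m)) (pw I m)" for m
  proof -
    have sub: "pw I (Suc m) \<subseteq> \<mm> \<cdot> pw I m" unfolding pw_Suc2[OF Ii] by (rule prod_mono[OF I\<mm> order_refl])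
    show ?thesis unfolding min_gens_nlen[OF pI]
      by (rule nlen_le[OF cofin_prod[OF cofin_\<mm> cofin_pw[OF I]] pI cofin_pw[OF I] pI])
         (rule len_mono[OF sub order_refl pI])
  qed
  obtain n g0 m2 where g0: "\<And>m. m \<ge> m2 \<Longrightarrow> int (min_gens R (pw I m)) = hilb_poly n g0 m"
    using fiber_polynomial[OF inf I] by blast
  have "\<exists>g. \<forall>m. hilb_poly n g0 m = hilb_poly D g m"
  proof (rule hilb_poly_degree)
    show "(\<lambda>m. real_of_int (hilb_poly D e (Suc (Suc m))) / real m ^ D) \<longlonglongrightarrow> real_of_int (e 0) / fact D"
      by (rule lim_Suc[OF hilb_poly_lim])
    show "0 \<le> hilb_poly n g0 (Suc m) \<and> real_of_int (hilb_poly n g0 (Suc m)) \<le> real_of_int (hilb_poly D e (Suc (Suc m)))"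
      if m: "m \<ge> max m0 m2" for m
    proof -
      have "nlen (pw I (Suc (Suc m))) (carrier R) = nlen (pw I (Suc (Suc m))) (pw I (Suc m)) + nlen (pw I (Suc m)) (carrier R)"
        by (rule nlen_add[OF cofin_pw[OF I] pI oneideal pw_antimono[OF Ii] idl_subset[OF pI]]) simp
      hence "int (nlen (pw I (Suc (Suc m))) (pw I (Suc m))) = hilb_poly d e (Suc (Suc m)) - hilb_poly d e (Suc m)"
        using e[of "Suc m"] e[of "Suc (Suc m)"] m by simp
      also have "\<dots> = hilb_poly D e (Suc (Suc m))" unfolding D by (rule hilb_poly_Suc_diff)
      finally have "int (min_gens R (pw I (Suc m))) \<le> hilb_poly D e (Suc (Suc m))" using min_le[of "Suc m"] by linarith
      moreover have "int (min_gens R (pw I (Suc m))) = hilb_poly n g0 (Suc m)" using g0[of "Suc m"] m by simp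
      ultimately show ?thesis by linarith
    qed
  qed
  then obtain g where "\<And>m. hilb_poly n g0 m = hilb_poly D g m" by blast
  hence g: "\<And>m. m \<ge> m2 \<Longrightarrow> int (min_gens R (pw I m)) = hilb_poly D g m" using g0 by simp
  obtain s where s: "\<And>X Y. cofin X \<Longrightarrow> cofin Y \<Longrightarrow> Y \<subseteq> X \<Longrightarrow> min_gens R Y \<le> min_gens R X + s * nlen Y X"
    using min_gens_compare by blast
  let ?mu = "min_gens R K" and ?l = "nlen K (carrier R)"
  let ?e = "\<lambda>i. e (Suc i)"
  \<comment> \<open>The coefficient of (m + D choose D) in the estimate, apart from the 1 from the
    monomials and from e_1.\<close>
  define B where "B = int ?mu + int ?l - int d - e 0"
  have bound: "hilb_poly D g (Suc m) \<le> (int s + 1) * int (\<delta> (Suc m)) + int ((m + Suc D) choose D)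
      + B * int ((m + D) choose D) + hilb_poly D ?e (Suc m)" if m: "m \<ge> max m0 m2" for m
  proof -
    let ?c = "(m + D) choose D" and ?c' = "(m + D) choose Suc D"
    have 1: "int (min_gens R (pw I (Suc m))) \<le> int (min_gens R (pw K (Suc m))) + int s * int (\<delta> (Suc m))"
      using s[OF cofin_pw[OF cK] cofin_pw[OF I] pw_mono[OF K(2)], of "Suc m"]
      unfolding \<delta>_def of_nat_mult[symmetric] of_nat_add[symmetric] of_nat_le_iff .
    have "min_gens R (pw K (Suc m)) + nlen (pw K (Suc m)) (carrier R) + ?c * d \<le>
      ((m + Suc D) choose D) + ?c * (?mu + ?l) + ?c' * nlen J (carrier R)"
      using main_estimate[OF J(1) cJ assms(2) cK J(2) ind, of m] unfolding D by simp
    hence "int (min_gens R (pw K (Suc m)) + nlen (pw K (Suc m)) (carrier R) + ?c * d) \<le>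
      int (((m + Suc D) choose D) + ?c * (?mu + ?l) + ?c' * nlen J (carrier R))" by (simp only: of_nat_le_iff)
    hence 2: "int (min_gens R (pw K (Suc m))) + int (nlen (pw K (Suc m)) (carrier R)) + int ?c * int d \<le>
      int ((m + Suc D) choose D) + int ?c * (int ?mu + int ?l) + int ?c' * e 0"
      using e0 eK0 by (simp only: of_nat_add of_nat_mult)
    \<comment> \<open>The Hilbert polynomial of I replaces that of K, so the coefficient e_1 of I
      enters directly.\<close>
    have 3: "int (nlen (pw K (Suc m)) (carrier R)) = hilb_poly d e (Suc m) - int (\<delta> (Suc m))"
      using e[of "Suc m"] lenIK[of "Suc m"] m by simp
    \<comment> \<open>The part with \<open>?c'\<close> cancels the bound for \<lambda>(R/J^m)
      because \<lambda>(R/J) = e_0. The part with \<open>?c\<close> is the origin of - e_0.\<close>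
    have "int ((Suc m + D) choose Suc D) = int ?c + int ?c'" by simp
    hence 4: "hilb_poly d e (Suc m) = e 0 * int ?c + e 0 * int ?c' - hilb_poly D ?e (Suc m)"
      unfolding D hilb_poly_shift by (simp only: distrib_left)
    have 5: "int (min_gens R (pw I (Suc m))) = hilb_poly D g (Suc m)" using g[of "Suc m"] m by simp
    show ?thesis using 1 2 3 4 5 by (simp add: B_def algebra_simps)
  qed
  \<comment> \<open>Division by m^D: each binomial coefficient tends to 1/D!, while the terms with
    \<delta> disappear.\<close>
  have "real_of_int (g 0) / fact D \<le> (real s + 1) * 0 + 1 / fact D + real_of_int B * (1 / fact D) + real_of_int (?e 0) / fact D"
  proof (rule LIMSEQ_le)
    show "(\<lambda>m. real_of_int (hilb_poly D g (Suc m)) / real m ^ D) \<longlonglongrightarrow> real_of_int (g 0) / fact D"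
      by (rule hilb_poly_lim)
    show "(\<lambda>m. (real s + 1) * (real (\<delta> (Suc m)) / real m ^ D) + real ((m + Suc D) choose D) / real m ^ D
        + real_of_int B * (real ((m + D) choose D) / real m ^ D) + real_of_int (hilb_poly D ?e (Suc m)) / real m ^ D)
      \<longlonglongrightarrow> (real s + 1) * 0 + 1 / fact D + real_of_int B * (1 / fact D) + real_of_int (?e 0) / fact D"
      by (intro tendsto_add tendsto_mult tendsto_const \<delta>_lim binomial_lim hilb_poly_lim)
    show "\<exists>N. \<forall>m\<ge>N. real_of_int (hilb_poly D g (Suc m)) / real m ^ D \<le>
        (real s + 1) * (real (\<delta> (Suc m)) / real m ^ D) + real ((m + Suc D) choose D) / real m ^ D
        + real_of_int B * (real ((m + D) choose D) / real m ^ D) + real_of_int (hilb_poly D ?e (Suc m)) / real m ^ D"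
    proof (intro exI allI impI)
      fix m assume m: "max m0 m2 \<le> m"
      have "real_of_int (hilb_poly D g (Suc m)) \<le> real_of_int ((int s + 1) * int (\<delta> (Suc m)) + int ((m + Suc D) choose D)
        + B * int ((m + D) choose D) + hilb_poly D ?e (Suc m))" using bound[OF m] by (simp only: of_int_le_iff)
      also have "\<dots> = (real s + 1) * real (\<delta> (Suc m)) + real ((m + Suc D) choose D)
        + real_of_int B * real ((m + D) choose D) + real_of_int (hilb_poly D ?e (Suc m))" by simp
      finally have "real_of_int (hilb_poly D g (Suc m)) / real m ^ D \<le> ((real s + 1) * real (\<delta> (Suc m))
        + real ((m + Suc D) choose D) + real_of_int B * real ((m + D) choose D)
        + real_of_int (hilb_poly D ?e (Suc m))) / real m ^ D" by (rule divide_right_mono) simp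
      thus "real_of_int (hilb_poly D g (Suc m)) / real m ^ D \<le>
        (real s + 1) * (real (\<delta> (Suc m)) / real m ^ D) + real ((m + Suc D) choose D) / real m ^ D
        + real_of_int B * (real ((m + D) choose D) / real m ^ D) + real_of_int (hilb_poly D ?e (Suc m)) / real m ^ D"
        by (simp add: add_divide_distrib)
    qed
  qed
  also have "\<dots> = real_of_int (1 + B + e 1) / fact D" by (simp add: add_divide_distrib)
  finally have "real_of_int (g 0) \<le> real_of_int (1 + B + e 1)" by (simp add: divide_le_cancel)
  hence "g 0 \<le> 1 + B + e 1" by (simp only: of_int_le_iff)
  moreover have "fiber_multiplicity R d I = g 0" by (rule fiber_multiplicity_eq[OF D g])
  moreover have "hilbert_coeff R d I 0 = e 0" "hilbert_coeff R d I 1 = e 1"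
    using hilbert_coeff_eq[OF Ii e] D by simp_all
  moreover have "colength R K = ?l" by (rule colength_eq[OF K(1)])
  ultimately show ?thesis unfolding B_def K_def[symmetric] by simp
qed

end

theorem corollary4p3:
  fixes R :: "('a, 'b) ring_scheme" and \<mm> I :: "'a set" and d :: nat
  assumes "cohen_macaulay_local_ring R \<mm>"
    and "krull_dim R = ereal (real d)" and "d > 0"
    and "infinite (carrier (R Quot \<mm>))"
    and "primary_to R \<mm> I"
  shows "fiber_multiplicity R d I \<le>
    hilbert_coeff R d I 1 - hilbert_coeff R d I 0 + int (colength R (check_ideal R d I))
      + int (min_gens R (check_ideal R d I)) - int d + 1"
  using assms by (rule cohen_macaulay_local_ring.fiber_multiplicity_bound)

end
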